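(* For all disjoint nonempty (finite) sequences $A$ and $B$ of distinct positive integers, $N^{\mathrm{uni}}_u((A),(B))$ is equal to $$\sum_{k\ge 1}\frac1k\sum_{\substack{(A_k\cdots A_1)=(A)\\ (B_1\cdots B_k)=(B)}}\ \prod_{i=1}^{k}N'_{\beta_+>\gamma_-(B_i)}((A_i\ 0))\ \prod_{j=1}^{k}N'_{\beta_-<\gamma_+(A_{j+1})}((B_j\ 0)),$$ where $A_{k+1}=A_1$, and the inner sum is over all pairs of ordered $k$-tuples $(A_1,\dots,A_k)$, $(B_1,\dots,B_k)$ of nonempty sequences such that the concatenation $A_k A_{k-1}\cdots A_1$ defines the same cycle as $A$ and the concatenation $B_1B_2\cdots B_k$ defines the same cycle as $B$.
   Context: Permutations are composed from right to left; $(i\ j)$ denotes a transposition and $(i\ i)$ the identity. For a nonempty sequence $D=d_1\cdots d_r$ of distinct nonnegative integers, $(D)$ is the cycle $d_1\mapsto d_2\mapsto\cdots\mapsto d_r\mapsto d_1$, a permutation of the set $\{d_1,\dots,d_r\}$; two sequences define the same cycle iff one is a cyclic rotation of the other. $(D\ 0)$ is the cycle of the sequence $D$ followed by $0$. Let $\gamma_-(D)=d_1$ be the first and $\gamma_+(D)=d_r$ the last element of $D$. Let $S=\{s_1<\cdots<s_r\}$ be a finite set of nonnegative integers and $\pi$ a permutation of $S$. A representation of $\pi$ is a family $(a_s)_{s\in S}$ of elements of $S$ with $\pi=(s_r\ a_{s_r})\cdots(s_2\ a_{s_2})(s_1\ a_{s_1})$. Its digraph has vertex set $S$ and an edge from $s$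 to $a_s$ for each $s\in S$ (loops allowed). Every connected component contains a unique directed cycle (possibly a loop), called its ring. The representation is a tree if the digraph is connected and its ring has length 1; the vertex $x$ with $a_x=x$ is then the root. It is a unicycle if the digraph is connected and its ring has length at least 2. In a unicycle, a ring vertex is upper if its predecessor in the ring (the ring vertex with an edge to it) has a smaller label, and lower if its predecessor in the ring has a larger label. The permutation represented by a unicycle is a product of two disjoint cycles (1-cycles allowed), one of which, the upper cycle, contains all the upper vertices, and the other of which, the lower cycle, contains all the lower vertices. $N^{\mathrm{uni}}_u((A),(B))$ is the number of representations of the permutation $(A)(B)$ (of the set of entries of $A$ and $B$) as a unicycle for which $(A)$ is the upper cycle. For a tree $T$ with root $0$, $\beta_+(T)$ (resp. $\beta_-(T)$) denotes the largest (resp. smallest) vertex $v\ne 0$ adjacent to $0$. For a permutation $\pi$ of a set of nonnegative integers containing $0$, $N'_{\beta_+>x}(\pi)$ is the number of representations of $\pi$ as a tree $T$ with root $0$ and $\beta_+(T)>x$, and $N'_{\beta_-<x}(\pi)$ is the number of representations of $\pi$ as a tree $T$ with root $0$ and $\beta_-(T)<x$. *)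

theory Defs
  imports
    "HOL-Analysis.Infinite_Sum"
    "HOL-Combinatorics.Cycles"
    "HOL-Library.FuncSet"
begin

(* A permutation of a finite set S is a function that is the identity outside S. It does not
   determine S (all 1-cycles are the identity function), so S is always given alongside it. *)

definition same_cycle :: "nat list \<Rightarrow> nat list \<Rightarrow> bool" where
  "same_cycle D E \<longleftrightarrow>
     distinct D \<and> distinct E \<and> set D = set E \<and> cycle_of_list D = cycle_of_list E"

(* For S = {s1 < ... < sr}: (sr a_sr) o ... o (s1 a_s1); fold composes s1 first, i.e. rightmost. *)
definition represented_perm :: "nat set \<Rightarrow> (nat \<Rightarrow> nat) \<Rightarrow> nat \<Rightarrow> nat" where
  "represented_perm S a =
     fold (\<lambda>s p. transpose s (a s) \<circ> p) (sorted_list_of_set S) id"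

definition representations :: "nat set \<Rightarrow> (nat \<Rightarrow> nat) \<Rightarrow> (nat \<Rightarrow> nat) set" where
  "representations S \<pi> = {a \<in> S \<rightarrow>\<^sub>E S. represented_perm S a = \<pi>}"

definition edges :: "nat set \<Rightarrow> (nat \<Rightarrow> nat) \<Rightarrow> (nat \<times> nat) set" where
  "edges S a = {(s, a s) | s. s \<in> S}"

definition connected_digraph :: "nat set \<Rightarrow> (nat \<Rightarrow> nat) \<Rightarrow> bool" where
  "connected_digraph S a \<longleftrightarrow>
     S \<noteq> {} \<and> (\<forall>u\<in>S. \<forall>v\<in>S. (u, v) \<in> (edges S a \<union> (edges S a)\<inverse>)\<^sup>*)"

(* The vertices on directed cycles. Every vertex has out-degree 1, so in a connected digraph
   they form a single directed cycle, the ring, whose length is their number. *)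
definition ring_vertices :: "nat set \<Rightarrow> (nat \<Rightarrow> nat) \<Rightarrow> nat set" where
  "ring_vertices S a = {v \<in> S. (v, v) \<in> (edges S a)\<^sup>+}"

definition is_tree :: "nat set \<Rightarrow> (nat \<Rightarrow> nat) \<Rightarrow> bool" where
  "is_tree S a \<longleftrightarrow> connected_digraph S a \<and> card (ring_vertices S a) = 1"

definition is_tree_with_root :: "nat set \<Rightarrow> (nat \<Rightarrow> nat) \<Rightarrow> nat \<Rightarrow> bool" where
  "is_tree_with_root S a x \<longleftrightarrow> is_tree S a \<and> x \<in> S \<and> a x = x"

definition is_unicycle :: "nat set \<Rightarrow> (nat \<Rightarrow> nat) \<Rightarrow> bool" where
  "is_unicycle S a \<longleftrightarrow> connected_digraph S a \<and> card (ring_vertices S a) \<ge> 2"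

definition upper_vertices :: "nat set \<Rightarrow> (nat \<Rightarrow> nat) \<Rightarrow> nat set" where
  "upper_vertices S a =
     {v \<in> ring_vertices S a. \<exists>u \<in> ring_vertices S a. (u, v) \<in> edges S a \<and> u < v}"

definition lower_vertices :: "nat set \<Rightarrow> (nat \<Rightarrow> nat) \<Rightarrow> nat set" where
  "lower_vertices S a =
     {v \<in> ring_vertices S a. \<exists>u \<in> ring_vertices S a. (u, v) \<in> edges S a \<and> u > v}"

(* The last two conditions say that (A), rather than (B), is the upper cycle. *)
definition N_uni_u :: "nat list \<Rightarrow> nat list \<Rightarrow> nat" where
  "N_uni_u A B =
     card {a \<in> representations (set A \<union> set B) (cycle_of_list A \<circ> cycle_of_list B).
             is_unicycle (set A \<union> set B) a \<and>
             upper_vertices (set A \<union> set B) a \<subseteq> set A \<and>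
             lower_vertices (set A \<union> set B) a \<subseteq> set B}"

definition zero_neighbours :: "nat set \<Rightarrow> (nat \<Rightarrow> nat) \<Rightarrow> nat set" where
  "zero_neighbours S a = {v. v \<noteq> 0 \<and> ((v, 0) \<in> edges S a \<or> (0, v) \<in> edges S a)}"

(* Meaningful only if 0 has a neighbour, as in every tree with root 0 and at least two vertices. *)
definition beta_plus :: "nat set \<Rightarrow> (nat \<Rightarrow> nat) \<Rightarrow> nat" where
  "beta_plus S a = Max (zero_neighbours S a)"

definition beta_minus :: "nat set \<Rightarrow> (nat \<Rightarrow> nat) \<Rightarrow> nat" where
  "beta_minus S a = Min (zero_neighbours S a)"

definition N'_beta_plus_gt :: "nat \<Rightarrow> nat set \<Rightarrow> (nat \<Rightarrow> nat) \<Rightarrow> nat" where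
  "N'_beta_plus_gt x S \<pi> =
     card {a \<in> representations S \<pi>. is_tree_with_root S a 0 \<and> beta_plus S a > x}"

definition N'_beta_minus_lt :: "nat \<Rightarrow> nat set \<Rightarrow> (nat \<Rightarrow> nat) \<Rightarrow> nat" where
  "N'_beta_minus_lt x S \<pi> =
     card {a \<in> representations S \<pi>. is_tree_with_root S a 0 \<and> beta_minus S a < x}"

(* The k-tuples (A_1, ..., A_k), (B_1, ..., B_k) are lists, with As ! i = A_(i+1) and
   Bs ! i = B_(i+1). The set is finite for every k, and empty for k > length A. *)
definition decompositions ::
    "nat list \<Rightarrow> nat list \<Rightarrow> nat \<Rightarrow> (nat list list \<times> nat list list) set" where
  "decompositions A B k =
     {(As, Bs). length As = k \<and> length Bs = k \<and>
        (\<forall>D \<in> set As \<union> set Bs. D \<noteq> []) \<and>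
        same_cycle (concat (rev As)) A \<and> same_cycle (concat Bs) B}"

end

theory Submission
  imports Defs
begin

text \<open>Read a product of the transpositions \<open>(s a\<^sub>s)\<close> as a process in time: at time \<open>s\<close> the tokens on the
vertices \<open>s\<close> and \<open>a\<^sub>s\<close> change places. In a tree the edge of \<open>s\<close> is the only way out of the subtree
below \<open>s\<close>, and it is used once. Hence a token that ends at the root only moves up, and a token that
starts at the root only moves down (\<open>rising_token_step\<close>, \<open>falling_token_step\<close>).

The ring of a unicycle splits into maximal runs of upper vertices, along which the labels increase,
and of lower vertices, along which they decrease; the two kinds alternate, so there are \<open>2k\<close> runs.
Accordingly the two cycles of the permutation split into segments, one for each run, and the vertices of
each segment form a tree whose root is a new vertex 0 that stands for the rest of the ring. In the
tree of an upper run \<open>v\<^sub>1 < \<dots> < v\<^sub>p\<close> the token that starts at \<open>v\<^sub>1\<close> climbs along the run to 0. So the cycle of this tree is \<open>(A\<^sub>i 0)\<close> with last entry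
\<open>v\<^sub>1\<close> of \<open>A\<^sub>i\<close>, and \<open>v\<^sub>p\<close> is the largest child of 0. In the tree of a lower run \<open>u\<^sub>1 > \<dots> > u\<^sub>q\<close> the
token that starts at 0 descends from \<open>u\<^sub>q\<close>, the smallest child of 0, to \<open>u\<^sub>1\<close>. So the cycle of this
tree is \<open>(B\<^sub>i 0)\<close> with first entry \<open>u\<^sub>1\<close> of \<open>B\<^sub>i\<close>. This token is called the walker of the tree, and the
ring consists of the paths of the walkers. The two inequalities in the formula say that the ring
descends from the end of an upper run to the start of the next lower run and ascends from the end of
a lower run to the start of the next upper run.

To glue trees back together, the root 0 of a tree is identified at each time with a ring vertex: the
position of the walker of the next tree or, while that walker is at its own root, the position of the
walker of the tree after the next. Under this moving identification all tokens other than the walkers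
move in the unicycle exactly as they do in the trees (\<open>place_step\<close>, \<open>token_glue\<close>). This yields the two
cycles of the glued unicycle as the concatenations \<open>A\<^sub>k \<dots> A\<^sub>1\<close> and \<open>B\<^sub>1 \<dots> B\<^sub>k\<close> (\<open>glue_cycles\<close>).

The same rule tells how to cut: a vertex off the ring is separated from its target exactly if at the
time of its edge the target is the position of a walker. So the trees are determined by the glued unicycle
once it is known which run comes first (\<open>tree_necklace_unique\<close>), and every unicycle arises (locale
\<open>marked_unicycle\<close>). The choice of the first run amounts to marking one of the \<open>k\<close> places where the
ring turns from a lower to an upper vertex; the factor \<open>1/k\<close> removes this mark (\<open>card_unicycles\<close>).\<close>

section \<open>Time-ordered products of transpositions, followed token by token\<close>

lemma funpow_in: "u \<in> S \<Longrightarrow> a \<in> S \<rightarrow> S \<Longrightarrow> (a ^^ n) u \<in> S"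
  by (induction n) auto

lemma funpow_fixpoint: "h x = x \<Longrightarrow> (h ^^ i) x = x"
  by (induction i) auto

text \<open>A time that is not the label of an edge is given \<open>f s = s\<close>, so that nothing happens at it. With this
convention the product no longer refers to the set of labels.\<close>

primrec token :: "(nat \<Rightarrow> nat) \<Rightarrow> nat \<Rightarrow> nat \<Rightarrow> nat" where
  "token f 0 x = x"
| "token f (Suc t) x = transpose t (f t) (token f t x)"

lemma represented_perm_eq_token:
  assumes "S \<subseteq> {..<n}"
  shows "represented_perm S a = token (\<lambda>s. if s \<in> S then a s else s) n"
  using assms
proof (induction n arbitrary: S)
  case 0
  then show ?case by (auto simp: represented_perm_def)
next
  case (Suc n)
  let ?S = "S - {n}"
  have S': "?S \<subseteq> {..<n}" using Suc.prems by (auto simp: less_Suc_eq)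
  have cong: "token (\<lambda>s. if s \<in> ?S then a s else s) t = token (\<lambda>s. if s \<in> S then a s else s) t"
    if "t \<le> n" for t
    using that by (induction t) auto
  have IH: "represented_perm ?S a = token (\<lambda>s. if s \<in> S then a s else s) n"
    using Suc.IH[OF S'] cong by simp
  show ?case
  proof (cases "n \<in> S")
    case True
    have fin: "finite ?S" using S' finite_subset by blast
    have "sorted_list_of_set (insert n ?S) = sorted_list_of_set ?S @ [n]"
      using fin S' by (subst sorted_list_of_set_insert_remove) (auto intro!: sorted_insort_is_snoc simp: less_imp_le)
    then have "sorted_list_of_set S = sorted_list_of_set ?S @ [n]"
      using True by (simp add: insert_absorb)
    then have "represented_perm S a = transpose n (a n) \<circ> represented_perm ?S a"
      by (simp add: represented_perm_def)
    then show ?thesis using IH True by (auto simp: fun_eq_iff)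
  next
    case False
    then show ?thesis using IH by (auto simp: fun_eq_iff)
  qed
qed

lemma bij_token: "bij (token f t)"
proof (induction t)
  case (Suc t)
  have "token f (Suc t) = transpose t (f t) \<circ> token f t" by (auto simp: fun_eq_iff)
  then show ?case using Suc bij_comp[OF Suc bij_transpose] by metis
qed (simp add: bij_def inj_def surj_def)

lemma token_inj [simp]: "token f t x = token f t y \<longleftrightarrow> x = y"
  using bij_token[of f t] by (auto simp: bij_def inj_def)

lemma token_outside:
  assumes "\<And>s. s \<in> X \<Longrightarrow> f s \<in> X" "\<And>s. s \<notin> X \<Longrightarrow> f s = s"
  shows "token f t x \<in> X \<longleftrightarrow> x \<in> X" "x \<notin> X \<Longrightarrow> token f t x = x"
proof -
  have *: "transpose s (f s) y \<in> X \<longleftrightarrow> y \<in> X" for s y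
    using assms[of s] by (cases "s \<in> X") (auto simp: transpose_def)
  show "token f t x \<in> X \<longleftrightarrow> x \<in> X" by (induction t) (auto simp: *)
  have **: "transpose s (f s) y = y" if "y \<notin> X" for s y
    using assms[of s] that by (cases "s \<in> X") (auto simp: transpose_def)
  show "token f t x = x" if "x \<notin> X" using that by (induction t) (auto simp: **)
qed

text \<open>The subtree that hangs from \<open>s\<close>, if the edges lead from \<open>v\<close> to \<open>f v\<close>.\<close>

definition below :: "(nat \<Rightarrow> nat) \<Rightarrow> nat \<Rightarrow> nat set" where
  "below f s = {y. \<exists>n. (f ^^ n) y = s}"

lemma below_refl [simp]: "s \<in> below f s"
  unfolding below_def by (auto intro: exI[of _ 0])

lemma step_in_below_iff:
  assumes "t \<noteq> s"
  shows "f t \<in> below f s \<longleftrightarrow> t \<in> below f s"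
proof
  assume "f t \<in> below f s"
  then obtain n where "(f ^^ n) (f t) = s" by (auto simp: below_def)
  then have "(f ^^ Suc n) t = s" by (simp add: funpow_swap1)
  then show "t \<in> below f s" unfolding below_def by blast
next
  assume "t \<in> below f s"
  then obtain n where n: "(f ^^ n) t = s" by (auto simp: below_def)
  then obtain k where "n = Suc k" using assms by (cases n) auto
  then have "(f ^^ k) (f t) = s" using n by (simp add: funpow_swap1)
  then show "f t \<in> below f s" unfolding below_def by blast
qed

text \<open>The edge of \<open>s\<close> is the only one that joins the subtree below \<open>s\<close> to the rest.\<close>

lemma transpose_in_below_iff:
  assumes "t \<noteq> s"
  shows "transpose t (f t) y \<in> below f s \<longleftrightarrow> y \<in> below f s"
  using step_in_below_iff[OF assms, of f] by (auto simp: transpose_def)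

lemma zero_notin_below:
  assumes "f 0 = 0" "s \<noteq> 0"
  shows "0 \<notin> below f s"
proof -
  have "(f ^^ n) 0 = 0" for n using assms(1) by (induction n) auto
  then show ?thesis using assms(2) by (auto simp: below_def)
qed

lemma token_in_below_before:
  "t \<le> s \<Longrightarrow> token f t x \<in> below f s \<longleftrightarrow> x \<in> below f s"
  by (induction t) (auto simp: transpose_in_below_iff)

lemma token_in_below_after:
  assumes "Suc s \<le> t"
  shows "token f t x \<in> below f s \<longleftrightarrow> token f (Suc s) x \<in> below f s"
  using assms
proof (induction t rule: dec_induct)
  case (step t)
  then have "t \<noteq> s" by simp
  then have "token f (Suc t) x \<in> below f s \<longleftrightarrow> token f t x \<in> below f s"
    using transpose_in_below_iff[of t s f] by simp
  then show ?case using step by simp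
qed simp

subsection \<open>Rising and falling tokens\<close>

text \<open>A token that went down along the edge of \<open>s\<close> would be locked in below \<open>s\<close> from then on, and 0 does not
lie there.\<close>

lemma rising_token_step:
  assumes f0: "f 0 = 0" and fin: "token f n x = 0" and "s < n"
  shows "token f (Suc s) x = (if token f s x = s then f s else token f s x)"
proof -
  have "token f s x \<noteq> f s" if "f s \<noteq> s"
  proof
    assume "token f s x = f s"
    then have "token f (Suc s) x = s" by simp
    then have "token f (Suc s) x \<in> below f s" by simp
    then have "token f n x \<in> below f s" using token_in_below_after[of s n] \<open>s < n\<close> by simp
    then show False using zero_notin_below[of f s] f0 fin that by metis
  qed
  then show ?thesis by (auto simp: transpose_def)
qed

text \<open>A token from the root cannot be below \<open>s\<close> before the time of the edge of \<open>s\<close>.\<close>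

lemma falling_token_step:
  assumes f0: "f 0 = 0"
  shows "token f (Suc s) 0 = (if token f s 0 = f s then s else token f s 0)"
proof -
  have "token f s 0 \<noteq> s" if "f s \<noteq> s"
    using zero_notin_below[of f s] token_in_below_before[of s s f 0] f0 that by (metis below_refl order_refl)
  then show ?thesis by (cases "f s = s") (auto simp: transpose_def)
qed

lemma rising_token_fixed:
  assumes f0: "f 0 = 0" and fin: "token f n x = 0"
    and "t \<le> t'" "t' \<le> n" and "\<And>s. t \<le> s \<Longrightarrow> s < t' \<Longrightarrow> s \<noteq> token f t x"
  shows "token f t' x = token f t x"
  using assms(3-5)
proof (induction t' rule: dec_induct)
  case (step s)
  then show ?case using rising_token_step[OF f0 fin, of s] by auto
qed simp

text \<open>A rising token leaves its position exactly at the time that is the label of the position. If this time is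
over, the token is stuck and never gets to 0.\<close>

lemma rising_token_ge:
  assumes f0: "f 0 = 0" and fin: "token f n x = 0" and "t \<le> n" and "token f t x \<noteq> 0"
  shows "t \<le> token f t x"
proof (rule ccontr)
  assume "\<not> ?thesis"
  then have "token f n x = token f t x"
    using rising_token_fixed[OF f0 fin, of t n] assms(3) by auto
  then show False using fin assms(4) by simp
qed

lemma rising_token_wait:
  assumes f0: "f 0 = 0" and fin: "token f n x = 0" and "t \<le> t'" "t' \<le> token f t x" "t' \<le> n"
  shows "token f t' x = token f t x"
  using rising_token_fixed[OF f0 fin assms(3,5)] assms(4) by auto

lemma rising_token_zero:
  assumes f0: "f 0 = 0" and fin: "token f n x = 0" and "t \<le> t'" "t' \<le> n" "token f t x = 0"
  shows "token f t' x = 0"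
  using assms(3,4,5)
proof (induction t' rule: dec_induct)
  case (step s)
  then show ?case using rising_token_step[OF f0 fin, of s] f0 by auto
qed simp

text \<open>Once the token has arrived at 0, the edge of a later child of 0 would carry it away again.\<close>

lemma rising_token_after_children:
  assumes f0: "f 0 = 0" and fin: "token f n x = 0" and "t \<le> s" "s < n" "token f t x = 0" and "s \<noteq> 0"
  shows "f s \<noteq> 0"
proof
  assume "f s = 0"
  have "token f s x = 0" using rising_token_zero[OF f0 fin assms(3)] assms by simp
  then have "token f (Suc s) x = s" using \<open>f s = 0\<close> by simp
  moreover have "token f (Suc s) x = 0" using rising_token_zero[OF f0 fin, of t "Suc s"] assms by simp
  ultimately show False using assms by simp
qed

lemma falling_token_less:
  assumes f0: "f 0 = 0" and "token f t 0 \<noteq> 0"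
  shows "token f t 0 < t"
  using assms(2)
proof (induction t)
  case (Suc t)
  then show ?case using falling_token_step[of f t, OF f0] by (auto split: if_splits simp del: token.simps(2))
qed simp

lemma falling_token_mono:
  assumes f0: "f 0 = 0" and "t \<le> t'"
  shows "token f t 0 \<le> token f t' 0"
  using assms(2)
proof (induction t' rule: dec_induct)
  case (step s)
  have "token f s 0 \<le> token f (Suc s) 0"
    using falling_token_step[of f s, OF f0] falling_token_less[of f, OF f0, of s]
    by (cases "token f s 0 = 0") (auto simp del: token.simps(2))
  then show ?case using step by linarith
qed simp

lemma falling_token_arrival:
  assumes f0: "f 0 = 0" and "token f t 0 = v" "v \<noteq> 0"
  shows "token f v 0 = f v" "token f (Suc v) 0 = v" "v < t"
proof -
  have "token f v 0 = f v \<and> token f (Suc v) 0 = v"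
    using assms(2)
  proof (induction t)
    case (Suc t)
    then show ?case using falling_token_step[of f t, OF f0] \<open>v \<noteq> 0\<close>
      by (cases "token f t 0 = f t") (auto simp del: token.simps(2))
  qed (use \<open>v \<noteq> 0\<close> in simp)
  then show "token f v 0 = f v" "token f (Suc v) 0 = v" by auto
  show "v < t" using falling_token_less[of f, OF f0, of t] assms by auto
qed

text \<open>The first child of 0 whose edge is used takes the token down.\<close>

lemma falling_token_before_children:
  assumes f0: "f 0 = 0" and "token f t 0 = 0" "s < t" "s \<noteq> 0"
  shows "f s \<noteq> 0"
proof
  assume fs: "f s = 0"
  have "token f s 0 = 0" "token f (Suc s) 0 = 0"
    using falling_token_mono[of f, OF f0, of s t] falling_token_mono[of f, OF f0, of "Suc s" t] assms by auto
  then show False using fs assms by simp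
qed

lemma falling_token_settled:
  assumes f0: "f 0 = 0" and fin: "token f n 0 = v" "v \<noteq> 0" and "v < t" "t \<le> n"
  shows "token f t 0 = v"
  using falling_token_arrival(2)[of f, OF f0 fin] falling_token_mono[of f, OF f0, of "Suc v" t]
    falling_token_mono[of f, OF f0, of t n] assms by simp

subsection \<open>A tree represents a single cycle\<close>

text \<open>This is transitivity of the permutation of a tree. Colour a token if it starts in \<open>Y\<close>. Since \<open>Y\<close> is
invariant, each subtree contains equally many coloured tokens at the beginning and at the end; as its
only exchange with the rest happens along one edge, the two tokens exchanged there have the same
colour. So no exchange changes the pattern of colours, and adjacent vertices have the same colour.\<close>

lemma tree_invariant_set:
  assumes fin: "finite X" and X: "X \<subseteq> {..<n}" "0 \<in> X" and f0: "f 0 = 0"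
    and closed: "\<And>s. s \<in> X \<Longrightarrow> f s \<in> X" and out: "\<And>s. s \<notin> X \<Longrightarrow> f s = s"
    and root: "\<And>s. s \<in> X \<Longrightarrow> \<exists>k. (f ^^ k) s = 0"
    and Y: "Y \<subseteq> X" "Y \<noteq> {}" and inv: "\<And>x. x \<in> Y \<Longrightarrow> token f n x \<in> Y"
  shows "Y = X"
proof -
  have finY: "finite Y" using Y fin finite_subset by blast
  have img: "token f n ` Y = Y"
    using inv by (intro card_subset_eq finY) (auto simp: card_image inj_on_def finY)
  have same: "p \<in> Y \<longleftrightarrow> q \<in> Y"
    if s: "s < n" "f s \<noteq> s" and p: "token f s p = s" and q: "token f s q = f s" for s p q
  proof -
    define Z where "Z t = {x \<in> Y. token f t x \<in> below f s}" for t
    have s0: "s \<noteq> 0" using s f0 by metis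
    \<comment> \<open>otherwise \<open>s\<close> would lie on a directed cycle and could not reach 0\<close>
    have fs: "f s \<notin> below f s"
    proof
      assume "f s \<in> below f s"
      then obtain k where "(f ^^ k) (f s) = s" by (auto simp: below_def)
      then have per: "(f ^^ Suc k) s = s" by (simp add: funpow_swap1)
      have "s \<in> X" using out s by blast
      then obtain j where j: "(f ^^ j) s = 0" using root by blast
      have zero: "(f ^^ i) 0 = 0" for i using f0 by (induction i) auto
      have "(f ^^ (Suc k * j)) s = s"
        by (metis funpow_mult funpow_fixpoint per)
      moreover have "Suc k * j = k * j + j" by simp
      ultimately have "(f ^^ (k * j)) ((f ^^ j) s) = s" by (metis comp_apply funpow_add)
      then show False using j zero s0 by simp
    qed
    have "token f n ` Z n = Y \<inter> below f s"
      using img by (auto simp: Z_def)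
    then have "card (Z n) = card (Y \<inter> below f s)"
      by (metis card_image token_inj inj_onI)
    moreover have "Z s = Y \<inter> below f s"
      by (auto simp: Z_def token_in_below_before)
    moreover have "Z n = Z (Suc s)"
      using s token_in_below_after[of s n f] by (auto simp: Z_def simp del: token.simps)
    ultimately have card_eq: "card (Z (Suc s)) = card (Z s)" by simp
    have other: "token f (Suc s) x = token f s x" if "x \<noteq> p" "x \<noteq> q" for x
    proof -
      have "token f s x \<noteq> s" "token f s x \<noteq> f s" using that p q by (metis token_inj)+
      then show ?thesis by simp
    qed
    have finZ: "finite (Z t)" for t using finY by (simp add: Z_def)
    have pq: "token f (Suc s) p = f s" "token f (Suc s) q = s" using p q by auto
    have pin: "p \<notin> Z (Suc s)" "q \<notin> Z s" using fs pq q by (auto simp: Z_def simp del: token.simps)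
    have piff: "p \<in> Z s \<longleftrightarrow> p \<in> Y" "q \<in> Z (Suc s) \<longleftrightarrow> q \<in> Y"
      using p pq by (auto simp: Z_def simp del: token.simps)
    have "x \<in> Z s \<longleftrightarrow> x \<in> Z (Suc s)" if "x \<noteq> p" "x \<noteq> q" for x
      using other[OF that] by (simp add: Z_def del: token.simps)
    then have rest: "Z s - {p} = Z (Suc s) - {q}"
      using pin by (intro set_eqI) (metis Diff_iff insert_iff empty_iff)
    show ?thesis
    proof (rule ccontr)
      assume "\<not> ?thesis"
      then have "card (Z s) \<noteq> card (Z (Suc s))"
        using rest pin piff finZ
        by (metis Diff_empty Diff_insert0 card_Suc_Diff1 n_not_Suc_n)
      then show False using card_eq by simp
    qed
  qed
  have frozen: "token f t ` Y = Y" if "t \<le> n" for t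
    using that
  proof (induction t)
    case (Suc t)
    then have IH: "token f t ` Y = Y" by simp
    obtain p q where pq: "token f t p = t" "token f t q = f t"
      using bij_token[of f t] by (metis bij_pointE)
    have "f t \<in> Y \<longleftrightarrow> t \<in> Y"
    proof (cases "f t = t")
      case False
      then have "p \<in> Y \<longleftrightarrow> q \<in> Y" using same[of t p q] pq Suc by simp
      moreover have "p \<in> Y \<longleftrightarrow> t \<in> Y" using IH pq by (metis image_iff token_inj)
      moreover have "q \<in> Y \<longleftrightarrow> f t \<in> Y" using IH pq by (metis image_iff token_inj)
      ultimately show ?thesis by simp
    qed simp
    then have "transpose t (f t) ` Y = Y" by (simp add: transpose_image_eq)
    moreover have "token f (Suc t) ` Y = transpose t (f t) ` (token f t ` Y)"
      by (auto simp: image_iff)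
    ultimately show ?case using IH by simp
  qed simp
  have edge: "f s \<in> Y \<longleftrightarrow> s \<in> Y" if "s \<in> X" for s
  proof (cases "f s = s")
    case False
    have "s < n" using that X by auto
    obtain p q where pq: "token f s p = s" "token f s q = f s"
      using bij_token[of f s] by (metis bij_pointE)
    then have "p \<in> Y \<longleftrightarrow> q \<in> Y" using same[of s p q] False \<open>s < n\<close> by simp
    moreover have "token f s ` Y = Y" using frozen \<open>s < n\<close> by simp
    ultimately show ?thesis using pq by (metis image_iff token_inj)
  qed simp
  have path: "(f ^^ k) s \<in> Y \<longleftrightarrow> s \<in> Y" if "s \<in> X" for s k
  proof -
    have "(f ^^ k) s \<in> X" for k using that closed by (induction k) auto
    then show ?thesis using edge by (induction k) auto
  qed
  have "0 \<in> Y" using Y path root by (metis subsetD ex_in_conv)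
  then show ?thesis using Y path root by (metis subsetI subset_antisym)
qed

section \<open>Cycles of lists\<close>

lemma map_eq_rotate1_iff:
  assumes "L \<noteq> []"
  shows "map \<sigma> L = rotate1 L \<longleftrightarrow> successively (\<lambda>x y. \<sigma> x = y) L \<and> \<sigma> (last L) = hd L"
proof -
  have "map \<sigma> (x # xs) = xs @ [z] \<longleftrightarrow> successively (\<lambda>x y. \<sigma> x = y) (x # xs) \<and> \<sigma> (last (x # xs)) = z"
    for x z xs
    by (induction xs arbitrary: x) (auto simp: successively_Cons)
  then show ?thesis using assms by (cases L) auto
qed

lemma cycle_of_list_agrees_iff:
  assumes "distinct L" "L \<noteq> []"
  shows "(\<forall>x\<in>set L. cycle_of_list L x = \<sigma> x) \<longleftrightarrow>
    successively (\<lambda>x y. \<sigma> x = y) L \<and> \<sigma> (last L) = hd L"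
proof -
  have "map (cycle_of_list L) L = rotate1 L"
    using cyclic_rotation[OF assms(1), of 1] by simp
  then have "(\<forall>x\<in>set L. cycle_of_list L x = \<sigma> x) \<longleftrightarrow> map \<sigma> L = rotate1 L"
    by (metis map_eq_conv)
  then show ?thesis using map_eq_rotate1_iff[OF assms(2)] by simp
qed

lemma cycle_of_list_steps:
  assumes "distinct L" "L \<noteq> []"
  shows "successively (\<lambda>x y. cycle_of_list L x = y) L" "cycle_of_list L (last L) = hd L"
  using cycle_of_list_agrees_iff[OF assms, of "cycle_of_list L"] by auto

lemma cycle_of_list_nth:
  assumes "distinct L" "i < length L" "j < length L"
  shows "\<exists>n. (cycle_of_list L ^^ n) (L ! i) = L ! j"
proof
  have "map (cycle_of_list L ^^ (length L - i + j)) L ! i = rotate (length L - i + j) L ! i"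
    using cyclic_rotation[OF assms(1)] by metis
  then show "(cycle_of_list L ^^ (length L - i + j)) (L ! i) = L ! j"
    using assms by (simp add: nth_rotate)
qed

lemma cycle_of_list_invariant_set:
  assumes "distinct L" "Y \<subseteq> set L" "Y \<noteq> {}" "\<And>x. x \<in> Y \<Longrightarrow> cycle_of_list L x \<in> Y"
  shows "Y = set L"
proof -
  have "z \<in> Y" if z: "z \<in> set L" for z
  proof -
    obtain y where y: "y \<in> Y" "y \<in> set L" using assms(2,3) by blast
    obtain i where i: "i < length L" "L ! i = y" using y(2) by (auto simp: in_set_conv_nth)
    obtain j where j: "j < length L" "L ! j = z" using z by (auto simp: in_set_conv_nth)
    obtain n where n: "(cycle_of_list L ^^ n) y = z"
      using cycle_of_list_nth[OF assms(1) i(1) j(1)] i(2) j(2) by auto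
    have "(cycle_of_list L ^^ k) y \<in> Y" for k
      using y(1) assms(4) by (intro funpow_in) auto
    then show ?thesis using n by blast
  qed
  then show ?thesis using assms(2) by blast
qed

text \<open>A cycle determines its list up to rotation, and the last entry fixes the rotation.\<close>

lemma cycle_of_list_unique:
  assumes "distinct L" "distinct M" "set L = set M" "cycle_of_list L = cycle_of_list M"
    and "last L = last M"
  shows "L = M"
proof (cases "L = []")
  case False
  then have "M \<noteq> []" using assms(3) by auto
  have hd: "hd L = hd M"
    using cycle_of_list_steps(2)[OF assms(1) False] cycle_of_list_steps(2)[OF assms(2) \<open>M \<noteq> []\<close>]
    unfolding assms(4,5) by simp
  have len: "length L = length M" using assms(1-3) distinct_card by metis
  have nth: "K ! i = (cycle_of_list K ^^ i) (hd K)" if "distinct K" "i < length K" for K :: "'a list" and i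
  proof -
    have "map (cycle_of_list K ^^ i) K ! 0 = rotate i K ! 0"
      using cyclic_rotation[OF that(1)] by metis
    moreover have "K \<noteq> []" "0 < length K" using that by auto
    ultimately show ?thesis using that by (simp add: nth_rotate hd_conv_nth)
  qed
  show ?thesis
    using len nth[OF assms(1)] nth[OF assms(2)] unfolding hd assms(4) by (intro nth_equalityI) auto
next
  case True
  then show ?thesis using assms(3) by simp
qed

text \<open>The list is the orbit of \<open>z\<close>, started just after \<open>z\<close>.\<close>

lemma transitive_perm_is_cycle:
  fixes \<sigma> :: "'a \<Rightarrow> 'a"
  assumes "finite X" "z \<in> X" "bij \<sigma>" and closed: "\<And>x. x \<in> X \<Longrightarrow> \<sigma> x \<in> X"
    and out: "\<And>x. x \<notin> X \<Longrightarrow> \<sigma> x = x"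
    and trans: "\<And>Y. Y \<subseteq> X \<Longrightarrow> Y \<noteq> {} \<Longrightarrow> (\<And>x. x \<in> Y \<Longrightarrow> \<sigma> x \<in> Y) \<Longrightarrow> Y = X"
  obtains D where "distinct D" "set D = X - {z}" "\<sigma> = cycle_of_list (D @ [z])"
proof -
  have perm: "permutation \<sigma>"
    unfolding permutation using assms(3) out assms(1) finite_subset[of "{x. \<sigma> x \<noteq> x}" X] by blast
  let ?L = "support \<sigma> z"
  have rng: "set ?L = range (\<lambda>i. (\<sigma> ^^ i) z)" using support_set[OF perm] .
  have "(\<sigma> ^^ i) z \<in> X" for i using assms(2) closed by (intro funpow_in) auto
  moreover have "\<sigma> x \<in> set ?L" if x: "x \<in> set ?L" for x
  proof -
    obtain i where "x = (\<sigma> ^^ i) z" using x rng by auto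
    then have "\<sigma> x = (\<sigma> ^^ Suc i) z" by simp
    then show ?thesis unfolding rng by blast
  qed
  ultimately have L: "set ?L = X" using rng by (intro trans) auto
  have dist: "distinct ?L" using cycle_of_permutation[OF perm] .
  have pos: "least_power \<sigma> z > 0" using least_power_of_permutation(2)[OF perm] .
  obtain D where D: "?L = z # D" using pos by (simp add: upt_conv_Cons)
  have "\<sigma> x = cycle_of_list ?L x" for x
    using cycle_restrict[OF perm, of x z] L out[of x] id_outside_supp[of x ?L] by metis
  then have "\<sigma> = cycle_of_list (rotate 1 ?L)"
    using cycle_of_list_rotate_independent[OF dist, of 1] by auto
  then have "\<sigma> = cycle_of_list (D @ [z])" using D by simp
  moreover have "distinct D" "set D = X - {z}" using D dist L by auto
  ultimately show ?thesis using that by blast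
qed

lemma successively_concat:
  assumes "\<And>L. L \<in> set Ls \<Longrightarrow> L \<noteq> [] \<and> successively P L"
    and "successively (\<lambda>L M. P (last L) (hd M)) Ls"
  shows "successively P (concat Ls)"
  using assms
proof (induction Ls)
  case (Cons L Ls)
  have "hd (concat Ls) = hd (hd Ls)" if "Ls \<noteq> []"
    using that Cons.prems(1) by (cases Ls) auto
  moreover have "successively P (concat Ls)"
    using Cons by (auto simp: successively_Cons)
  ultimately show ?case using Cons.prems by (cases "Ls = []") (auto simp: successively_append_iff successively_Cons)
qed simp

lemma hd_concat: "Ls \<noteq> [] \<Longrightarrow> hd Ls \<noteq> [] \<Longrightarrow> hd (concat Ls) = hd (hd Ls)"
  by (cases Ls) auto

lemma last_concat: "Ls \<noteq> [] \<Longrightarrow> last Ls \<noteq> [] \<Longrightarrow> last (concat Ls) = last (last Ls)"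
  by (induction Ls rule: rev_induct) auto

lemma concat_cycle_agrees:
  assumes "distinct (concat Ls)" "length Ls = k" "0 < k"
    and block: "\<And>i. i < k \<Longrightarrow> Ls ! i \<noteq> [] \<and> successively (\<lambda>x y. \<sigma> x = y) (Ls ! i)"
    and link: "\<And>i. i < k \<Longrightarrow> \<sigma> (last (Ls ! i)) = hd (Ls ! (Suc i mod k))"
    and x: "x \<in> set (concat Ls)"
  shows "cycle_of_list (concat Ls) x = \<sigma> x"
proof -
  have ne: "Ls \<noteq> []" using assms by auto
  have all: "\<And>L. L \<in> set Ls \<Longrightarrow> L \<noteq> [] \<and> successively (\<lambda>x y. \<sigma> x = y) L"
    using block assms(2) by (metis in_set_conv_nth)
  have "successively (\<lambda>L M. \<sigma> (last L) = hd M) Ls"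
    unfolding successively_conv_nth using link assms(2) by simp
  then have "successively (\<lambda>x y. \<sigma> x = y) (concat Ls)"
    using all by (intro successively_concat) auto
  moreover have "\<sigma> (last (concat Ls)) = hd (concat Ls)"
  proof -
    have "hd Ls = Ls ! 0" "last Ls = Ls ! (k - 1)" using ne assms(2) by (auto simp: hd_conv_nth last_conv_nth)
    moreover have "hd Ls \<noteq> []" "last Ls \<noteq> []" using ne all by auto
    ultimately show ?thesis
      using link[of "k - 1"] assms(3) ne by (simp add: hd_concat last_concat)
  qed
  moreover have "concat Ls \<noteq> []" using x by (metis empty_iff empty_set)
  ultimately show ?thesis
    using cycle_of_list_agrees_iff[OF assms(1)] x by blast
qed

section \<open>Functional digraphs\<close>

lemma edges_rtrancl_iff:
  assumes "u \<in> S" "a \<in> S \<rightarrow> S"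
  shows "(u, v) \<in> (edges S a)\<^sup>* \<longleftrightarrow> (\<exists>n. (a ^^ n) u = v)"
proof
  assume "(u, v) \<in> (edges S a)\<^sup>*"
  then show "\<exists>n. (a ^^ n) u = v"
  proof (induction rule: rtrancl_induct)
    case base
    show ?case by (rule exI[of _ 0]) simp
  next
    case (step y z)
    then obtain n where "(a ^^ n) u = y" by blast
    then have "(a ^^ Suc n) u = z" using step by (auto simp: edges_def)
    then show ?case by blast
  qed
next
  assume "\<exists>n. (a ^^ n) u = v"
  then obtain n where n: "(a ^^ n) u = v" by blast
  have "(u, (a ^^ n) u) \<in> (edges S a)\<^sup>*"
  proof (induction n)
    case (Suc n)
    have "((a ^^ n) u, a ((a ^^ n) u)) \<in> edges S a"
      using funpow_in[of u S a n] assms by (auto simp: edges_def)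
    then show ?case using Suc by (auto intro: rtrancl_into_rtrancl)
  qed simp
  then show "(u, v) \<in> (edges S a)\<^sup>*" using n by simp
qed

lemma ring_vertices_eq:
  assumes "a \<in> S \<rightarrow> S"
  shows "ring_vertices S a = {v \<in> S. \<exists>n>0. (a ^^ n) v = v}"
proof -
  have "(v, v) \<in> (edges S a)\<^sup>+ \<longleftrightarrow> (\<exists>n>0. (a ^^ n) v = v)" if v: "v \<in> S" for v
  proof -
    have "(v, v) \<in> (edges S a)\<^sup>+ \<longleftrightarrow> (a v, v) \<in> (edges S a)\<^sup>*"
      using v by (auto simp: trancl_unfold_left edges_def)
    also have "\<dots> \<longleftrightarrow> (\<exists>n. (a ^^ n) (a v) = v)"
      using edges_rtrancl_iff[of "a v" S a v] assms v by (auto simp: Pi_iff)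
    also have "\<dots> \<longleftrightarrow> (\<exists>n. (a ^^ Suc n) v = v)" by (simp add: funpow_swap1)
    also have "\<dots> \<longleftrightarrow> (\<exists>n>0. (a ^^ n) v = v)" by (metis gr0_conv_Suc)
    finally show ?thesis .
  qed
  then show ?thesis unfolding ring_vertices_def by blast
qed

lemma ring_vertices_subset: "ring_vertices S a \<subseteq> S"
  by (auto simp: ring_vertices_def)

lemma ring_vertices_closed:
  assumes "a \<in> S \<rightarrow> S" "v \<in> ring_vertices S a"
  shows "a v \<in> ring_vertices S a"
proof -
  have eq: "ring_vertices S a = {v \<in> S. \<exists>n>0. (a ^^ n) v = v}"
    using assms(1) by (rule ring_vertices_eq)
  obtain n where n: "n > 0" "(a ^^ n) v = v" "v \<in> S"
    using assms(2) unfolding eq by blast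
  have "(a ^^ n) (a v) = a ((a ^^ n) v)" by (rule funpow_swap1[symmetric])
  then have "(a ^^ n) (a v) = a v" using n(2) by simp
  then show ?thesis using n(1) assms(1) n(3) unfolding eq by (auto simp: Pi_iff)
qed

text \<open>Every vertex has out-degree 1, so two vertices are connected iff their forward paths meet.\<close>

lemma connected_digraph_iff:
  assumes "a \<in> S \<rightarrow> S"
  shows "connected_digraph S a \<longleftrightarrow>
    S \<noteq> {} \<and> (\<forall>u\<in>S. \<forall>v\<in>S. \<exists>n k. (a ^^ n) u = (a ^^ k) v)"
proof -
  let ?U = "(edges S a \<union> (edges S a)\<inverse>)\<^sup>*"
  have "(u, v) \<in> ?U \<longleftrightarrow> (\<exists>n k. (a ^^ n) u = (a ^^ k) v)" if "u \<in> S" "v \<in> S" for u v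
  proof
    assume "(u, v) \<in> ?U"
    then show "\<exists>n k. (a ^^ n) u = (a ^^ k) v"
    proof (induction rule: rtrancl_induct)
      case (step y z)
      then obtain n k where nk: "(a ^^ n) u = (a ^^ k) y" by blast
      consider "a y = z" | "a z = y" using step by (auto simp: edges_def)
      then show ?case
      proof cases
        case 1
        have "(a ^^ Suc n) u = (a ^^ k) (a y)" using nk by (simp add: funpow_swap1)
        then show ?thesis using 1 by blast
      next
        case 2
        have "(a ^^ n) u = (a ^^ Suc k) z" using nk 2 by (simp add: funpow_swap1)
        then show ?thesis by blast
      qed
    qed blast
  next
    assume "\<exists>n k. (a ^^ n) u = (a ^^ k) v"
    then obtain w where w: "(u, w) \<in> (edges S a)\<^sup>*" "(v, w) \<in> (edges S a)\<^sup>*"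
      using edges_rtrancl_iff[OF \<open>u \<in> S\<close> assms] edges_rtrancl_iff[OF \<open>v \<in> S\<close> assms] by metis
    have "(u, w) \<in> ?U" using w(1) by (rule in_rtrancl_UnI[OF disjI1])
    moreover have "(w, v) \<in> ?U"
      using rtrancl_converseI[OF w(2)] by (rule in_rtrancl_UnI[OF disjI2])
    ultimately show "(u, v) \<in> ?U" by simp
  qed
  then show ?thesis unfolding connected_digraph_def by blast
qed

lemma upper_vertices_eq:
  assumes "a \<in> S \<rightarrow> S"
  shows "upper_vertices S a = {a u | u. u \<in> ring_vertices S a \<and> u < a u}"
  using ring_vertices_closed[OF assms] ring_vertices_subset[of S a]
  unfolding upper_vertices_def edges_def by blast

lemma lower_vertices_eq:
  assumes "a \<in> S \<rightarrow> S"
  shows "lower_vertices S a = {a u | u. u \<in> ring_vertices S a \<and> a u < u}"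
  using ring_vertices_closed[OF assms] ring_vertices_subset[of S a]
  unfolding lower_vertices_def edges_def by blast

lemma is_tree_with_root_iff:
  assumes "a \<in> S \<rightarrow> S"
  shows "is_tree_with_root S a r \<longleftrightarrow> r \<in> S \<and> a r = r \<and> (\<forall>s\<in>S. \<exists>k. (a ^^ k) s = r)"
proof (cases "r \<in> S \<and> a r = r")
  case True
  then have stay: "(a ^^ k) r = r" for k by (simp add: funpow_fixpoint)
  have "is_tree S a \<longleftrightarrow> (\<forall>s\<in>S. \<exists>k. (a ^^ k) s = r)"
  proof
    assume "is_tree S a"
    then have "\<forall>u\<in>S. \<exists>n k. (a ^^ n) u = (a ^^ k) r"
      using True unfolding is_tree_def connected_digraph_iff[OF assms] by blast
    then show "\<forall>s\<in>S. \<exists>k. (a ^^ k) s = r"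
      unfolding stay by blast
  next
    assume root: "\<forall>s\<in>S. \<exists>k. (a ^^ k) s = r"
    have "\<exists>n k. (a ^^ n) u = (a ^^ k) v" if "u \<in> S" "v \<in> S" for u v
    proof -
      obtain n where "(a ^^ n) u = r" using root \<open>u \<in> S\<close> by blast
      moreover obtain k where "(a ^^ k) v = r" using root \<open>v \<in> S\<close> by blast
      ultimately have "(a ^^ n) u = (a ^^ k) v" by simp
      then show ?thesis by blast
    qed
    then have conn: "connected_digraph S a"
      using True unfolding connected_digraph_iff[OF assms] by blast
    have "v = r" if v: "v \<in> S" "n > 0" "(a ^^ n) v = v" for v n
    proof -
      obtain k where k: "(a ^^ k) v = r" using root v by blast
      have "((a ^^ n) ^^ k) v = v" using v(3) by (rule funpow_fixpoint)
      then have "(a ^^ (n * k)) v = v" by (simp add: funpow_mult)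
      moreover have "n * k = (n * k - k) + k" using v(2) by simp
      ultimately have "(a ^^ ((n * k - k) + k)) v = v" by argo
      then have "(a ^^ (n * k - k)) ((a ^^ k) v) = v" by (simp add: funpow_add)
      then show ?thesis using k stay by simp
    qed
    moreover have "0 < (1::nat) \<and> (a ^^ 1) r = r" using True by simp
    ultimately have "ring_vertices S a = {r}"
      using True unfolding ring_vertices_eq[OF assms] by blast
    then show "is_tree S a" using conn by (simp add: is_tree_def)
  qed
  then show ?thesis using True unfolding is_tree_with_root_def by blast
next
  case False
  then show ?thesis unfolding is_tree_with_root_def by blast
qed

section \<open>Gluing a cyclic sequence of trees into a unicycle\<close>

text \<open>The trees are given jointly: \<open>b\<close> maps every vertex to its parent, with 0 as the common name of all
roots, and \<open>\<kappa>\<close> tells the tree to which a vertex belongs. In tree \<open>j\<close> the vertices of other trees are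
isolated.\<close>

definition tree_of :: "(nat \<Rightarrow> nat) \<Rightarrow> (nat \<Rightarrow> nat) \<Rightarrow> nat \<Rightarrow> nat \<Rightarrow> nat" where
  "tree_of \<kappa> b j s = (if \<kappa> s = j then b s else s)"

text \<open>The trees \<open>0, \<dots>, m - 1\<close> are arranged in a circle. The even ones are those of the upper runs and carry a
rising walker, the odd ones are those of the lower runs and carry a falling walker. In both cases \<open>c j\<close>
is the vertex at which the ring will enter tree \<open>j\<close>: the start of a rising walker, the end of a
falling one. The last two assumptions make the ring go down into a lower run and up into an upper run.\<close>

locale tree_necklace =
  fixes S :: "nat set" and n m :: nat and \<kappa> b c :: "nat \<Rightarrow> nat"
  assumes even_m: "even m" and m_pos: "0 < m"
    and S_sub: "S \<subseteq> {0<..<n}"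
    and \<kappa>_less: "s \<in> S \<Longrightarrow> \<kappa> s < m"
    and b_in: "s \<in> S \<Longrightarrow> b s \<in> insert 0 S"
    and b_out: "s \<notin> S \<Longrightarrow> b s = s"
    and \<kappa>_b: "s \<in> S \<Longrightarrow> b s \<noteq> 0 \<Longrightarrow> \<kappa> (b s) = \<kappa> s"
    and to_root: "s \<in> S \<Longrightarrow> \<exists>i. (b ^^ i) s = 0"
    and c_in: "j < m \<Longrightarrow> c j \<in> S" and \<kappa>_c: "j < m \<Longrightarrow> \<kappa> (c j) = j"
    and rising: "j < m \<Longrightarrow> even j \<Longrightarrow> token (tree_of \<kappa> b j) n (c j) = 0"
    and falling: "j < m \<Longrightarrow> odd j \<Longrightarrow> token (tree_of \<kappa> b j) n 0 = c j"
    and child_above: "j < m \<Longrightarrow> even j \<Longrightarrow> \<exists>s\<in>S. \<kappa> s = j \<and> b s = 0 \<and> c (Suc j mod m) < s"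
    and child_below: "j < m \<Longrightarrow> odd j \<Longrightarrow> \<exists>s\<in>S. \<kappa> s = j \<and> b s = 0 \<and> s < c (Suc j mod m)"
begin

definition nxt :: "nat \<Rightarrow> nat" where "nxt j = Suc j mod m"

lemma nxt_less [simp]: "nxt j < m"
  using m_pos by (simp add: nxt_def)

lemma nxt_cases: "j < m \<Longrightarrow> nxt j = (if Suc j = m then 0 else Suc j)"
  by (simp add: nxt_def)

lemma even_nxt: "j < m \<Longrightarrow> even (nxt j) \<longleftrightarrow> odd j"
  using even_m by (auto simp: nxt_cases)

lemma nxt_neq: "j < m \<Longrightarrow> nxt j \<noteq> j"
  using even_nxt by metis

lemma nxt_inj: "i < m \<Longrightarrow> j < m \<Longrightarrow> nxt i = nxt j \<longleftrightarrow> i = j"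
  by (auto simp: nxt_cases)

lemma nxt_surj: "i < m \<Longrightarrow> \<exists>h<m. nxt h = i"
  by (cases i) (auto simp: nxt_def intro: exI[of _ "m - 1"] exI[of _ "i - 1"])

lemma finite_S: "finite S"
  using S_sub finite_subset by blast

lemma zero_notin: "0 \<notin> S"
  using S_sub by auto

lemma S_pos: "s \<in> S \<Longrightarrow> s \<noteq> 0" and S_less: "s \<in> S \<Longrightarrow> s < n"
  using S_sub by auto

lemma b_zero: "b 0 = 0"
  using b_out zero_notin by blast

lemma b_neq: "s \<in> S \<Longrightarrow> b s \<noteq> s"
  using to_root[of s] funpow_fixpoint[of b s] S_pos[of s] by metis

abbreviation "T \<equiv> tree_of \<kappa> b"

lemma T_zero: "T j 0 = 0"
  by (simp add: tree_of_def b_zero)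

lemma T_out: "s \<notin> S \<Longrightarrow> T j s = s"
  by (simp add: tree_of_def b_out)

lemma T_neq_iff: "T j s \<noteq> s \<longleftrightarrow> s \<in> S \<and> \<kappa> s = j"
  using b_neq[of s] b_out[of s] by (auto simp: tree_of_def)

definition X :: "nat \<Rightarrow> nat set" where "X j = {s \<in> S. \<kappa> s = j}"

lemma X_pos: "x \<in> X j \<Longrightarrow> x \<noteq> 0"
  using S_pos by (auto simp: X_def)

lemma token_T_in: "token (T j) t x \<in> insert 0 (X j) \<longleftrightarrow> x \<in> insert 0 (X j)"
proof (rule token_outside(1))
  show "T j s \<in> insert 0 (X j)" if "s \<in> insert 0 (X j)" for s
    using that b_in[of s] \<kappa>_b[of s] by (auto simp: X_def tree_of_def b_zero)
  show "T j s = s" if "s \<notin> insert 0 (X j)" for s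
    using that T_neq_iff[of j s] by (auto simp: X_def)
qed

definition walker :: "nat \<Rightarrow> nat \<Rightarrow> nat" where
  "walker j t = token (T j) t (if even j then c j else 0)"

lemma walker_Suc: "walker j (Suc t) = transpose t (T j t) (walker j t)"
  by (simp add: walker_def)

lemma walker_in: "j < m \<Longrightarrow> walker j t \<in> insert 0 (X j)"
  unfolding walker_def token_T_in using c_in \<kappa>_c by (auto simp: X_def)

lemma walker_nonzero:
  assumes "j < m" "walker j t \<noteq> 0"
  shows "walker j t \<in> S" "\<kappa> (walker j t) = j"
  using walker_in[OF assms(1), of t] assms(2) by (auto simp: X_def)

lemma walker_start: "walker j 0 = (if even j then c j else 0)"
  by (simp add: walker_def)

lemma walker_end: "j < m \<Longrightarrow> walker j n = (if even j then 0 else c j)"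
  using rising falling by (simp add: walker_def)

text \<open>The sources of the edges used by the walkers. They turn out to be the ring of the glued digraph.\<close>

definition R :: "nat set" where
  "R = {s \<in> S. walker (\<kappa> s) (Suc s) \<noteq> walker (\<kappa> s) s}"

lemma R_subset: "R \<subseteq> S" by (auto simp: R_def)

lemma walker_still: "s \<notin> R \<or> \<kappa> s \<noteq> j \<Longrightarrow> walker j (Suc s) = walker j s"
proof (cases "s \<in> S \<and> \<kappa> s = j")
  case False
  then have "T j s = s" using T_neq_iff by metis
  then show ?thesis by (simp add: walker_Suc)
qed (auto simp: R_def)

lemma walker_moves:
  assumes "s \<in> R"
  shows "even (\<kappa> s) \<Longrightarrow> walker (\<kappa> s) s = s \<and> walker (\<kappa> s) (Suc s) = b s"
    and "odd (\<kappa> s) \<Longrightarrow> walker (\<kappa> s) s = b s \<and> walker (\<kappa> s) (Suc s) = s"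
proof -
  let ?j = "\<kappa> s"
  have s: "s \<in> S" "?j < m" "s < n" and moved: "walker ?j (Suc s) \<noteq> walker ?j s"
    using assms \<kappa>_less S_less by (auto simp: R_def)
  have Ts: "T ?j s = b s" by (simp add: tree_of_def)
  show "walker ?j s = s \<and> walker ?j (Suc s) = b s" if "even ?j"
    using rising_token_step[of "T ?j", OF T_zero rising[OF s(2) that] s(3)] moved that Ts
    unfolding walker_def by (auto split: if_splits)
  show "walker ?j s = b s \<and> walker ?j (Suc s) = s" if "odd ?j"
    using falling_token_step[of "T ?j" s, OF T_zero] moved that Ts
    unfolding walker_def by (auto split: if_splits)
qed

lemma in_R_iff:
  assumes "s \<in> S"
  shows "s \<in> R \<longleftrightarrow> walker (\<kappa> s) s \<in> {s, b s}"
proof -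
  have "T (\<kappa> s) s = b s" by (simp add: tree_of_def)
  then show ?thesis using assms b_neq[OF assms] by (auto simp: R_def walker_Suc transpose_def)
qed

lemma walker_in_R:
  assumes j: "j < m" and t: "t \<le> n" and nz: "walker j t \<noteq> 0"
  shows "walker j t \<in> R"
proof -
  let ?v = "walker j t"
  have v: "?v \<in> S" "\<kappa> ?v = j" using walker_nonzero[OF j nz] by auto
  show ?thesis
  proof (cases "even j")
    case True
    have ge: "t \<le> ?v"
      using rising_token_ge[of "T j", OF T_zero rising[OF j True] t] nz True unfolding walker_def by simp
    have "walker j ?v = ?v"
      using rising_token_wait[of "T j", OF T_zero rising[OF j True] ge] S_less[OF v(1)] True
      unfolding walker_def by simp
    then show ?thesis using in_R_iff[OF v(1)] v(2) by simp
  next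
    case False
    have "walker j ?v = T j ?v"
      using falling_token_arrival(1)[of "T j", OF T_zero _ nz] False unfolding walker_def by simp
    then have "walker j ?v = b ?v" using v(2) by (simp add: tree_of_def)
    then show ?thesis using in_R_iff[OF v(1)] v(2) by simp
  qed
qed

lemma walker_rest:
  assumes j: "j < m"
  shows "even j \<Longrightarrow> t \<le> c j \<Longrightarrow> walker j t = c j"
    and "odd j \<Longrightarrow> c j < t \<Longrightarrow> t \<le> n \<Longrightarrow> walker j t = c j"
proof -
  show "walker j t = c j" if "even j" "t \<le> c j"
    using rising_token_wait[of "T j" n "c j" 0 t, OF T_zero rising[OF j that(1)]] that S_less[OF c_in[OF j]]
    unfolding walker_def by simp
  show "walker j t = c j" if "odd j" "c j < t" "t \<le> n"
    using falling_token_settled[of "T j" n "c j" t, OF T_zero falling[OF j that(1)]] that S_pos[OF c_in[OF j]]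
    unfolding walker_def by simp
qed

text \<open>The compatibility of neighbouring trees on which everything rests: while a walker is at its root, the
walker of the next tree is at the entry vertex of its tree. A rising walker is at its root after the
times of all children of the root, a falling one before these times, so this is what the assumptions on
the children of 0 provide.\<close>

lemma walker_next:
  assumes j: "j < m" and t: "t \<le> n" and zero: "walker j t = 0"
  shows "walker (nxt j) t = c (nxt j)"
proof (cases "even j")
  case True
  obtain s where s: "s \<in> S" "\<kappa> s = j" "b s = 0" "c (nxt j) < s"
    using child_above[OF j True] by (auto simp: nxt_def)
  have "s < t"
  proof (rule ccontr)
    assume "\<not> s < t"
    then have "T j s \<noteq> 0"
      using rising_token_after_children[of "T j", OF T_zero rising[OF j True], of t s] zero True
        S_less[OF s(1)] S_pos[OF s(1)] unfolding walker_def by simp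
    then show False using s by (simp add: tree_of_def)
  qed
  then show ?thesis using walker_rest(2)[of "nxt j" t] even_nxt[OF j] True s t by simp
next
  case False
  obtain s where s: "s \<in> S" "\<kappa> s = j" "b s = 0" "s < c (nxt j)"
    using child_below[OF j False] by (auto simp: nxt_def)
  have "t \<le> s"
  proof (rule ccontr)
    assume "\<not> t \<le> s"
    then have "T j s \<noteq> 0"
      using falling_token_before_children[of "T j" t s, OF T_zero] zero False S_pos[OF s(1)]
      unfolding walker_def by simp
    then show False using s by (simp add: tree_of_def)
  qed
  then show ?thesis using walker_rest(1)[of "nxt j" t] even_nxt[OF j] False s by simp
qed

text \<open>The ring vertex that plays the role of the root of tree \<open>j\<close> at time \<open>t\<close>. By \<open>walker_next\<close> the walkers of
two consecutive trees are never both at their roots, so this is not 0.\<close>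

definition root_place :: "nat \<Rightarrow> nat \<Rightarrow> nat" where
  "root_place j t = (if walker (nxt j) t \<noteq> 0 then walker (nxt j) t else walker (nxt (nxt j)) t)"

text \<open>The vertex of the glued digraph that corresponds at time \<open>t\<close> to the vertex \<open>y\<close> of tree \<open>j\<close>.\<close>

definition place :: "nat \<Rightarrow> nat \<Rightarrow> nat \<Rightarrow> nat" where
  "place t j y = (if y = 0 then root_place j t else y)"

text \<open>Only edges to a root have to be redirected, and the edge of \<open>s\<close> matters only at time \<open>s\<close>.\<close>

definition glue :: "nat \<Rightarrow> nat" where
  "glue s = (if s \<in> S then place s (\<kappa> s) (b s) else s)"

lemma c_neq_0: "j < m \<Longrightarrow> c j \<noteq> 0"
  using c_in zero_notin by metis

lemma root_place_in_R: "t \<le> n \<Longrightarrow> root_place j t \<in> R"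
  using walker_in_R[of "nxt j" t] walker_in_R[of "nxt (nxt j)" t] walker_next[of "nxt j" t]
    c_neq_0[of "nxt (nxt j)"] by (auto simp: root_place_def)

lemma root_place_cases:
  assumes "t \<le> n"
  obtains "walker (nxt j) t \<noteq> 0" "root_place j t = walker (nxt j) t" "\<kappa> (root_place j t) = nxt j"
  | "walker (nxt j) t = 0" "root_place j t = walker (nxt (nxt j)) t"
    "\<kappa> (root_place j t) = nxt (nxt j)" "walker (nxt (nxt j)) t \<noteq> 0"
proof (cases "walker (nxt j) t = 0")
  case True
  then have "walker (nxt (nxt j)) t \<noteq> 0"
    using walker_next[OF _ assms True] c_neq_0 by simp
  then show ?thesis using True that(2) walker_nonzero(2)[of "nxt (nxt j)" t] by (simp add: root_place_def)
next
  case False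
  then show ?thesis using that(1) walker_nonzero(2)[of "nxt j" t] by (simp add: root_place_def)
qed

lemma root_place_walker:
  assumes "t \<le> n" shows "walker (\<kappa> (root_place j t)) t = root_place j t"
  by (rule root_place_cases[OF assms, of j]) auto

lemma root_place_inj:
  assumes t: "t \<le> n" and ij: "i < m" "j < m" and nz: "walker i t \<noteq> 0" "walker j t \<noteq> 0"
    and eq: "root_place i t = root_place j t"
  shows "i = j"
  using root_place_cases[OF t, of i] root_place_cases[OF t, of j] eq nz nxt_inj ij
  by (smt (verit) nxt_less)

text \<open>There are \<open>m\<close> more vertices in the trees than in the glued digraph. Without the positions of the \<open>m\<close>
walkers the correspondence is injective at every time: a root is placed on a position of a walker, which
is thereby vacant.\<close>

lemma place_inj:
  assumes t: "t \<le> n" and ij: "i < m" "j < m"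
    and y: "y \<in> insert 0 (X i)" "y \<noteq> walker i t" and z: "z \<in> insert 0 (X j)" "z \<noteq> walker j t"
    and eq: "place t i y = place t j z"
  shows "i = j \<and> y = z"
proof -
  have mixed: False
    if "z' \<in> X j'" "z' \<noteq> walker j' t" "z' = root_place i' t" for i' j' z'
    using root_place_walker[OF t, of i'] that by (auto simp: X_def)
  consider "y = 0" "z = 0" | "y = 0" "z \<in> X j" "z \<noteq> 0" | "z = 0" "y \<in> X i" "y \<noteq> 0"
    | "y \<in> X i" "z \<in> X j" "y \<noteq> 0" "z \<noteq> 0" using y z by blast
  then show ?thesis
  proof cases
    case 1
    have "walker i t \<noteq> 0" "walker j t \<noteq> 0" using y(2) z(2) 1 by metis+
    moreover have "root_place i t = root_place j t" using eq 1 by (simp add: place_def)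
    ultimately have "i = j" by (rule root_place_inj[OF t ij])
    then show ?thesis using 1 by simp
  next
    case 2
    have "z = root_place i t" using eq 2 by (simp add: place_def)
    then show ?thesis using mixed[OF 2(2) z(2)] by blast
  next
    case 3
    have "y = root_place j t" using eq 3 by (simp add: place_def)
    then show ?thesis using mixed[OF 3(2) y(2)] by blast
  next
    case 4
    then show ?thesis using eq by (simp add: place_def X_def)
  qed
qed

text \<open>If no walker moves at time \<open>t\<close>, the places do not change, and the exchange in the tree of \<open>t\<close> corresponds
to that in the glued digraph by injectivity. If the walker of tree \<open>i\<close> moves from \<open>p\<close> to \<open>p'\<close>, the place of
the root of the preceding tree \<open>h\<close> moves along with it; so in the glued digraph the token on \<open>p'\<close> changes
places with the token that is at the root of tree \<open>h\<close>.\<close>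

lemma place_step:
  assumes j: "j < m" and t: "t < n" and y: "y \<in> insert 0 (X j)" "y \<noteq> walker j t"
  shows "transpose t (glue t) (place t j y) = place (Suc t) j (transpose t (T j t) y)"
proof (cases "t \<in> S")
  case False
  then have "walker k (Suc t) = walker k t" for k using walker_still R_subset by blast
  then show ?thesis using False by (simp add: glue_def T_out place_def root_place_def)
next
  case tS: True
  define i where "i = \<kappa> t"
  have i: "i < m" using \<kappa>_less tS by (simp add: i_def)
  have t0: "t \<noteq> 0" using S_pos[OF tS] .
  have bt: "b t \<noteq> t" using b_neq[OF tS] .
  have Xi: "t \<in> insert 0 (X i)" "b t \<in> insert 0 (X i)"
    using tS b_in[OF tS] \<kappa>_b[OF tS] by (auto simp: X_def i_def)
  have Ti: "T i t = b t" by (simp add: tree_of_def i_def)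
  have Tj: "T k t = t" if "k \<noteq> i" for k using that by (simp add: tree_of_def i_def)
  have pt: "place t' k t = t" for t' k using t0 by (simp add: place_def)
  have pb: "place t i (b t) = glue t" using tS by (simp add: glue_def i_def)
  have t_le: "t \<le> n" using t by simp
  show ?thesis
  proof (cases "t \<in> R")
    case False
    then have "walker k (Suc t) = walker k t" for k using walker_still by blast
    then have same: "place (Suc t) k z = place t k z" for k z by (simp add: place_def root_place_def)
    have free: "t \<noteq> walker i t" "b t \<noteq> walker i t" using False in_R_iff[OF tS] by (auto simp: i_def)
    consider "j = i" "y = t" | "j = i" "y = b t" | "j \<noteq> i \<or> y \<notin> {t, b t}" by blast
    then show ?thesis
    proof cases
      case 1
      then show ?thesis by (simp add: same pt pb Ti)
    next
      case 2
      then show ?thesis by (simp add: same pt pb Ti)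
    next
      case 3
      then have "place t j y \<noteq> place t i t" "place t j y \<noteq> place t i (b t)"
        using place_inj[OF t_le j i y Xi(1) free(1)] place_inj[OF t_le j i y Xi(2) free(2)] by auto
      then have "transpose t (glue t) (place t j y) = place t j y" by (simp add: pt pb)
      moreover have "transpose t (T j t) y = y" using 3 Ti Tj by (cases "j = i") auto
      ultimately show ?thesis by (simp add: same)
    qed
  next
    case moving: True
    obtain h where h: "h < m" "nxt h = i" using nxt_surj[OF i] by blast
    have hi: "h \<noteq> i" using nxt_neq[OF h(1)] h(2) by simp
    define p p' where "p = walker i t" and "p' = walker i (Suc t)"
    have pp: "p = t \<and> p' = b t \<or> p = b t \<and> p' = t"
      using walker_moves[OF moving] unfolding p_def p'_def i_def by blast
    have others: "walker k (Suc t) = walker k t" if "k \<noteq> i" for k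
      using walker_still that by (metis i_def)
    define w where "w = walker (nxt i) t"
    have w': "walker (nxt i) (Suc t) = w" using others[OF nxt_neq[OF i]] by (simp add: w_def)
    have w0: "w \<noteq> 0" if "b t = 0"
    proof -
      have "walker i t = 0 \<or> walker i (Suc t) = 0" using pp that by (auto simp: p_def p'_def)
      then show ?thesis
        using walker_next[OF i, of t] walker_next[OF i, of "Suc t"] t c_neq_0[of "nxt i"] w'
        by (auto simp: w_def)
    qed
    have hnz: "walker h t \<noteq> 0"
    proof
      assume zero: "walker h t = 0"
      then have "walker h (Suc t) = 0" using others[OF hi] by simp
      then have "p = c i" "p' = c i"
        using zero walker_next[OF h(1), of t] walker_next[OF h(1), of "Suc t"] t h(2)
        by (auto simp: p_def p'_def)
      then show False using pp bt by auto
    qed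
    \<comment> \<open>the place of a vertex on the path of this walker; \<open>w\<close> stands in for the root of tree \<open>i\<close>\<close>
    define q where "q x = (if x \<noteq> 0 then x else w)" for x
    have gh: "root_place h t = q p" "root_place h (Suc t) = q p'"
      using w' by (auto simp: root_place_def q_def p_def p'_def h(2) w_def)
    have glue_q: "glue t = q (b t)" using w0 tS
      by (auto simp: glue_def place_def root_place_def q_def w_def i_def)
    have tq: "t = q t" using t0 by (simp add: q_def)
    have pq: "place t i p' = q p'"
      using pp pb pt glue_q tq by metis
    have gk: "root_place k (Suc t) = root_place k t" if "k < m" "k \<noteq> h" for k
    proof -
      have "nxt k \<noteq> i" using that h nxt_inj by metis
      moreover have "nxt (nxt k) \<noteq> i \<or> walker (nxt k) t \<noteq> 0"
        using hnz h nxt_inj[of "nxt k" h] by auto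
      ultimately show ?thesis using others by (auto simp: root_place_def)
    qed
    have pp_ne: "p' \<noteq> p" using pp bt by auto
    consider "j = i" "y = p'" | "j = h" "y = 0" | "\<not> (j = i \<and> y = p')" "\<not> (j = h \<and> y = 0)" by blast
    then show ?thesis
    proof cases
      case 1
      have "place (Suc t) i z = place t i z" for z using gk[OF i] hi by (auto simp: place_def)
      then show ?thesis using 1 pp pb pt Ti by auto
    next
      case 2
      have "place (Suc t) h (transpose t (T h t) 0) = q p'" using gh Tj[OF hi] by (simp add: place_def)
      moreover have "place t h 0 = q p" using gh by (simp add: place_def)
      ultimately show ?thesis using 2 pp glue_q tq by (metis transpose_apply_first transpose_apply_second)
    next
      case 3
      have "transpose t (T j t) y = y"
      proof (cases "j = i")
        case True
        then have "y \<noteq> t" "y \<noteq> b t" using y(2) 3(1) pp by (auto simp: p_def p'_def)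
        then show ?thesis using True Ti by simp
      qed (simp add: Tj)
      moreover have "place (Suc t) j y = place t j y"
        using gk[OF j] 3(2) by (auto simp: place_def)
      moreover have "place t j y \<noteq> place t i p'"
      proof
        assume "place t j y = place t i p'"
        then show False
          using place_inj[OF t_le j i y, of p'] Xi pp pp_ne 3(1) by (auto simp: p_def)
      qed
      moreover have "place t j y \<noteq> place t h 0"
        using place_inj[OF t_le j h(1) y, of 0] hnz 3(2) by auto
      moreover have "place t h 0 = q p" using gh by (simp add: place_def)
      moreover have "q p = t \<and> q p' = glue t \<or> q p = glue t \<and> q p' = t"
        using pp glue_q tq by auto
      ultimately have "place t j y \<noteq> t" "place t j y \<noteq> glue t" using pq by auto
      then show ?thesis
        using \<open>transpose t (T j t) y = y\<close> \<open>place (Suc t) j y = place t j y\<close> by simp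
    qed
  qed
qed

lemma token_glue:
  assumes j: "j < m" and t: "t \<le> n" and y: "y \<in> insert 0 (X j)" "y \<noteq> walker j 0"
  shows "token glue t (place 0 j y) = place t j (token (T j) t y)"
  using t
proof (induction t)
  case (Suc t)
  have "token (T j) t y \<noteq> walker j t"
    using y(2) by (simp add: walker_def)
  then show ?case using Suc place_step[OF j, of t "token (T j) t y"] token_T_in y(1) by simp
qed simp

text \<open>The segments of the rising trees follow each other against the direction of the ring: the last vertex of
the segment two trees further on is mapped to the vertex that follows 0 in tree \<open>j\<close>.\<close>

lemma token_glue_rising:
  assumes j: "j < m" "even j"
  shows "x \<in> X j \<Longrightarrow> x \<noteq> c j \<Longrightarrow> token glue n x = token (T j) n x"
    and "token glue n (c (nxt (nxt j))) = token (T j) n 0"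
proof -
  have nz: "token (T j) n x \<noteq> 0" if "x \<noteq> c j" for x
    using rising[OF j] that by (metis token_inj)
  show "token glue n x = token (T j) n x" if "x \<in> X j" "x \<noteq> c j"
  proof -
    have "x \<noteq> 0" using that(1) X_pos by blast
    then show ?thesis
      using token_glue[OF j(1) order_refl, of x] that j(2) nz[OF that(2)]
      by (simp add: walker_start place_def)
  qed
  have "place 0 j 0 = c (nxt (nxt j))"
    using j by (simp add: place_def root_place_def walker_start even_nxt)
  then show "token glue n (c (nxt (nxt j))) = token (T j) n 0"
    using token_glue[OF j(1) order_refl, of 0] j nz[of 0] c_neq_0[OF j(1)]
    by (auto simp: walker_start place_def)
qed

lemma token_glue_falling:
  assumes j: "j < m" "odd j" and x: "x \<in> X j"
  shows "token glue n x =
    (if token (T j) n x = 0 then c (nxt (nxt j)) else token (T j) n x)"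
proof -
  have "x \<noteq> 0" using x X_pos by blast
  moreover have "root_place j n = c (nxt (nxt j))"
    using j by (simp add: root_place_def walker_end even_nxt)
  ultimately show ?thesis
    using token_glue[OF j(1) order_refl, of x] j x by (auto simp: walker_start place_def)
qed

end

section \<open>The ring of the glued digraph\<close>

text \<open>The upper vertices at which the ring changes from lower to upper vertices.\<close>

definition upturns :: "nat set \<Rightarrow> (nat \<Rightarrow> nat) \<Rightarrow> nat set" where
  "upturns S a = {v \<in> upper_vertices S a. \<exists>u \<in> lower_vertices S a. (u, v) \<in> edges S a}"

lemma edges_cong: "(\<And>s. s \<in> S \<Longrightarrow> a s = a' s) \<Longrightarrow> edges S a = edges S a'"
  unfolding edges_def by force

context tree_necklace
begin

lemma glue_b: "s \<in> S \<Longrightarrow> b s \<noteq> 0 \<Longrightarrow> glue s = b s"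
  and glue_root: "s \<in> S \<Longrightarrow> b s = 0 \<Longrightarrow> glue s = root_place (\<kappa> s) s"
  by (auto simp: glue_def place_def)

lemma glue_in: "glue \<in> S \<rightarrow> S"
proof
  fix s assume s: "s \<in> S"
  show "glue s \<in> S"
    using s b_in[OF s] glue_b[OF s] glue_root[OF s] root_place_in_R[of s "\<kappa> s"] S_less[OF s] R_subset
    by (cases "b s = 0") auto
qed

lemma walker_bounds:
  assumes j: "j < m" and t: "t \<le> n" and nz: "walker j t \<noteq> 0"
  shows "even j \<Longrightarrow> t \<le> walker j t" and "odd j \<Longrightarrow> walker j t < t"
proof -
  show "t \<le> walker j t" if "even j"
    using rising_token_ge[of "T j", OF T_zero rising[OF j that] t] nz that unfolding walker_def by simp
  show "walker j t < t" if "odd j"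
    using falling_token_less[of "T j" t, OF T_zero] nz that unfolding walker_def by simp
qed

lemma R_facts:
  assumes "s \<in> R"
  shows "s \<in> S" "\<kappa> s < m" "s < n" "Suc s \<le> n" "s \<le> n"
  using assms R_subset \<kappa>_less S_less by (auto simp: Suc_le_eq less_imp_le)

lemma b_in_R:
  assumes s: "s \<in> R" "b s \<noteq> 0"
  shows "b s \<in> R"
proof (cases "even (\<kappa> s)")
  case True
  then have "walker (\<kappa> s) (Suc s) = b s" using walker_moves(1)[OF s(1)] by blast
  then show ?thesis using walker_in_R[OF R_facts(2,4)[OF s(1)]] s(2) by simp
next
  case False
  then have "walker (\<kappa> s) s = b s" using walker_moves(2)[OF s(1)] by blast
  then show ?thesis using walker_in_R[OF R_facts(2,5)[OF s(1)]] s(2) by simp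
qed

lemma walker_next_at_end:
  assumes s: "s \<in> R" "b s = 0"
  shows "walker (nxt (\<kappa> s)) s = c (nxt (\<kappa> s))"
proof -
  note f = R_facts[OF s(1)]
  have "walker (nxt (\<kappa> s)) (Suc s) = walker (nxt (\<kappa> s)) s"
    using walker_still[of s "nxt (\<kappa> s)"] nxt_neq[OF f(2)] by metis
  moreover have "walker (\<kappa> s) s = 0 \<or> walker (\<kappa> s) (Suc s) = 0"
    using walker_moves[OF s(1)] s(2) by (cases "even (\<kappa> s)") simp_all
  ultimately show ?thesis using walker_next[OF f(2) f(4)] walker_next[OF f(2) f(5)] by auto
qed

text \<open>The walker of tree \<open>\<kappa> s\<close> uses the edge from \<open>s\<close> to the root, so just before or just after time \<open>s\<close> it is
at the root and the next walker is at its entry vertex.\<close>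

lemma glue_at_end:
  assumes s: "s \<in> R" "b s = 0"
  shows "glue s = c (nxt (\<kappa> s))"
  using walker_next_at_end[OF s] c_neq_0[of "nxt (\<kappa> s)"] glue_root[of s] s R_facts[OF s(1)]
  by (simp add: root_place_def)

lemma c_in_R:
  assumes "j < m" shows "c j \<in> R"
proof (cases "even j")
  case True
  then show ?thesis
    using walker_in_R[OF assms, of 0] c_neq_0[OF assms] by (simp add: walker_start)
next
  case False
  then show ?thesis
    using walker_in_R[OF assms, of n] c_neq_0[OF assms] walker_end[OF assms] by simp
qed

lemma glue_in_R: "glue \<in> R \<rightarrow> R"
proof
  fix s assume s: "s \<in> R"
  show "glue s \<in> R"
    using b_in_R[OF s] glue_at_end[OF s] c_in_R[of "nxt (\<kappa> s)"] glue_b[of s] R_facts(1)[OF s]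
    by (cases "b s = 0") auto
qed

text \<open>Inside a tree the ring follows a rising walker and retraces a falling one. Away from the root, the
position of a rising walker is never below the current time, and that of a falling one always is. Between trees the same bounds apply to the next walker.\<close>

lemma glue_order:
  assumes s: "s \<in> R"
  shows "even (\<kappa> (glue s)) \<Longrightarrow> s < glue s" and "odd (\<kappa> (glue s)) \<Longrightarrow> glue s < s"
proof -
  note f = R_facts[OF s]
  have "if even (\<kappa> (glue s)) then s < glue s else glue s < s"
  proof (cases "b s = 0")
    case False
    then have g: "glue s = b s" "\<kappa> (b s) = \<kappa> s" using glue_b[OF f(1)] \<kappa>_b[OF f(1)] by auto
    show ?thesis
    proof (cases "even (\<kappa> s)")
      case True
      have "walker (\<kappa> s) (Suc s) = b s" using walker_moves(1)[OF s True] by blast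
      then show ?thesis using walker_bounds(1)[OF f(2,4) _ True] g True False by simp
    next
      case odd: False
      have "walker (\<kappa> s) s = b s" using walker_moves(2)[OF s odd] by blast
      then show ?thesis using walker_bounds(2)[OF f(2,5) _ odd] g odd False by simp
    qed
  next
    case True
    let ?k = "nxt (\<kappa> s)"
    have g: "glue s = c ?k" "walker ?k s = c ?k" "\<kappa> (c ?k) = ?k" "c ?k \<noteq> 0"
      using glue_at_end[OF s True] walker_next_at_end[OF s True] \<kappa>_c c_neq_0 by simp_all
    have "c ?k \<noteq> s" using g(3) nxt_neq[OF f(2)] by metis
    then show ?thesis
      using g walker_bounds[of ?k s] f(5) by (cases "even ?k") auto
  qed
  then show "even (\<kappa> (glue s)) \<Longrightarrow> s < glue s" "odd (\<kappa> (glue s)) \<Longrightarrow> glue s < s"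
    by (auto split: if_splits)
qed

lemma c_reaches_walker:
  assumes j: "j < m" and "t \<le> n" and "walker j t \<noteq> 0"
  shows "\<exists>i. (glue ^^ i) (c j) = walker j t"
proof (cases "even j")
  case True
  show ?thesis using assms(2,3)
  proof (induction t)
    case 0
    then show ?case using True by (auto simp: walker_start intro: exI[of _ 0])
  next
    case (Suc t)
    show ?case
    proof (cases "t \<in> R \<and> \<kappa> t = j")
      case moved: True
      then have w: "walker j t = t" "walker j (Suc t) = b t" using walker_moves(1)[of t] True by auto
      then obtain i where "(glue ^^ i) (c j) = t" using Suc moved R_facts(1) S_pos by fastforce
      then have "(glue ^^ Suc i) (c j) = b t" using glue_b[of t] w Suc.prems moved R_facts(1) by simp
      then show ?thesis using w by metis
    next
      case False
      then show ?thesis using Suc walker_still[of t j] by auto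
    qed
  qed
next
  case False
  show ?thesis using assms(2,3)
  proof (induction t rule: inc_induct)
    case base
    then show ?case using False walker_end[OF j] by (auto intro: exI[of _ 0])
  next
    case (step t)
    show ?case
    proof (cases "t \<in> R \<and> \<kappa> t = j")
      case moved: True
      then have w: "walker j t = b t" "walker j (Suc t) = t" using walker_moves(2)[of t] False by auto
      then obtain i where "(glue ^^ i) (c j) = t" using step moved R_facts(1) S_pos by fastforce
      then have "(glue ^^ Suc i) (c j) = b t" using glue_b[of t] w step.prems moved R_facts(1) by simp
      then show ?thesis using w by metis
    next
      case no: False
      then show ?thesis using step walker_still[of t j] by auto
    qed
  qed
qed

lemma R_walker:
  assumes "s \<in> R"
  obtains t where "t \<le> n" "walker (\<kappa> s) t = s"
  using that[of s] that[of "Suc s"] walker_moves[OF assms] R_facts[OF assms] by blast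

lemma end_reachable:
  assumes "s \<in> R"
  shows "\<exists>r\<in>R. \<kappa> r = \<kappa> s \<and> b r = 0 \<and> (\<exists>i. (glue ^^ i) s = r)"
proof -
  obtain k where "(b ^^ k) s = 0" using to_root R_facts(1)[OF assms] by blast
  then show ?thesis using assms
  proof (induction k arbitrary: s)
    case 0
    then show ?case using R_facts(1)[of s] S_pos by auto
  next
    case (Suc k)
    show ?case
    proof (cases "b s = 0")
      case True
      then show ?thesis using Suc.prems by (auto intro!: exI[of _ 0])
    next
      case False
      have s: "s \<in> S" using R_facts(1) Suc.prems(2) .
      have "(b ^^ k) (b s) = 0" using Suc.prems(1) by (simp add: funpow_swap1)
      then obtain r i where r: "r \<in> R" "\<kappa> r = \<kappa> (b s)" "b r = 0" "(glue ^^ i) (b s) = r"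
        using Suc.IH[OF _ b_in_R[OF Suc.prems(2) False]] by blast
      have "(glue ^^ Suc i) s = r" using r(4) glue_b[OF s False] by (simp add: funpow_swap1)
      then show ?thesis using r \<kappa>_b[OF s False] by metis
    qed
  qed
qed

lemma reaches_next:
  assumes "s \<in> R"
  shows "\<exists>i. (glue ^^ Suc i) s = c (nxt (\<kappa> s))"
proof -
  obtain r i where "r \<in> R" "\<kappa> r = \<kappa> s" "b r = 0" "(glue ^^ i) s = r"
    using end_reachable[OF assms] by blast
  then have "(glue ^^ Suc i) s = c (nxt (\<kappa> s))" using glue_at_end[of r] by simp
  then show ?thesis by blast
qed

lemma reach_trans: "(glue ^^ i) u = v \<Longrightarrow> (glue ^^ k) v = w \<Longrightarrow> (glue ^^ (k + i)) u = w"
  by (simp add: funpow_add)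

lemma R_connected:
  assumes u: "u \<in> R" and v: "v \<in> R"
  shows "\<exists>i. (glue ^^ Suc i) u = v"
proof -
  have forward: "\<exists>i. (glue ^^ i) (c k) = c ((k + d) mod m)" if k: "k < m" for k d
  proof (induction d)
    case 0
    then show ?case using k by (auto intro: exI[of _ 0])
  next
    case (Suc d)
    let ?e = "(k + d) mod m"
    have e: "?e < m" using m_pos by simp
    obtain i where "(glue ^^ i) (c k) = c ?e" using Suc by blast
    moreover obtain i' where "(glue ^^ Suc i') (c ?e) = c (nxt ?e)"
      using reaches_next[OF c_in_R[OF e]] \<kappa>_c[OF e] by metis
    moreover have "nxt ?e = (k + Suc d) mod m" by (simp add: nxt_def mod_Suc_eq)
    ultimately show ?case using reach_trans by metis
  qed
  let ?k = "nxt (\<kappa> u)" and ?l = "\<kappa> v"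
  have l: "?l < m" using R_facts(2)[OF v] .
  obtain i1 where 1: "(glue ^^ Suc i1) u = c ?k" using reaches_next[OF u] by blast
  have "?k + (m - ?k + ?l) = m + ?l" using nxt_less[of "\<kappa> u"] by linarith
  then have "(?k + (m - ?k + ?l)) mod m = ?l" using l by simp
  then obtain i2 where 2: "(glue ^^ i2) (c ?k) = c ?l" using forward[OF nxt_less] by metis
  obtain t where t: "t \<le> n" "walker ?l t = v" using R_walker[OF v] .
  then obtain i3 where 3: "(glue ^^ i3) (c ?l) = v"
    using c_reaches_walker[OF l t(1)] R_facts(1)[OF v] S_pos by metis
  have "(glue ^^ (i3 + (i2 + Suc i1))) u = v" using reach_trans[OF reach_trans[OF 1 2] 3] .
  then show ?thesis by (metis add_Suc_right)
qed

lemma reaches_R: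
  assumes "s \<in> S"
  shows "\<exists>i. (glue ^^ i) s \<in> R"
proof -
  obtain k where "(b ^^ k) s = 0" using to_root[OF assms] by blast
  then show ?thesis using assms
  proof (induction k arbitrary: s)
    case 0
    then show ?case using S_pos by auto
  next
    case (Suc k)
    have s: "s \<in> S" by fact
    show ?case
    proof (cases "b s = 0")
      case True
      then have "(glue ^^ 1) s \<in> R"
        using glue_root[OF s] root_place_in_R[of s] S_less[OF s] by simp
      then show ?thesis by blast
    next
      case False
      have "(b ^^ k) (b s) = 0" using Suc.prems(1) by (simp add: funpow_swap1)
      then obtain i where "(glue ^^ i) (b s) \<in> R" using Suc.IH b_in[OF s] False by blast
      then have "(glue ^^ Suc i) s \<in> R" using glue_b[OF s False] by (simp add: funpow_swap1)
      then show ?thesis by blast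
    qed
  qed
qed

lemma ring_vertices_glue: "ring_vertices S glue = R"
proof -
  have "s \<in> R" if s: "s \<in> S" "(glue ^^ i) s = s" "0 < i" for s i
  proof -
    obtain k where k: "(glue ^^ k) s \<in> R" using reaches_R[OF s(1)] by blast
    have "((glue ^^ i) ^^ k) s = s" using s(2) by (rule funpow_fixpoint)
    then have "(glue ^^ (i * k)) s = s" by (simp add: funpow_mult)
    moreover have "i * k = (i * k - k) + k" using s(3) by simp
    ultimately have "(glue ^^ ((i * k - k) + k)) s = s" by argo
    then have "(glue ^^ (i * k - k)) ((glue ^^ k) s) = s" by (simp add: funpow_add)
    then show ?thesis using funpow_in[OF k glue_in_R, of "i * k - k"] by simp
  qed
  moreover have "s \<in> S \<and> (\<exists>i>0. (glue ^^ i) s = s)" if "s \<in> R" for s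
    using R_connected[OF that that] R_facts(1)[OF that] by blast
  ultimately show ?thesis unfolding ring_vertices_eq[OF glue_in] by blast
qed

lemma R_pred: "v \<in> R \<Longrightarrow> \<exists>u\<in>R. glue u = v"
proof -
  assume v: "v \<in> R"
  obtain i where "(glue ^^ Suc i) v = v" using R_connected[OF v v] by blast
  then have "glue ((glue ^^ i) v) = v" by simp
  then show ?thesis using funpow_in[OF v glue_in_R] by blast
qed

lemma upper_vertices_glue: "upper_vertices S glue = {v \<in> R. even (\<kappa> v)}"
proof -
  have "glue u \<in> R" "u < glue u \<longleftrightarrow> even (\<kappa> (glue u))" if "u \<in> R" for u
    using glue_in_R that glue_order[OF that] by fastforce+
  then show ?thesis
    unfolding upper_vertices_eq[OF glue_in] ring_vertices_glue using R_pred by blast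
qed

lemma lower_vertices_glue: "lower_vertices S glue = {v \<in> R. odd (\<kappa> v)}"
proof -
  have "glue u \<in> R" "glue u < u \<longleftrightarrow> odd (\<kappa> (glue u))" if "u \<in> R" for u
    using glue_in_R that glue_order[OF that] by fastforce+
  then show ?thesis
    unfolding lower_vertices_eq[OF glue_in] ring_vertices_glue using R_pred by blast
qed

lemma is_unicycle_glue: "is_unicycle S glue"
proof -
  have "\<exists>i k. (glue ^^ i) u = (glue ^^ k) v" if u: "u \<in> S" and v: "v \<in> S" for u v
  proof -
    obtain i k where i: "(glue ^^ i) u \<in> R" and k: "(glue ^^ k) v \<in> R"
      using reaches_R[OF u] reaches_R[OF v] by blast
    obtain d where "(glue ^^ Suc d) ((glue ^^ i) u) = (glue ^^ k) v" using R_connected[OF i k] by blast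
    then have "(glue ^^ (Suc d + i)) u = (glue ^^ k) v" by (simp only: funpow_add comp_apply)
    then show ?thesis by blast
  qed
  then have "connected_digraph S glue"
    unfolding connected_digraph_iff[OF glue_in] using c_in[OF m_pos] by blast
  moreover have "2 \<le> card R"
  proof -
    have m2: "1 < m" using even_m m_pos by (metis One_nat_def Suc_lessI odd_one)
    have "c 0 \<noteq> c 1" using \<kappa>_c[OF m_pos] \<kappa>_c[OF m2] by auto
    then have "card {c 0, c 1} = 2" by simp
    moreover have "{c 0, c 1} \<subseteq> R" using c_in_R m_pos m2 by simp
    ultimately show ?thesis using card_mono[OF finite_subset[OF R_subset finite_S]] by metis
  qed
  ultimately show ?thesis by (simp add: is_unicycle_def ring_vertices_glue)
qed

lemma upturns_glue: "upturns S glue = c ` {j. j < m \<and> even j}"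
proof -
  have "v \<in> c ` {j. j < m \<and> even j}"
    if u: "u \<in> R" "odd (\<kappa> u)" and v: "even (\<kappa> v)" "v = glue u" for u v
  proof -
    have "b u = 0" using glue_b[OF R_facts(1)[OF u(1)]] \<kappa>_b[OF R_facts(1)[OF u(1)]] u v by metis
    then have "v = c (nxt (\<kappa> u))" using glue_at_end[OF u(1)] v by simp
    then show ?thesis using even_nxt[OF R_facts(2)[OF u(1)]] u(2) by auto
  qed
  moreover have "\<exists>u\<in>R. odd (\<kappa> u) \<and> glue u = c j" if j: "j < m" "even j" for j
  proof -
    obtain h where h: "h < m" "nxt h = j" using nxt_surj[OF j(1)] by blast
    obtain r where r: "r \<in> R" "\<kappa> r = h" "b r = 0"
      using end_reachable[OF c_in_R[OF h(1)]] \<kappa>_c[OF h(1)] by auto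
    then show ?thesis using glue_at_end[OF r(1,3)] h even_nxt[OF h(1)] j(2) by auto
  qed
  moreover have "c j \<in> R" "even (\<kappa> (c j)) = even j" if "j < m" for j
    using c_in_R[OF that] \<kappa>_c[OF that] by auto
  moreover have "upturns S glue = {v \<in> R. even (\<kappa> v) \<and> (\<exists>u\<in>R. odd (\<kappa> u) \<and> glue u = v)}"
    unfolding upturns_def upper_vertices_glue lower_vertices_glue edges_def
    using R_subset by auto
  ultimately show ?thesis by fastforce
qed

lemma card_upturns_glue: "card (upturns S glue) = m div 2"
proof -
  have "inj_on c {j. j < m \<and> even j}" using \<kappa>_c by (auto intro: inj_on_inverseI[of _ \<kappa>])
  moreover have "{j. j < m \<and> even j} = (\<lambda>i. 2 * i) ` {..<m div 2}" using even_m by (auto elim!: evenE)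
  ultimately show ?thesis unfolding upturns_glue by (simp add: card_image inj_on_def)
qed

text \<open>On the ring, \<open>\<kappa>\<close> and \<open>b\<close> can be recovered step by step from the digraph alone: a new tree begins where
the ring changes between upper and lower vertices.\<close>

lemma R_step:
  assumes u: "u \<in> R"
  defines "U \<equiv> upper_vertices S glue"
  shows "\<kappa> (glue u) = (if u \<in> U \<longleftrightarrow> glue u \<in> U then \<kappa> u else nxt (\<kappa> u))"
    and "b u = (if u \<in> U \<longleftrightarrow> glue u \<in> U then glue u else 0)"
proof -
  have f: "u \<in> S" "\<kappa> u < m" "glue u \<in> R" using R_facts[OF u] glue_in_R u by auto
  have "(u \<in> U \<longleftrightarrow> glue u \<in> U) \<longleftrightarrow> b u \<noteq> 0"
    using f u glue_b[OF f(1)] \<kappa>_b[OF f(1)] glue_at_end[OF u] even_nxt[OF f(2)] \<kappa>_c[of "nxt (\<kappa> u)"]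
    unfolding U_def upper_vertices_glue by (cases "b u = 0") auto
  then show "\<kappa> (glue u) = (if u \<in> U \<longleftrightarrow> glue u \<in> U then \<kappa> u else nxt (\<kappa> u))"
    and "b u = (if u \<in> U \<longleftrightarrow> glue u \<in> U then glue u else 0)"
    using glue_b[OF f(1)] \<kappa>_b[OF f(1)] glue_at_end[OF u] \<kappa>_c[of "nxt (\<kappa> u)"] by auto
qed

lemma walker_Suc_R:
  "walker j (Suc t) = (if t \<in> R \<and> \<kappa> t = j then if even j then b t else t else walker j t)"
  using walker_moves[of t] walker_still[of t j] by auto

text \<open>Off the ring, the edges that were redirected are those whose target is a position of a walker at the time
of the edge. An edge of a tree whose target is the position of the walker would be used by the walker.\<close>

lemma cut_iff:
  assumes s: "s \<in> S" "s \<notin> R"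
  shows "b s = 0 \<longleftrightarrow> glue s \<in> R \<and> walker (\<kappa> (glue s)) s = glue s"
proof (cases "b s = 0")
  case True
  then show ?thesis
    using glue_root[OF s(1)] root_place_in_R[of s] root_place_walker[of s] S_less[OF s(1)] by simp
next
  case False
  then show ?thesis using glue_b[OF s(1)] \<kappa>_b[OF s(1)] in_R_iff[OF s(1)] s(2) by auto
qed

end

text \<open>The digraph determines the ring, hence the ring parts of \<open>\<kappa>\<close> and \<open>b\<close> by \<open>R_step\<close>, hence the walkers, hence
\<open>b\<close> off the ring by \<open>cut_iff\<close>. The tree of a child of 0 off the ring follows from \<open>root_place_inj\<close>. The
vertex \<open>c 0\<close> is needed to know which tree has number 0.\<close>

theorem tree_necklace_unique:
  assumes "tree_necklace S n m \<kappa> b c" and "tree_necklace S n m' \<kappa>' b' c'"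
    and glue: "\<And>s. s \<in> S \<Longrightarrow> tree_necklace.glue S m \<kappa> b c s = tree_necklace.glue S m' \<kappa>' b' c' s"
    and start: "c 0 = c' 0"
  shows "m' = m" and "\<And>s. s \<in> S \<Longrightarrow> \<kappa>' s = \<kappa> s \<and> b' s = b s"
proof -
  interpret A: tree_necklace S n m \<kappa> b c by fact
  interpret B: tree_necklace S n m' \<kappa>' b' c' by fact
  have E: "edges S B.glue = edges S A.glue" using edges_cong[of S A.glue B.glue] glue by metis
  have RR: "B.R = A.R"
    using E unfolding A.ring_vertices_glue[symmetric] B.ring_vertices_glue[symmetric] ring_vertices_def by simp
  have UU: "upper_vertices S B.glue = upper_vertices S A.glue"
    unfolding upper_vertices_def A.ring_vertices_glue B.ring_vertices_glue RR E ..
  have LL: "lower_vertices S B.glue = lower_vertices S A.glue"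
    unfolding lower_vertices_def A.ring_vertices_glue B.ring_vertices_glue RR E ..
  have "upturns S B.glue = upturns S A.glue" unfolding upturns_def UU LL E ..
  then have "m' div 2 = m div 2" using A.card_upturns_glue B.card_upturns_glue by simp
  then show mm: "m' = m" using A.even_m B.even_m by (metis dvd_mult_div_cancel)
  have nxt: "B.nxt j = A.nxt j" for j using mm by (simp add: A.nxt_def B.nxt_def)
  have ring_path: "\<kappa>' ((A.glue ^^ i) (c 0)) = \<kappa> ((A.glue ^^ i) (c 0))" for i
  proof (induction i)
    case 0
    show ?case using A.\<kappa>_c[of 0] B.\<kappa>_c[of 0] A.m_pos B.m_pos start by simp
  next
    case (Suc i)
    have u: "(A.glue ^^ i) (c 0) \<in> A.R"
      using funpow_in[OF A.c_in_R[OF A.m_pos] A.glue_in_R] .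
    then have "A.glue ((A.glue ^^ i) (c 0)) = B.glue ((A.glue ^^ i) (c 0))"
      using glue A.R_facts(1) by blast
    then show ?case
      using A.R_step(1)[OF u] B.R_step(1)[of "(A.glue ^^ i) (c 0)"] u RR UU Suc nxt by simp
  qed
  have ring_\<kappa>: "\<kappa>' s = \<kappa> s" if "s \<in> A.R" for s
    using A.R_connected[OF A.c_in_R[OF A.m_pos] that] ring_path by metis
  have ring_b: "b' s = b s" if s: "s \<in> A.R" for s
    using A.R_step(2)[OF s] B.R_step(2)[of s] s RR UU glue A.R_facts(1)[OF s] by simp
  have cc: "c' j = c j" if "j < m" for j
    using that
  proof (induction j)
    case (Suc j)
    obtain r where r: "r \<in> A.R" "\<kappa> r = j" "b r = 0"
      using A.end_reachable[OF A.c_in_R] A.\<kappa>_c Suc.prems by (metis Suc_lessD)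
    have "c (Suc j) = A.glue r" using A.glue_at_end[OF r(1,3)] r(2) Suc.prems by (simp add: A.nxt_def)
    moreover have "c' (Suc j) = B.glue r"
      using B.glue_at_end[of r] r ring_\<kappa> ring_b RR Suc.prems mm by (simp add: A.nxt_def B.nxt_def)
    ultimately show ?case using glue A.R_facts(1)[OF r(1)] by simp
  qed (use start in simp)
  have walk: "B.walker j t = A.walker j t" if "j < m" for j t
  proof (induction t)
    case 0
    show ?case using cc[OF that] by (simp add: A.walker_start B.walker_start)
  next
    case (Suc t)
    then show ?case using A.walker_Suc_R B.walker_Suc_R RR ring_\<kappa> ring_b by auto
  qed
  have bb: "b' s = b s" if s: "s \<in> S" for s
  proof (cases "s \<in> A.R")
    case False
    have "b' s = 0 \<longleftrightarrow> b s = 0"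
      using A.cut_iff[OF s False] B.cut_iff[OF s] False RR glue[OF s] ring_\<kappa> walk A.R_facts(2) by metis
    then show ?thesis using glue[OF s] A.glue_b[OF s] B.glue_b[OF s] by metis
  qed (rule ring_b)
  have "\<kappa>' s = \<kappa> s" if "(b ^^ k) s = 0" "s \<in> S" for k s
    using that
  proof (induction k arbitrary: s)
    case 0
    then show ?case using A.S_pos by auto
  next
    case (Suc k)
    have s: "s \<in> S" by fact
    consider "s \<in> A.R" | "b s \<noteq> 0" | "s \<notin> A.R" "b s = 0" by blast
    then show ?case
    proof cases
      case 1
      then show ?thesis by (rule ring_\<kappa>)
    next
      case 2
      have "(b ^^ k) (b s) = 0" using Suc.prems(1) by (simp add: funpow_swap1)
      then have "\<kappa>' (b s) = \<kappa> (b s)" using Suc.IH A.b_in[OF s] 2 by blast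
      then show ?thesis using A.\<kappa>_b[OF s 2] B.\<kappa>_b[OF s] bb[OF s] 2 by simp
    next
      case 3
      have k: "\<kappa> s < m" "\<kappa>' s < m" using A.\<kappa>_less[OF s] B.\<kappa>_less[OF s] mm by auto
      have "A.root_place (\<kappa>' s) s = B.root_place (\<kappa>' s) s"
        using walk by (simp add: A.root_place_def B.root_place_def nxt)
      then have "A.root_place (\<kappa> s) s = A.root_place (\<kappa>' s) s"
        using glue[OF s] A.glue_root[OF s 3(2)] B.glue_root[OF s] bb[OF s] 3(2) by simp
      moreover have "A.walker (\<kappa> s) s \<noteq> 0" using A.in_R_iff[OF s] 3 by auto
      moreover have "A.walker (\<kappa>' s) s \<noteq> 0"
        using B.in_R_iff[OF s] 3 RR bb[OF s] walk[OF k(2)] by auto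
      ultimately show ?thesis
        using A.root_place_inj[OF less_imp_le[OF A.S_less[OF s]] k] by simp
    qed
  qed
  then show "\<kappa>' s = \<kappa> s \<and> b' s = b s" if "s \<in> S" for s
    using that A.to_root bb by blast
qed

section \<open>Cutting a unicycle into a cyclic sequence of trees\<close>

locale unicycle_digraph =
  fixes S :: "nat set" and n :: nat and a :: "nat \<Rightarrow> nat"
  assumes S_sub: "S \<subseteq> {0<..<n}" and a_in: "a \<in> S \<rightarrow> S"
    and unicycle: "is_unicycle S a"
begin

definition "Rg = ring_vertices S a"

lemma Rg_iff: "v \<in> Rg \<longleftrightarrow> v \<in> S \<and> (\<exists>i>0. (a ^^ i) v = v)"
  unfolding Rg_def ring_vertices_eq[OF a_in] by simp

lemma Rg_sub: "Rg \<subseteq> S" by (auto simp: Rg_iff)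

lemma S_pos: "s \<in> S \<Longrightarrow> s \<noteq> 0" and S_less: "s \<in> S \<Longrightarrow> s < n"
  using S_sub by auto

lemma finite_S: "finite S" using S_sub finite_subset by blast

lemma finite_Rg: "finite Rg" using Rg_sub finite_S finite_subset by blast

lemma a_Rg: "a \<in> Rg \<rightarrow> Rg"
  using ring_vertices_closed[OF a_in] by (simp add: Rg_def)

lemma connected: "u \<in> S \<Longrightarrow> v \<in> S \<Longrightarrow> \<exists>i k. (a ^^ i) u = (a ^^ k) v"
  using unicycle unfolding is_unicycle_def connected_digraph_iff[OF a_in] by blast

lemma reaches_ring_vertex:
  assumes u: "u \<in> S" and v: "v \<in> Rg"
  shows "\<exists>k. (a ^^ k) u = v"
proof -
  obtain r where r: "0 < r" "(a ^^ r) v = v" "v \<in> S" using v Rg_iff by blast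
  obtain p q where pq: "(a ^^ p) u = (a ^^ q) v" using connected[OF u r(3)] by blast
  have "((a ^^ r) ^^ q) v = v" using r(2) by (rule funpow_fixpoint)
  then have "(a ^^ (r * q)) v = v" by (simp add: funpow_mult)
  moreover have "r * q = (r * q - q) + q" using r(1) by simp
  ultimately have "(a ^^ ((r * q - q) + q)) v = v" by argo
  then have "(a ^^ (r * q - q)) ((a ^^ p) u) = v" using pq by (simp add: funpow_add)
  then have "(a ^^ ((r * q - q) + p)) u = v" by (simp add: funpow_add)
  then show ?thesis by blast
qed

lemma no_loop:
  assumes "v \<in> Rg" shows "a v \<noteq> v"
proof
  assume loop: "a v = v"
  have "w = v" if w: "w \<in> Rg" for w
  proof -
    obtain k where "(a ^^ k) v = w" using reaches_ring_vertex w assms Rg_sub by blast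
    then show ?thesis using funpow_fixpoint[of a v k] loop by simp
  qed
  then have "Rg = {v}" using assms by blast
  then show False using unicycle by (simp add: is_unicycle_def Rg_def)
qed

text \<open>The smallest ring vertex is lower, and its successor in the ring is upper.\<close>

lemma upturns_nonempty: "upturns S a \<noteq> {}"
proof -
  have ne: "Rg \<noteq> {}"
  proof
    assume "Rg = {}"
    then show False using unicycle by (simp add: is_unicycle_def Rg_def)
  qed
  define v where "v = Min Rg"
  have v: "v \<in> Rg" and least: "w \<in> Rg \<Longrightarrow> v \<le> w" for w
    using Min_in[OF finite_Rg ne] Min_le[OF finite_Rg] by (auto simp: v_def)
  obtain i where i: "0 < i" "(a ^^ i) v = v" using v Rg_iff by blast
  then obtain d where d: "i = Suc d" by (cases i) auto
  let ?u = "(a ^^ d) v"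
  have u: "?u \<in> Rg" "a ?u = v" using funpow_in[OF v a_Rg] i(2) d by auto
  have "v < ?u" using least[OF u(1)] no_loop[OF u(1)] u(2) by (cases "v = ?u") auto
  then have low: "v \<in> lower_vertices S a"
    unfolding lower_vertices_eq[OF a_in] Rg_def[symmetric] using u by force
  have av: "a v \<in> Rg" using a_Rg v by blast
  then have "v < a v" using least[OF av] no_loop[OF v] by simp
  then have "a v \<in> upper_vertices S a"
    unfolding upper_vertices_eq[OF a_in] Rg_def[symmetric] using v by blast
  then have "a v \<in> upturns S a"
    using low v Rg_sub by (auto simp: upturns_def edges_def)
  then show ?thesis by blast
qed

end

locale marked_unicycle = unicycle_digraph +
  fixes y :: nat
  assumes y: "y \<in> upturns S a"
begin

lemma y_Rg: "y \<in> Rg"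
  using y by (simp add: upturns_def upper_vertices_def Rg_def)

subsection \<open>Walking around the ring\<close>

definition vtx :: "nat \<Rightarrow> nat" where "vtx i = (a ^^ i) y"

definition len :: nat where "len = (LEAST l. 0 < l \<and> vtx l = y)"

lemma vtx_0 [simp]: "vtx 0 = y" and vtx_Suc: "vtx (Suc i) = a (vtx i)"
  by (simp_all add: vtx_def)

lemma vtx_Rg: "vtx i \<in> Rg"
  unfolding vtx_def using funpow_in[OF y_Rg a_Rg] .

lemma len: "0 < len" "vtx len = y"
proof -
  have "\<exists>l. 0 < l \<and> vtx l = y" using y_Rg Rg_iff by (auto simp: vtx_def)
  then have "0 < len \<and> vtx len = y" unfolding len_def by (rule LeastI_ex)
  then show "0 < len" "vtx len = y" by auto
qed

lemma vtx_add: "vtx (i + k) = (a ^^ i) (vtx k)"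
  by (simp add: vtx_def funpow_add)

lemma vtx_mod: "vtx (i mod len) = vtx i"
  unfolding vtx_def using funpow_mod_eq[of len a y i] len(2) by (simp add: vtx_def)

lemma vtx_inj: "i < len \<Longrightarrow> k < len \<Longrightarrow> vtx i = vtx k \<Longrightarrow> i = k"
proof (induction i k rule: linorder_wlog)
  case (le i k)
  show ?case
  proof (rule ccontr)
    assume "i \<noteq> k"
    have "vtx (len - k + i) = vtx (len - k + k)" unfolding vtx_add using le by simp
    moreover have "len - k + k = len" using le by simp
    ultimately have "vtx (len - k + i) = y" using len(2) by metis
    moreover have "0 < len - k + i" "len - k + i < len" using le \<open>i \<noteq> k\<close> by auto
    ultimately show False using not_less_Least[of "len - k + i" "\<lambda>l. 0 < l \<and> vtx l = y"]
      by (simp add: len_def)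
  qed
qed simp

definition pos :: "nat \<Rightarrow> nat" where "pos v = inv_into {..<len} vtx v"

lemma pos:
  assumes "v \<in> Rg" shows "pos v < len" "vtx (pos v) = v"
proof -
  obtain k where "vtx k = v" using reaches_ring_vertex[of y v] y_Rg Rg_sub assms by (auto simp: vtx_def)
  then have "vtx (k mod len) = v" using vtx_mod by simp
  then have "v \<in> vtx ` {..<len}" using len(1) by (metis imageI lessThan_iff mod_less_divisor)
  then show "pos v < len" "vtx (pos v) = v"
    using inv_into_into[of v vtx "{..<len}"] f_inv_into_f[of v vtx "{..<len}"] by (auto simp: pos_def)
qed

lemma pos_vtx: "i < len \<Longrightarrow> pos (vtx i) = i"
  using vtx_inj pos vtx_Rg by blast

lemma pred_unique:
  assumes u: "u \<in> Rg" and eq: "a u = vtx (Suc i)"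
  shows "u = vtx i"
proof -
  have i: "i mod len < len" using len(1) by simp
  have *: "vtx (Suc (pos u)) = vtx (Suc (i mod len))"
    using eq pos[OF u] vtx_mod[of i] by (simp add: vtx_Suc)
  have nz: "vtx k = y \<Longrightarrow> k < len \<Longrightarrow> k = 0" for k
    using vtx_inj[of k 0] len(1) by simp
  have "pos u = i mod len"
  proof (cases "Suc (pos u) < len \<and> Suc (i mod len) < len")
    case True
    then show ?thesis using vtx_inj[OF _ _ *] by simp
  next
    case False
    then have "Suc (pos u) = len \<or> Suc (i mod len) = len" using pos(1)[OF u] i by linarith
    then have "Suc (pos u) = len \<and> Suc (i mod len) = len"
      using * len(2) nz[of "Suc (pos u)"] nz[of "Suc (i mod len)"] pos(1)[OF u] i
      by (metis Suc_lessI nat.distinct(1))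
    then show ?thesis by simp
  qed
  then show ?thesis using pos(2)[OF u] vtx_mod by metis
qed

definition up :: "nat \<Rightarrow> bool" where "up i \<longleftrightarrow> vtx i \<in> upper_vertices S a"

lemma up_Suc: "up (Suc i) \<longleftrightarrow> vtx i < vtx (Suc i)"
proof -
  have "vtx (Suc i) = a (vtx i)" by (rule vtx_Suc)
  then show ?thesis
    using pred_unique[of _ i] vtx_Rg[of i] unfolding up_def upper_vertices_eq[OF a_in] Rg_def[symmetric]
    by (smt (verit) mem_Collect_eq)
qed

lemma not_up_Suc: "\<not> up (Suc i) \<longleftrightarrow> vtx (Suc i) < vtx i"
  using up_Suc[of i] no_loop[OF vtx_Rg[of i]] by (auto simp: vtx_Suc)

lemma up_len: "up len" "up 0" and not_up_last: "\<not> up (len - 1)"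
proof -
  show "up 0" "up len" using y len(2) by (simp_all add: up_def upturns_def)
  obtain u where u: "u \<in> lower_vertices S a" "a u = y"
    using y by (auto simp: upturns_def edges_def)
  have lenS: "len = Suc (len - 1)" using len(1) by simp
  have "u \<in> Rg" using u(1) by (auto simp: lower_vertices_def Rg_def)
  then have last: "u = vtx (len - 1)" using pred_unique[of u "len - 1"] u(2) len(2) lenS by metis
  obtain w where w: "w \<in> Rg" "u = a w" "a w < w"
    using u(1) unfolding lower_vertices_eq[OF a_in] Rg_def[symmetric] by blast
  have "vtx (len - 1 + len) = vtx (len - 1)" unfolding vtx_add len(2) by (simp add: vtx_def)
  then have vtx: "vtx (Suc (len - 1 + (len - 1))) = u" using last lenS by (metis add_Suc_right)
  then have "w = vtx (len - 1 + (len - 1))" using pred_unique[OF w(1)] w(2) by simp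
  then have "\<not> up (Suc (len - 1 + (len - 1)))" using up_Suc vtx w by auto
  then show "\<not> up (len - 1)" using vtx last by (simp add: up_def)
qed

subsection \<open>Runs\<close>

text \<open>The number of changes between upper and lower vertices up to step \<open>i\<close>, which is the number of the run that
contains \<open>vtx i\<close>. Since \<open>y\<close> is upper with a lower predecessor, upper runs get even numbers, and the changes
in one full turn are as many as the runs.\<close>

definition run :: "nat \<Rightarrow> nat" where
  "run i = (\<Sum>k<i. if up (Suc k) = up k then 0 else 1)"

lemma run_0 [simp]: "run 0 = 0"
  and run_Suc: "run (Suc i) = (if up (Suc i) = up i then run i else Suc (run i))"
  by (simp_all add: run_def)

lemma run_mono: "i \<le> k \<Longrightarrow> run i \<le> run k"
  by (induction k rule: dec_induct) (auto simp: run_Suc)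

lemma even_run: "even (run i) \<longleftrightarrow> up i"
  by (induction i) (auto simp: run_Suc up_len)

lemma run_onto: "j \<le> run i \<Longrightarrow> \<exists>k\<le>i. run k = j"
proof (induction i)
  case (Suc i)
  then show ?case by (cases "j \<le> run i") (auto simp: run_Suc le_Suc_eq split: if_splits)
qed simp

definition m :: nat where "m = run len"

lemma run_last: "run (len - 1) = m - 1" "0 < m" and even_m: "even m"
proof -
  have "Suc (len - 1) = len" using len(1) by simp
  then have "m = Suc (run (len - 1))" using run_Suc[of "len - 1"] up_len not_up_last by (simp add: m_def)
  then show "run (len - 1) = m - 1" "0 < m" by auto
  show "even m" using even_run up_len by (simp add: m_def)
qed

lemma run_less: "i < len \<Longrightarrow> run i < m"
proof -
  assume "i < len"
  then have "i \<le> len - 1" by linarith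
  then show "run i < m" using run_mono[of i "len - 1"] run_last by simp
qed

lemma run_ex: "j < m \<Longrightarrow> \<exists>i<len. run i = j"
  using run_onto[of j len] by (metis le_neq_implies_less less_imp_le m_def nat_less_le)

lemma run_order:
  assumes "i \<le> k" "run i = run k"
  shows "even (run i) \<Longrightarrow> vtx i \<le> vtx k" and "odd (run i) \<Longrightarrow> vtx k \<le> vtx i"
proof -
  have "if even (run i) then vtx i \<le> vtx k else vtx k \<le> vtx i"
    using assms
  proof (induction k rule: dec_induct)
    case (step k)
    have "run i \<le> run k" "run k \<le> run (Suc k)"
      using step run_mono[of i k] run_mono[of k "Suc k"] by auto
    then have eq: "run i = run k" "run (Suc k) = run k" using step by auto
    then show ?case
      using step.IH up_Suc[of k] not_up_Suc[of k] even_run[of "Suc k"] by (auto split: if_splits)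
  qed simp
  then show "even (run i) \<Longrightarrow> vtx i \<le> vtx k" and "odd (run i) \<Longrightarrow> vtx k \<le> vtx i" by auto
qed

definition Run :: "nat \<Rightarrow> nat set" where "Run j = {v \<in> Rg. run (pos v) = j}"

definition c :: "nat \<Rightarrow> nat" where "c j = vtx (LEAST i. run i = j)"

lemma c_props:
  assumes "j < m"
  shows "c j \<in> Run j" and "v \<in> Run j \<Longrightarrow> pos (c j) \<le> pos v"
proof -
  let ?i = "LEAST i. run i = j"
  obtain k where k: "k < len" "run k = j" using run_ex[OF assms] by blast
  have i: "run ?i = j" "?i \<le> k" using k(2) by (auto intro: LeastI Least_le)
  then have p: "pos (c j) = ?i" unfolding c_def using pos_vtx k(1) by simp
  then show "c j \<in> Run j" using i(1) vtx_Rg by (simp add: Run_def c_def)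
  show "pos (c j) \<le> pos v" if "v \<in> Run j"
    using that unfolding p by (auto simp: Run_def intro: Least_le)
qed

lemma c_extremal:
  assumes "j < m" "v \<in> Run j"
  shows "even j \<Longrightarrow> c j \<le> v" and "odd j \<Longrightarrow> v \<le> c j"
proof -
  have v: "v \<in> Rg" "run (pos v) = j" and c: "c j \<in> Rg" "run (pos (c j)) = j"
    using assms(2) c_props(1)[OF assms(1)] by (auto simp: Run_def)
  show "even j \<Longrightarrow> c j \<le> v" and "odd j \<Longrightarrow> v \<le> c j"
    using run_order[OF c_props(2)[OF assms]] v c pos(2)[OF v(1)] pos(2)[OF c(1)] by auto
qed

definition ring_b :: "nat \<Rightarrow> nat" where
  "ring_b v = (if run (Suc (pos v)) = run (pos v) then a v else 0)"

lemma ring_b_nonzero: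
  assumes v: "v \<in> Rg" and nz: "ring_b v \<noteq> 0"
  shows "ring_b v = a v" "pos (a v) = Suc (pos v)" "run (pos (a v)) = run (pos v)" "Suc (pos v) < len"
proof -
  have eq: "run (Suc (pos v)) = run (pos v)" using nz by (simp add: ring_b_def split: if_splits)
  then show "ring_b v = a v" by (simp add: ring_b_def)
  show less: "Suc (pos v) < len"
  proof (rule ccontr)
    assume "\<not> ?thesis"
    then have "Suc (pos v) = len" using pos(1)[OF v] by simp
    then show False using eq run_less[OF pos(1)[OF v]] by (simp add: m_def)
  qed
  have "a v = vtx (Suc (pos v))" using pos(2)[OF v] by (simp add: vtx_Suc)
  then show "pos (a v) = Suc (pos v)" using pos_vtx[OF less] by simp
  then show "run (pos (a v)) = run (pos v)" using eq by simp
qed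

lemma next_in_run:
  assumes v: "v \<in> Rg" and w: "w \<in> Rg" "run (pos w) = run (pos v)" "pos v < pos w"
  shows "ring_b v = a v" and "a v \<in> Run (run (pos v))"
    and "even (run (pos v)) \<Longrightarrow> v < a v \<and> a v \<le> w" and "odd (run (pos v)) \<Longrightarrow> a v < v \<and> w \<le> a v"
proof -
  have eq: "run (Suc (pos v)) = run (pos v)"
    using run_mono[of "pos v" "Suc (pos v)"] run_mono[of "Suc (pos v)" "pos w"] w by simp
  then show b: "ring_b v = a v" by (simp add: ring_b_def)
  have av: "a v \<in> Rg" using a_Rg v by blast
  then have "a v \<in> S" using Rg_sub by blast
  then have nz: "ring_b v \<noteq> 0" using b S_pos by simp
  note p = ring_b_nonzero[OF v nz]
  show "a v \<in> Run (run (pos v))" using p av by (simp add: Run_def)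
  have vtx: "vtx (Suc (pos v)) = a v" "vtx (pos v) = v" "vtx (pos w) = w"
    using pos(2)[OF v] pos(2)[OF w(1)] by (auto simp: vtx_Suc)
  show "v < a v \<and> a v \<le> w" if "even (run (pos v))"
    using up_Suc[of "pos v"] even_run[of "Suc (pos v)"] run_order(1)[of "Suc (pos v)" "pos w"] that eq w vtx
    by simp
  show "a v < v \<and> w \<le> a v" if "odd (run (pos v))"
    using not_up_Suc[of "pos v"] even_run[of "Suc (pos v)"] run_order(2)[of "Suc (pos v)" "pos w"] that eq w vtx
    by simp
qed

lemma last_of_run:
  assumes v: "v \<in> Rg" "ring_b v = 0"
  shows "a v = c (Suc (run (pos v)) mod m)" and "run (Suc (pos v)) = Suc (run (pos v))"
proof -
  let ?i = "pos v" and ?j = "run (pos v)"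
  have "a v \<in> Rg" using a_Rg v by blast
  then have "a v \<noteq> 0" using Rg_sub S_pos by blast
  then have step: "run (Suc ?i) = Suc ?j"
    using v(2) run_Suc[of ?i] by (auto simp: ring_b_def split: if_splits)
  then show "run (Suc ?i) = Suc ?j" .
  have vtx: "a v = vtx (Suc ?i)" using pos(2)[OF v(1)] by (simp add: vtx_Suc)
  show "a v = c (Suc ?j mod m)"
  proof (cases "Suc ?i = len")
    case True
    then have "Suc ?j = m" using step by (simp add: m_def)
    moreover have "(LEAST i. run i = 0) = 0" by (rule Least_equality) auto
    ultimately show ?thesis using True vtx len(2) by (simp add: c_def)
  next
    case False
    then have "Suc ?j < m" using run_less[of "Suc ?i"] pos(1)[OF v(1)] step by simp
    moreover have "(LEAST i. run i = Suc ?j) = Suc ?i"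
    proof (rule Least_equality)
      show "Suc ?i \<le> k" if "run k = Suc ?j" for k
        using run_mono[of k ?i] that by (cases "k \<le> ?i") auto
    qed (rule step)
    ultimately show ?thesis using vtx by (simp add: c_def)
  qed
qed

lemma last_of_run_ex:
  assumes "j < m"
  obtains r where "r \<in> Run j" "ring_b r = 0"
proof -
  have "finite {i. i < len \<and> run i = j}" "{i. i < len \<and> run i = j} \<noteq> {}" using run_ex[OF assms] by auto
  then obtain i where i: "i < len" "run i = j" and max: "\<And>k. k < len \<Longrightarrow> run k = j \<Longrightarrow> k \<le> i"
    using Max_in[of "{i. i < len \<and> run i = j}"] Max_ge[of "{i. i < len \<and> run i = j}"] by blast
  have "run (Suc i) \<noteq> run i"
  proof
    assume eq: "run (Suc i) = run i"
    then have "Suc i \<noteq> len" using i assms by (auto simp: m_def)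
    then show False using max[of "Suc i"] eq i by simp
  qed
  then have "vtx i \<in> Run j" "ring_b (vtx i) = 0" using i pos_vtx vtx_Rg by (auto simp: Run_def ring_b_def)
  then show ?thesis by (rule that)
qed

subsection \<open>The walkers of the runs\<close>

text \<open>The position of the walker of run \<open>j\<close> as the ring prescribes it. That it is the walker of a tree is shown in
\<open>token_eq_E\<close>.\<close>

definition E :: "nat \<Rightarrow> nat \<Rightarrow> nat" where
  "E j t =
    (if even j then (if \<exists>v\<in>Run j. t \<le> v then Min {v \<in> Run j. t \<le> v} else 0)
     else (if \<exists>v\<in>Run j. v < t then Max {v \<in> Run j. v < t} else 0))"

lemma finite_Run: "finite (Run j)" using finite_Rg by (simp add: Run_def)

lemma Run_sub: "Run j \<subseteq> S" using Rg_sub by (auto simp: Run_def)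

lemma E_even_eq: "even j \<Longrightarrow> v \<in> Run j \<Longrightarrow> t \<le> v \<Longrightarrow> (\<And>w. w \<in> Run j \<Longrightarrow> t \<le> w \<Longrightarrow> v \<le> w) \<Longrightarrow> E j t = v"
  unfolding E_def using finite_Run by (auto intro!: Min_eqI)

lemma E_odd_eq: "odd j \<Longrightarrow> v \<in> Run j \<Longrightarrow> v < t \<Longrightarrow> (\<And>w. w \<in> Run j \<Longrightarrow> w < t \<Longrightarrow> w \<le> v) \<Longrightarrow> E j t = v"
  unfolding E_def using finite_Run by (auto intro!: Max_eqI)

lemma E_in: "E j t \<noteq> 0 \<Longrightarrow> E j t \<in> Run j"
proof -
  have "Min {v \<in> Run j. t \<le> v} \<in> Run j" if "\<exists>v\<in>Run j. t \<le> v"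
    using Min_in[of "{v \<in> Run j. t \<le> v}"] finite_Run that by auto
  moreover have "Max {v \<in> Run j. v < t} \<in> Run j" if "\<exists>v\<in>Run j. v < t"
    using Max_in[of "{v \<in> Run j. v < t}"] finite_Run that by auto
  ultimately show "E j t \<noteq> 0 \<Longrightarrow> E j t \<in> Run j" by (auto simp: E_def split: if_splits)
qed

lemma E_zero_iff: "E j t = 0 \<longleftrightarrow> (\<forall>v\<in>Run j. if even j then v < t else t \<le> v)"
proof -
  have z: "0 \<notin> Run j" using Run_sub S_pos by blast
  show ?thesis
  proof (cases "even j")
    case True
    show ?thesis
    proof (cases "\<exists>v\<in>Run j. t \<le> v")
      case ex: True
      have "Min {v \<in> Run j. t \<le> v} \<in> {v \<in> Run j. t \<le> v}"
        using ex finite_Run by (intro Min_in) auto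
      then have "Min {v \<in> Run j. t \<le> v} \<noteq> 0" using z by (metis (no_types, lifting) mem_Collect_eq)
      then have "E j t \<noteq> 0" unfolding E_def using ex True by simp
      then show ?thesis using ex True by (auto simp: not_less)
    qed (use True in \<open>auto simp: E_def not_le\<close>)
  next
    case False
    show ?thesis
    proof (cases "\<exists>v\<in>Run j. v < t")
      case ex: True
      have "Max {v \<in> Run j. v < t} \<in> {v \<in> Run j. v < t}"
        using ex finite_Run by (intro Max_in) auto
      then have "Max {v \<in> Run j. v < t} \<noteq> 0" using z by (metis (no_types, lifting) mem_Collect_eq)
      then have "E j t \<noteq> 0" unfolding E_def using ex False by simp
      then show ?thesis using ex False by (auto simp: not_le)
    qed (use False in \<open>auto simp: E_def not_less\<close>)
  qed
qed

lemma E_still: "t \<notin> Run j \<Longrightarrow> E j (Suc t) = E j t"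
proof -
  assume t: "t \<notin> Run j"
  have same: "Suc t \<le> v \<longleftrightarrow> t \<le> v" "v < Suc t \<longleftrightarrow> v < t" if "v \<in> Run j" for v
  proof -
    have "v \<noteq> t" using t that by blast
    then show "Suc t \<le> v \<longleftrightarrow> t \<le> v" "v < Suc t \<longleftrightarrow> v < t" by linarith+
  qed
  have "{v \<in> Run j. Suc t \<le> v} = {v \<in> Run j. t \<le> v}" "{v \<in> Run j. v < Suc t} = {v \<in> Run j. v < t}"
    using same by blast+
  moreover have "(\<exists>v\<in>Run j. Suc t \<le> v) = (\<exists>v\<in>Run j. t \<le> v)" "(\<exists>v\<in>Run j. v < Suc t) = (\<exists>v\<in>Run j. v < t)"
    using same by blast+
  ultimately show "E j (Suc t) = E j t" unfolding E_def by presburger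
qed

lemma E_moves:
  assumes t: "t \<in> Run j"
  shows "even j \<Longrightarrow> E j t = t \<and> E j (Suc t) = ring_b t" and "odd j \<Longrightarrow> E j t = ring_b t \<and> E j (Suc t) = t"
proof -
  have tR: "t \<in> Rg" "run (pos t) = j" using t by (auto simp: Run_def)
  have later: "pos t < pos w" if "w \<in> Run j" "if even j then t < w else w < t" for w
  proof (rule ccontr)
    assume "\<not> ?thesis"
    then have "pos w \<le> pos t" by simp
    moreover have "w \<in> Rg" "run (pos w) = j" using that by (auto simp: Run_def)
    ultimately show False
      using run_order[of "pos w" "pos t"] tR that(2) pos(2) by (auto split: if_splits)
  qed
  have next_ok: "ring_b t \<in> Run j" "if even j then t < ring_b t else ring_b t < t" if "ring_b t \<noteq> 0"
  proof -
    note p = ring_b_nonzero[OF tR(1) that]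
    have "a t \<in> Rg" using a_Rg tR(1) by blast
    then show "ring_b t \<in> Run j" using p tR by (simp add: Run_def)
    show "if even j then t < ring_b t else ring_b t < t"
      using next_in_run(3,4)[OF tR(1) \<open>a t \<in> Rg\<close>] p tR by auto
  qed
  have closest: "ring_b t \<noteq> 0 \<and> (if even j then ring_b t \<le> w else w \<le> ring_b t)"
    if w: "w \<in> Run j" "if even j then t < w else w < t" for w
  proof -
    have "w \<in> Rg" "run (pos w) = run (pos t)" using w tR by (auto simp: Run_def)
    note nx = next_in_run[OF tR(1) this later[OF w]]
    have "a t \<in> S" using nx(2) Run_sub by blast
    then show ?thesis using nx(1,3,4) tR(2) S_pos by simp
  qed
  show "E j t = t \<and> E j (Suc t) = ring_b t" if j: "even j"
  proof
    show "E j t = t" using j t by (intro E_even_eq) auto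
    show "E j (Suc t) = ring_b t"
    proof (cases "ring_b t = 0")
      case True
      then show ?thesis using closest j E_zero_iff[of j "Suc t"] by (metis less_Suc_eq_le not_le)
    next
      case False
      then show ?thesis using next_ok closest j by (intro E_even_eq) auto
    qed
  qed
  show "E j t = ring_b t \<and> E j (Suc t) = t" if j: "odd j"
  proof
    show "E j (Suc t) = t" using j t by (intro E_odd_eq) auto
    show "E j t = ring_b t"
    proof (cases "ring_b t = 0")
      case True
      then show ?thesis using closest j E_zero_iff[of j t] by (metis not_le)
    next
      case False
      then show ?thesis using next_ok closest j by (intro E_odd_eq) auto
    qed
  qed
qed

lemma E_start: "j < m \<Longrightarrow> E j 0 = (if even j then c j else 0)"
  using c_props(1)[of j] c_extremal(1)[of j] E_even_eq[of j "c j" 0] E_zero_iff[of j 0] by auto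

lemma E_end: "j < m \<Longrightarrow> E j n = (if even j then 0 else c j)"
  using c_props(1)[of j] c_extremal(2)[of j] E_odd_eq[of j "c j" n] E_zero_iff[of j n] Run_sub[of j] S_less
  by auto

lemma last_vs_next:
  assumes r: "r \<in> Run j" "ring_b r = 0" and j: "j < m"
  shows "if even j then c (Suc j mod m) < r else r < c (Suc j mod m)"
proof -
  have rR: "r \<in> Rg" "run (pos r) = j" using r by (auto simp: Run_def)
  have "c (Suc j mod m) = vtx (Suc (pos r))" "run (Suc (pos r)) = Suc j"
    using last_of_run[OF rR(1) r(2)] rR pos(2) by (auto simp: vtx_Suc)
  then show ?thesis
    using up_Suc[of "pos r"] not_up_Suc[of "pos r"] even_run[of "Suc (pos r)"] pos(2)[OF rR(1)] by auto
qed

lemma E_next: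
  assumes j: "j < m" and zero: "E j t = 0"
  shows "E (Suc j mod m) t = c (Suc j mod m)"
proof -
  let ?k = "Suc j mod m"
  have k: "?k < m" using run_last(2) by simp
  have par: "even ?k \<longleftrightarrow> odd j"
  proof (cases "Suc j = m")
    case True
    have "odd j" using even_m unfolding True[symmetric] by simp
    moreover have "Suc j mod m = 0" using True by simp
    ultimately show ?thesis by simp
  qed (use j in simp)
  obtain r where r: "r \<in> Run j" "ring_b r = 0" using last_of_run_ex[OF j] .
  have side: "if even j then r < t else t \<le> r" using zero r(1) E_zero_iff by blast
  note side' = last_vs_next[OF r j]
  show ?thesis
  proof (cases "even j")
    case True
    then have "c ?k < t" "odd ?k" using side side' par by auto
    then show ?thesis using c_props(1)[OF k] c_extremal(2)[OF k] by (intro E_odd_eq) auto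
  next
    case False
    then have "t \<le> c ?k" "even ?k" using side side' par by auto
    then show ?thesis using c_props(1)[OF k] c_extremal(1)[OF k] by (intro E_even_eq) auto
  qed
qed

subsection \<open>The trees hanging off the ring\<close>

definition depth :: "nat \<Rightarrow> nat" where "depth s = (LEAST d. (a ^^ d) s \<in> Rg)"

lemma depth: "s \<in> S \<Longrightarrow> (a ^^ depth s) s \<in> Rg" and depth_le: "(a ^^ d) s \<in> Rg \<Longrightarrow> depth s \<le> d"
proof -
  show "(a ^^ depth s) s \<in> Rg" if s: "s \<in> S"
  proof -
    obtain d where "(a ^^ d) s = y" using reaches_ring_vertex[OF s y_Rg] by blast
    then have "(a ^^ d) s \<in> Rg" using y_Rg by simp
    then show ?thesis unfolding depth_def by (rule LeastI)
  qed
  show "depth s \<le> d" if "(a ^^ d) s \<in> Rg" using that unfolding depth_def by (rule Least_le)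
qed

lemma depth_Suc:
  assumes "s \<in> S" "s \<notin> Rg" shows "depth s = Suc (depth (a s))"
proof -
  have as: "a s \<in> S" using a_in assms by blast
  have "(a ^^ Suc (depth (a s))) s \<in> Rg" using depth[OF as] by (simp add: funpow_swap1)
  then have "depth s \<le> Suc (depth (a s))" by (rule depth_le)
  moreover obtain d where d: "depth s = Suc d" using depth[OF assms(1)] assms(2)
    by (metis funpow_0 not0_implies_Suc)
  moreover have "(a ^^ d) (a s) \<in> Rg" using depth[OF assms(1)] d by (simp add: funpow_swap1)
  then have "depth (a s) \<le> d" by (rule depth_le)
  ultimately show ?thesis by simp
qed

text \<open>The last vertex before the ring on the path from \<open>s\<close>.\<close>

definition limb :: "nat \<Rightarrow> nat" where "limb s = (a ^^ (depth s - 1)) s"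

lemma limb_step: "s \<in> S \<Longrightarrow> s \<notin> Rg \<Longrightarrow> a s \<notin> Rg \<Longrightarrow> limb (a s) = limb s"
  using depth_Suc[of s] depth_Suc[of "a s"] a_in by (auto simp: limb_def funpow_swap1 Pi_iff)

lemma limb_base: "s \<in> S \<Longrightarrow> s \<notin> Rg \<Longrightarrow> a s \<in> Rg \<Longrightarrow> limb s = s"
  using depth_Suc[of s] depth_le[of 0 "a s"] by (simp add: limb_def)

definition ring_piece :: "nat \<Rightarrow> nat" where "ring_piece v = run (pos v)"

definition prv :: "nat \<Rightarrow> nat" where "prv i = (if i = 0 then m - 1 else i - 1)"

text \<open>The criterion of \<open>tree_necklace.cut_iff\<close>, with \<open>E\<close> for the walkers. A vertex that is cut off becomes a child
of the root that is placed on its former target at that time, which is the root of one of the two preceding trees.\<close>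

definition cut :: "nat \<Rightarrow> bool" where "cut w \<longleftrightarrow> E (ring_piece (a w)) w = a w"

definition tree_piece :: "nat \<Rightarrow> nat" where
  "tree_piece w =
    (let i = ring_piece (a w) in
     if \<not> cut w then i else if E (prv i) w \<noteq> 0 then prv i else prv (prv i))"

definition \<kappa> :: "nat \<Rightarrow> nat" where
  "\<kappa> s = (if s \<in> Rg then ring_piece s else tree_piece (limb s))"

definition b :: "nat \<Rightarrow> nat" where
  "b s = (if s \<notin> S then s else if s \<in> Rg then ring_b s else if a s \<in> Rg \<and> cut s then 0 else a s)"

lemma ring_piece_less: "v \<in> Rg \<Longrightarrow> ring_piece v < m"
  using pos run_less by (simp add: ring_piece_def)

lemma prv: "i < m \<Longrightarrow> prv i < m" "i < m \<Longrightarrow> Suc (prv i) mod m = i"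
  by (auto simp: prv_def)

lemma Run_piece: "v \<in> Run j \<longleftrightarrow> v \<in> Rg \<and> \<kappa> v = j"
  by (auto simp: Run_def \<kappa>_def ring_piece_def)

lemma \<kappa>_less:
  assumes "s \<in> S" shows "\<kappa> s < m"
proof (cases "s \<in> Rg")
  case True
  then show ?thesis using ring_piece_less by (simp add: \<kappa>_def)
next
  case False
  have "a (limb s) = (a ^^ depth s) s"
    using depth_Suc[OF assms False] by (simp add: limb_def)
  then have "a (limb s) \<in> Rg" using depth[OF assms] by simp
  then show ?thesis using False ring_piece_less prv(1) by (auto simp: \<kappa>_def tree_piece_def Let_def)
qed

lemma b_in: "s \<in> S \<Longrightarrow> b s \<in> insert 0 S"
  using a_in by (auto simp: b_def ring_b_def Pi_iff)

lemma b_nonzero: "s \<in> S \<Longrightarrow> b s \<noteq> 0 \<Longrightarrow> b s = a s"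
  unfolding b_def ring_b_def by presburger

lemma \<kappa>_b:
  assumes s: "s \<in> S" and nz: "b s \<noteq> 0"
  shows "\<kappa> (b s) = \<kappa> s"
proof (cases "s \<in> Rg")
  case True
  then have "ring_b s \<noteq> 0" using nz s by (simp add: b_def)
  moreover have "a s \<in> Rg" using a_Rg True by blast
  ultimately show ?thesis
    using ring_b_nonzero[OF True] b_nonzero[OF s nz] True by (simp add: \<kappa>_def ring_piece_def)
next
  case nonring: False
  show ?thesis
  proof (cases "a s \<in> Rg")
    case True
    then have "\<not> cut s" using nz s nonring by (auto simp: b_def)
    then show ?thesis using b_nonzero[OF s nz] nonring True limb_base[OF s nonring True]
      by (simp add: \<kappa>_def tree_piece_def)
  next
    case False
    then show ?thesis using b_nonzero[OF s nz] nonring limb_step[OF s nonring False] by (simp add: \<kappa>_def)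
  qed
qed

lemma cut_root:
  assumes s: "s \<in> S" "s \<notin> Rg" and zero: "b s = 0"
  defines "i \<equiv> ring_piece (a s)"
  shows "a s \<in> Rg" "E i s = a s" "i < m" "\<kappa> s = (if E (prv i) s \<noteq> 0 then prv i else prv (prv i))"
proof -
  have "a s \<in> S" using a_in s by blast
  then have "a s \<noteq> 0" by (rule S_pos)
  then have c: "a s \<in> Rg" "cut s" using zero s by (auto simp: b_def split: if_splits)
  then show "a s \<in> Rg" "E i s = a s" "i < m" using ring_piece_less by (auto simp: cut_def i_def)
  show "\<kappa> s = (if E (prv i) s \<noteq> 0 then prv i else prv (prv i))"
    using c s limb_base[OF s c(1)] by (simp add: \<kappa>_def tree_piece_def i_def Let_def)
qed

lemma to_root:
  assumes "s \<in> S" shows "\<exists>i. (b ^^ i) s = 0"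
proof -
  have step: "\<exists>i. (b ^^ i) s = 0" if "b s = 0 \<or> (\<exists>i. (b ^^ i) (b s) = 0)" for s
    using that
  proof
    assume "b s = 0"
    then have "(b ^^ 1) s = 0" by simp
    then show ?thesis by blast
  next
    assume "\<exists>i. (b ^^ i) (b s) = 0"
    then obtain i where "(b ^^ i) (b s) = 0" by blast
    then have "(b ^^ Suc i) s = 0" by (simp add: funpow_swap1)
    then show ?thesis by blast
  qed
  have ring: "\<exists>i. (b ^^ i) v = 0" if "v \<in> Rg" for v
    using that
  proof (induction "len - pos v" arbitrary: v rule: less_induct)
    case less
    have bv: "b v = ring_b v" using less.prems Rg_sub by (auto simp: b_def)
    show ?case
    proof (cases "ring_b v = 0")
      case False
      note p = ring_b_nonzero[OF less.prems False]
      have "a v \<in> Rg" using a_Rg less.prems by blast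
      then have "\<exists>i. (b ^^ i) (a v) = 0" using less.hyps[of "a v"] p by simp
      then show ?thesis using step[of v] bv p by simp
    qed (use step[of v] bv in simp)
  qed
  show ?thesis
    using assms
  proof (induction "depth s" arbitrary: s rule: less_induct)
    case less
    show ?case
    proof (cases "s \<in> Rg")
      case False
      have "a s \<in> S" using a_in less.prems by blast
      then have "\<exists>i. (b ^^ i) (a s) = 0" using less.hyps[of "a s"] depth_Suc[OF less.prems False] by simp
      then show ?thesis using step[of s] b_nonzero[OF less.prems] by metis
    qed (rule ring)
  qed
qed

text \<open>The edge of a vertex \<open>t\<close> off the ring must not move the token on \<open>E j t\<close>. An edge to \<open>E j t\<close> from a vertex of
tree \<open>j\<close> has been cut, and for an edge to 0 the tree was chosen such that \<open>E j t\<close> is not 0.\<close>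

lemma token_eq_E:
  assumes j: "j < m"
  shows "token (tree_of \<kappa> b j) t (if even j then c j else 0) = E j t"
proof (induction t)
  case 0
  then show ?case using E_start[OF j] by simp
next
  case (Suc t)
  have "transpose t (tree_of \<kappa> b j t) (E j t) = E j (Suc t)"
  proof (cases "t \<in> S \<and> \<kappa> t = j")
    case False
    then have "t \<notin> Run j" "tree_of \<kappa> b j t = t" using Run_piece Rg_sub by (auto simp: tree_of_def b_def)
    then show ?thesis using E_still by simp
  next
    case tS: True
    then have Tt: "tree_of \<kappa> b j t = b t" by (simp add: tree_of_def)
    show ?thesis
    proof (cases "t \<in> Rg")
      case True
      then have "t \<in> Run j" "b t = ring_b t" using tS Run_piece by (auto simp: b_def)
      then show ?thesis using E_moves[of t j] Tt by (cases "even j") auto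
    next
      case False
      have "E j t \<noteq> t"
        using E_in[of j t] S_pos[of t] tS False by (auto simp: Run_def)
      moreover have "E j t \<noteq> b t"
      proof (cases "b t = 0")
        case True
        note k = cut_root[OF _ False True]
        let ?i = "ring_piece (a t)"
        have "E j t \<noteq> 0"
        proof
          assume zero: "E j t = 0"
          then have j_eq: "j = prv (prv ?i)" "E (prv ?i) t = 0" using k(4) tS by (auto split: if_splits)
          then have "E (prv ?i) t = c (prv ?i)"
            using E_next[OF j zero] prv(2)[OF prv(1)[OF k(3)]] tS by simp
          moreover have "c (prv ?i) \<in> S" using c_props(1)[OF prv(1)[OF k(3)]] tS Run_sub by blast
          ultimately show False using j_eq(2) S_pos by metis
        qed
        then show ?thesis using True by simp
      next
        case nz: False
        show ?thesis
        proof
          assume eq: "E j t = b t"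
          have Ea: "E j t = a t" using eq b_nonzero nz tS by simp
          have "E j t \<in> Run j" using E_in[of j t] eq nz by simp
          then have "a t \<in> Rg" "ring_piece (a t) = j"
            unfolding Ea by (auto simp: Run_def ring_piece_def)
          moreover from this have "cut t" using Ea by (simp add: cut_def)
          ultimately have "b t = 0" using tS False by (simp add: b_def)
          then show False using nz by simp
        qed
      qed
      moreover have "t \<notin> Run j" using False by (simp add: Run_def)
      ultimately show ?thesis using Tt E_still by simp
    qed
  qed
  then show ?case using Suc by simp
qed

sublocale necklace: tree_necklace S n m \<kappa> b c
proof
  show "even m" "0 < m" "S \<subseteq> {0<..<n}" by (rule even_m run_last(2) S_sub)+
  show "\<kappa> s < m" "b s \<in> insert 0 S" "\<exists>i. (b ^^ i) s = 0" if "s \<in> S" for s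
    using that by (rule \<kappa>_less b_in to_root)+
  show "b s = s" if "s \<notin> S" for s using that by (simp add: b_def)
  show "\<kappa> (b s) = \<kappa> s" if "s \<in> S" "b s \<noteq> 0" for s using that by (rule \<kappa>_b)
  show "c j \<in> S" "\<kappa> (c j) = j" if "j < m" for j
    using c_props(1)[OF that] Run_sub Run_piece by auto
  show "token (tree_of \<kappa> b j) n (c j) = 0" if "j < m" "even j" for j
    using token_eq_E[OF that(1), of n] E_end[OF that(1)] that(2) by simp
  show "token (tree_of \<kappa> b j) n 0 = c j" if "j < m" "odd j" for j
    using token_eq_E[OF that(1), of n] E_end[OF that(1)] that(2) by simp
  fix j assume j: "j < m"
  obtain r where r: "r \<in> Run j" "ring_b r = 0" using last_of_run_ex[OF j] .
  then have "r \<in> S" "\<kappa> r = j" "b r = 0" using Run_sub Run_piece by (auto simp: b_def)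
  then show "\<exists>s\<in>S. \<kappa> s = j \<and> b s = 0 \<and> c (Suc j mod m) < s" if "even j"
    using last_vs_next[OF r j] that by auto
  show "\<exists>s\<in>S. \<kappa> s = j \<and> b s = 0 \<and> s < c (Suc j mod m)" if "odd j"
    using last_vs_next[OF r j] that \<open>r \<in> S\<close> \<open>\<kappa> r = j\<close> \<open>b r = 0\<close> by auto
qed

lemma walker_eq_E: "j < m \<Longrightarrow> necklace.walker j t = E j t"
  using token_eq_E by (simp add: necklace.walker_def)

lemma glue_eq:
  assumes s: "s \<in> S" shows "necklace.glue s = a s"
proof (cases "b s = 0")
  case False
  then show ?thesis using necklace.glue_b[OF s] b_nonzero[OF s] by simp
next
  case zero: True
  show ?thesis
  proof (cases "s \<in> Rg")
    case True
    then have rb: "ring_b s = 0" "s \<in> Run (\<kappa> s)" using zero s Run_piece by (auto simp: b_def)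
    have "E (\<kappa> s) s \<in> {s, b s}"
      using E_moves[OF rb(2)] rb(1) zero by (cases "even (\<kappa> s)") simp_all
    then have "s \<in> necklace.R"
      using necklace.in_R_iff[OF s] walker_eq_E[OF \<kappa>_less[OF s]] by simp
    then have "necklace.glue s = c (Suc (\<kappa> s) mod m)"
      using necklace.glue_at_end[OF _ zero] by (simp add: necklace.nxt_def)
    then show ?thesis using last_of_run(1)[OF True rb(1)] rb(2) by (simp add: Run_def)
  next
    case False
    let ?i = "ring_piece (a s)"
    note k = cut_root[OF s False zero]
    have "a s \<in> S" using k(1) Rg_sub by blast
    then have "a s \<noteq> 0" by (rule S_pos)
    then have "necklace.root_place (\<kappa> s) s = a s"
      using k prv[of ?i] prv[of "prv ?i"] walker_eq_E[of ?i s] walker_eq_E[of "prv ?i" s]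
      by (auto simp: necklace.root_place_def necklace.nxt_def)
    then show ?thesis using necklace.glue_root[OF s zero] by simp
  qed
qed

lemma c_0: "c 0 = y"
proof -
  have "(LEAST i. run i = 0) = 0" by (rule Least_equality) auto
  then show ?thesis by (simp add: c_def)
qed

end

section \<open>The cycles of the trees and of the unicycle\<close>

context tree_necklace
begin

lemma X_nonempty: "j < m \<Longrightarrow> c j \<in> X j"
  using c_in \<kappa>_c by (simp add: X_def)

lemma token_T_cycle:
  assumes j: "j < m"
  obtains D where "distinct D" "set D = X j" "token (T j) n = cycle_of_list (D @ [0])"
proof -
  let ?Z = "insert 0 (X j)"
  have closed: "T j s \<in> ?Z" if "s \<in> ?Z" for s
    using that b_in[of s] \<kappa>_b[of s] by (auto simp: X_def tree_of_def b_zero)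
  have out: "T j s = s" if "s \<notin> ?Z" for s
    using that T_neq_iff[of j s] by (auto simp: X_def)
  have fin: "finite ?Z" using finite_S by (simp add: X_def)
  have "0 < n" using S_less[OF c_in[OF j]] by simp
  then have sub: "?Z \<subseteq> {..<n}" using S_less by (auto simp: X_def)
  have root: "\<exists>i. (T j ^^ i) s = 0" if "s \<in> ?Z" for s
  proof (cases "s = 0")
    case False
    then obtain i where "(b ^^ i) s = 0" using to_root \<open>s \<in> ?Z\<close> by (auto simp: X_def)
    moreover have "(b ^^ i) s \<in> ?Z \<and> (T j ^^ i) s = (b ^^ i) s" for i
    proof (induction i)
      case (Suc i)
      then have "T j ((b ^^ i) s) = b ((b ^^ i) s)"
        by (auto simp: tree_of_def X_def b_zero)
      then show ?case using Suc closed[of "(b ^^ i) s"] by simp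
    qed (use that in simp)
    ultimately show ?thesis by metis
  qed (auto intro: exI[of _ 0])
  have trans: "Y = ?Z" if "Y \<subseteq> ?Z" "Y \<noteq> {}" "\<And>x. x \<in> Y \<Longrightarrow> token (T j) n x \<in> Y" for Y
    using tree_invariant_set[OF fin sub _ T_zero closed out root that] by simp
  have outside: "token (T j) n x = x" if "x \<notin> ?Z" for x
    by (rule token_outside(2)[OF closed out that])
  have diff: "?Z - {0} = X j" using X_pos by auto
  have in_Z: "token (T j) n x \<in> ?Z" if "x \<in> ?Z" for x
    using that by (simp only: token_T_in)
  have zero_in: "0 \<in> ?Z" by simp
  obtain D where "distinct D" "set D = ?Z - {0}" "token (T j) n = cycle_of_list (D @ [0])"
    by (rule transitive_perm_is_cycle[OF fin zero_in bij_token in_Z outside trans])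
  then show thesis using that unfolding diff by blast
qed

lemma cycle_of_tree:
  assumes D: "distinct D" "set D = X j" "token (T j) n = cycle_of_list (D @ [0])" and j: "j < m"
  shows "D \<noteq> []" "successively (\<lambda>x y. token (T j) n x = y) D"
    "token (T j) n (last D) = 0" "token (T j) n 0 = hd D"
    "even j \<Longrightarrow> last D = c j" "odd j \<Longrightarrow> hd D = c j"
proof -
  show ne: "D \<noteq> []" using X_nonempty[OF j] D(2) by auto
  have "0 \<notin> set D" using D(2) X_pos by auto
  then have dist: "distinct (D @ [0])" using D(1) by simp
  have "successively (\<lambda>x y. token (T j) n x = y) (D @ [0])"
    "token (T j) n (last (D @ [0])) = hd (D @ [0])"
    using cycle_of_list_steps[OF dist] unfolding D(3)[symmetric] by simp_all
  then show "successively (\<lambda>x y. token (T j) n x = y) D"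
    and l: "token (T j) n (last D) = 0" and h: "token (T j) n 0 = hd D"
    using ne by (simp_all add: successively_append_iff)
  show "last D = c j" if "even j" using l rising[OF j that] by (metis token_inj)
  show "hd D = c j" if "odd j" using h falling[OF j that] by simp
qed

lemma nxt_nxt:
  assumes "m = 2 * k" "i < k"
  shows "nxt (2 * i) = Suc (2 * i)" "nxt (Suc (2 * i)) = 2 * (Suc i mod k)"
    "nxt (2 * (Suc i mod k)) = Suc (2 * (Suc i mod k))"
proof -
  show "nxt (2 * i) = Suc (2 * i)" unfolding nxt_def using assms(2) by (simp add: assms(1))
  have "nxt (Suc (2 * i)) = 2 * Suc i mod (2 * k)" unfolding nxt_def by (simp add: assms(1))
  then show "nxt (Suc (2 * i)) = 2 * (Suc i mod k)" by (simp only: mult_mod_right)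
  have "Suc i mod k < k" using assms by simp
  then show "nxt (2 * (Suc i mod k)) = Suc (2 * (Suc i mod k))" unfolding nxt_def by (simp add: assms(1))
qed

text \<open>By \<open>token_glue_rising\<close> and \<open>token_glue_falling\<close> the glued digraph acts inside each segment like the tree
of that segment; these lemmas also give the passage to the neighbouring segment, which is the preceding one for
the \<open>A\<^sub>i\<close> and the following one for the \<open>B\<^sub>i\<close>.\<close>

lemma glue_cycles:
  assumes m: "m = 2 * k" and len: "length As = k" "length Bs = k"
    and As: "\<And>i. i < k \<Longrightarrow> distinct (As ! i) \<and> set (As ! i) = X (2 * i) \<and>
        token (T (2 * i)) n = cycle_of_list (As ! i @ [0])"
    and Bs: "\<And>i. i < k \<Longrightarrow> distinct (Bs ! i) \<and> set (Bs ! i) = X (Suc (2 * i)) \<and>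
        token (T (Suc (2 * i))) n = cycle_of_list (Bs ! i @ [0])"
  shows "distinct (concat (rev As))" "distinct (concat Bs)"
    "set (concat (rev As)) = {s \<in> S. even (\<kappa> s)}" "set (concat Bs) = {s \<in> S. odd (\<kappa> s)}"
    "token glue n = cycle_of_list (concat (rev As)) \<circ> cycle_of_list (concat Bs)"
proof -
  have k: "0 < k" using m m_pos by simp
  have lt: "2 * i < m" "Suc (2 * i) < m" if "i < k" for i using that m by auto
  note A = cycle_of_tree[OF As[THEN conjunct1] As[THEN conjunct2, THEN conjunct1]
      As[THEN conjunct2, THEN conjunct2] lt(1)]
  note B = cycle_of_tree[OF Bs[THEN conjunct1] Bs[THEN conjunct2, THEN conjunct1]
      Bs[THEN conjunct2, THEN conjunct2] lt(2)]
  have dist: "distinct (concat Ls)"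
    if "length Ls = k" "\<And>i. i < k \<Longrightarrow> distinct (Ls ! i) \<and> set (Ls ! i) = X (f i)" "inj f"
      "\<And>i. i < k \<Longrightarrow> Ls ! i \<noteq> []" for Ls f
  proof (rule distinct_concat)
    have disj: "set (Ls ! i) \<inter> set (Ls ! j) = {}" if "i < k" "j < k" "i \<noteq> j" for i j
      using that \<open>\<And>i. i < k \<Longrightarrow> distinct (Ls ! i) \<and> set (Ls ! i) = X (f i)\<close> \<open>inj f\<close>
      by (auto simp: X_def inj_eq)
    then have "Ls ! i \<noteq> Ls ! j" if "i < k" "j < k" "i \<noteq> j" for i j
      using that \<open>\<And>i. i < k \<Longrightarrow> Ls ! i \<noteq> []\<close> by (metis inf.idem set_empty)
    then show "distinct Ls" using \<open>length Ls = k\<close> by (simp add: distinct_conv_nth)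
    show "distinct L" if "L \<in> set Ls" for L
      using that \<open>\<And>i. i < k \<Longrightarrow> distinct (Ls ! i) \<and> set (Ls ! i) = X (f i)\<close> \<open>length Ls = k\<close>
      by (metis in_set_conv_nth)
    show "set L \<inter> set M = {}" if "L \<in> set Ls" "M \<in> set Ls" "L \<noteq> M" for L M
      using that disj \<open>length Ls = k\<close> by (metis in_set_conv_nth)
  qed
  have sets: "set (concat As) = {s \<in> S. even (\<kappa> s)}" "set (concat Bs) = {s \<in> S. odd (\<kappa> s)}"
  proof -
    have "set (concat As) = (\<Union>i<k. X (2 * i))"
      using As len by (auto simp: set_conv_nth[of As])
    also have "\<dots> = {s \<in> S. even (\<kappa> s)}" using \<kappa>_less m by (fastforce simp: X_def elim!: evenE)
    finally show "set (concat As) = {s \<in> S. even (\<kappa> s)}" .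
    have "set (concat Bs) = (\<Union>i<k. X (Suc (2 * i)))"
      using Bs len by (auto simp: set_conv_nth[of Bs])
    also have "\<dots> = {s \<in> S. odd (\<kappa> s)}" using \<kappa>_less m by (fastforce simp: X_def elim!: oddE)
    finally show "set (concat Bs) = {s \<in> S. odd (\<kappa> s)}" .
  qed
  have "distinct (concat As)"
    using dist[of As "\<lambda>i. 2 * i"] len As A(1) by (simp add: inj_def)
  then show dA: "distinct (concat (rev As))" by (simp add: distinct_concat_rev)
  show dB: "distinct (concat Bs)"
    using dist[of Bs "\<lambda>i. Suc (2 * i)"] len Bs B(1) by (simp add: inj_def)
  show sA: "set (concat (rev As)) = {s \<in> S. even (\<kappa> s)}" using sets(1) by simp
  show sB: "set (concat Bs) = {s \<in> S. odd (\<kappa> s)}" by (rule sets(2))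
  let ?\<sigma> = "token glue n"
  have blockA: "successively (\<lambda>x y. ?\<sigma> x = y) (As ! i)" if i: "i < k" for i
    unfolding successively_conv_nth
  proof (intro allI impI)
    fix q assume q: "Suc q < length (As ! i)"
    have "As ! i ! q \<noteq> last (As ! i)"
      using q As[OF i] A(1)[OF i i i i] by (simp add: last_conv_nth nth_eq_iff_index_eq)
    then have "As ! i ! q \<noteq> c (2 * i)" using A(5)[OF i i i i] by simp
    moreover have "As ! i ! q \<in> X (2 * i)" using q As[OF i] by (metis Suc_lessD nth_mem)
    ultimately have "?\<sigma> (As ! i ! q) = token (T (2 * i)) n (As ! i ! q)"
      using token_glue_rising(1)[OF lt(1)[OF i]] by simp
    then show "?\<sigma> (As ! i ! q) = As ! i ! Suc q"
      using successively_nth[OF A(2)[OF i i i i] q] by simp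
  qed
  have linkA: "?\<sigma> (last (As ! (Suc i mod k))) = hd (As ! i)" if i: "i < k" for i
  proof -
    have i': "Suc i mod k < k" using k by simp
    have "last (As ! (Suc i mod k)) = c (nxt (nxt (2 * i)))"
      using A(5)[OF i' i' i' i'] nxt_nxt[OF m i] by simp
    then show ?thesis using token_glue_rising(2)[OF lt(1)[OF i]] A(4)[OF i i i i] by simp
  qed
  have blockB: "successively (\<lambda>x y. ?\<sigma> x = y) (Bs ! i)" if i: "i < k" for i
    unfolding successively_conv_nth
  proof (intro allI impI)
    fix q assume q: "Suc q < length (Bs ! i)"
    have "Bs ! i ! q \<in> X (Suc (2 * i))" "Bs ! i ! Suc q \<in> X (Suc (2 * i))"
      using q Bs[OF i] by (metis Suc_lessD nth_mem)+
    moreover from this have "Bs ! i ! Suc q \<noteq> 0" using X_pos by blast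
    moreover have "token (T (Suc (2 * i))) n (Bs ! i ! q) = Bs ! i ! Suc q"
      using successively_nth[OF B(2)[OF i i i i] q] .
    ultimately show "?\<sigma> (Bs ! i ! q) = Bs ! i ! Suc q"
      using token_glue_falling[OF lt(2)[OF i]] by simp
  qed
  have linkB: "?\<sigma> (last (Bs ! i)) = hd (Bs ! (Suc i mod k))" if i: "i < k" for i
  proof -
    have i': "Suc i mod k < k" using k by simp
    have "last (Bs ! i) \<in> X (Suc (2 * i))" using Bs[OF i] B(1)[OF i i i i] by (metis last_in_set)
    then have "?\<sigma> (last (Bs ! i)) = c (nxt (nxt (Suc (2 * i))))"
      using token_glue_falling[OF lt(2)[OF i]] B(3)[OF i i i i] by simp
    then show ?thesis using B(6)[OF i' i' i' i'] nxt_nxt[OF m i] by simp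
  qed
  have onA: "cycle_of_list (concat (rev As)) x = ?\<sigma> x" if x: "x \<in> set (concat (rev As))" for x
  proof (rule concat_cycle_agrees[OF dA _ k])
    show "length (rev As) = k" using len by simp
    show "rev As ! i \<noteq> [] \<and> successively (\<lambda>x y. ?\<sigma> x = y) (rev As ! i)" if "i < k" for i
    proof -
      have "k - Suc i < k" using that by simp
      then show ?thesis using blockA A(1) len that by (simp add: rev_nth)
    qed
    show "?\<sigma> (last (rev As ! i)) = hd (rev As ! (Suc i mod k))" if i: "i < k" for i
    proof (cases "Suc i = k")
      case True
      then show ?thesis using linkA[of "k - 1"] len k by (simp add: rev_nth)
    next
      case False
      then have q: "Suc i < k" using i by simp
      then have "Suc (k - Suc (Suc i)) = k - Suc i" by simp
      then show ?thesis using linkA[of "k - Suc (Suc i)"] len q i by (simp add: rev_nth)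
    qed
  qed (rule x)
  have onB: "cycle_of_list (concat Bs) x = ?\<sigma> x" if x: "x \<in> set (concat Bs)" for x
    using concat_cycle_agrees[OF dB len(2) k _ _ x] blockB B(1) linkB by blast
  show "?\<sigma> = cycle_of_list (concat (rev As)) \<circ> cycle_of_list (concat Bs)"
  proof
    fix x
    consider "x \<in> S" "even (\<kappa> x)" | "x \<in> S" "odd (\<kappa> x)" | "x \<notin> S" by blast
    then show "?\<sigma> x = (cycle_of_list (concat (rev As)) \<circ> cycle_of_list (concat Bs)) x"
    proof cases
      case 1
      then have "x \<in> set (concat (rev As))" "x \<notin> set (concat Bs)" unfolding sA sB by auto
      then show ?thesis using onA id_outside_supp[of x "concat Bs"] by simp
    next
      case 2
      then have x: "x \<in> set (concat Bs)" unfolding sB by auto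
      then have "cycle_of_list (concat Bs) x \<in> set (concat Bs)"
        using cycle_is_surj[OF dB] by blast
      then have "cycle_of_list (concat Bs) x \<notin> set (concat (rev As))" unfolding sA sB by auto
      then show ?thesis using onB[OF x] id_outside_supp[of _ "concat (rev As)"] by simp
    next
      case 3
      then have "x \<notin> set (concat (rev As))" "x \<notin> set (concat Bs)" unfolding sA sB by auto
      moreover have "?\<sigma> x = x"
        using 3 glue_in by (intro token_outside(2)[of S]) (auto simp: glue_def Pi_iff)
      ultimately show ?thesis using id_outside_supp[of x] by simp
    qed
  qed
qed

end

lemma glue_cong:
  assumes "tree_necklace S n m \<kappa> b c" "tree_necklace S n m \<kappa>' b' c'"
    and "\<And>s. s \<in> S \<Longrightarrow> \<kappa>' s = \<kappa> s" "\<And>s. s \<in> S \<Longrightarrow> b' s = b s" "\<And>j. j < m \<Longrightarrow> c' j = c j"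
    and "s \<in> S"
  shows "tree_necklace.glue S m \<kappa>' b' c' s = tree_necklace.glue S m \<kappa> b c s"
proof -
  interpret P: tree_necklace S n m \<kappa> b c by fact
  interpret Q: tree_necklace S n m \<kappa>' b' c' by fact
  have "tree_of \<kappa>' b' j s = tree_of \<kappa> b j s" for j s
    using assms(3,4)[of s] P.b_out[of s] Q.b_out[of s] by (cases "s \<in> S") (auto simp: tree_of_def)
  then have T: "tree_of \<kappa>' b' j = tree_of \<kappa> b j" for j by blast
  have "Q.walker j t = P.walker j t" if "j < m" for j t
    using assms(5)[OF that] by (simp add: P.walker_def Q.walker_def T)
  then have "Q.root_place j t = P.root_place j t" for j t
    by (simp add: P.root_place_def Q.root_place_def P.nxt_def Q.nxt_def P.m_pos)
  then show ?thesis using assms(3,4,6) by (simp add: P.glue_def Q.glue_def P.place_def Q.place_def)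
qed

section \<open>Trees with root 0 that represent a cycle\<close>

lemma funpow_cong_on:
  assumes "a \<in> X \<rightarrow> X" "\<And>x. x \<in> X \<Longrightarrow> b x = a x" "s \<in> X"
  shows "(b ^^ i) s = (a ^^ i) s"
proof (induction i)
  case (Suc i)
  then show ?case using assms(2)[OF funpow_in[OF assms(3,1), of i]] by simp
qed simp

lemma rooted_tree_representation_iff:
  assumes "set (D @ [0]) \<subseteq> {..<n}"
  shows "f \<in> representations (set (D @ [0])) \<pi> \<and> is_tree_with_root (set (D @ [0])) f 0 \<longleftrightarrow>
    f \<in> set (D @ [0]) \<rightarrow>\<^sub>E set (D @ [0]) \<and> f 0 = 0 \<and> (\<forall>s\<in>set D. \<exists>i. (f ^^ i) s = 0) \<and>
    token (\<lambda>s. if s \<in> set (D @ [0]) then f s else s) n = \<pi>"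
proof (cases "f \<in> set (D @ [0]) \<rightarrow>\<^sub>E set (D @ [0])")
  case True
  then have "f \<in> set (D @ [0]) \<rightarrow> set (D @ [0])" by auto
  note tree = is_tree_with_root_iff[OF this, of 0]
  have "(f ^^ 0) 0 = 0" by simp
  then have "(\<forall>s\<in>set (D @ [0]). \<exists>i. (f ^^ i) s = 0) \<longleftrightarrow> (\<forall>s\<in>set D. \<exists>i. (f ^^ i) s = 0)"
    by (metis Un_iff empty_iff empty_set insert_iff list.set(2) set_append)
  then show ?thesis
    using True unfolding representations_def tree represented_perm_eq_token[OF assms] by auto
qed (auto simp: representations_def)

lemma zero_neighbours_eq:
  assumes "f 0 = 0" "0 \<notin> set D"
  shows "zero_neighbours (set (D @ [0])) f = {s \<in> set D. f s = 0}"
proof -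
  have "s \<noteq> 0" if "s \<in> set D" for s using that assms(2) by metis
  then show ?thesis using assms(1) by (auto simp: zero_neighbours_def edges_def)
qed

lemma zero_has_child:
  assumes "(f ^^ i) s = 0" "s \<in> X" "0 \<notin> X" "f \<in> X \<rightarrow> insert 0 X"
  shows "\<exists>v\<in>X. f v = 0"
  using assms(1,2)
proof (induction i arbitrary: s)
  case 0
  then show ?case using assms(3) by auto
next
  case (Suc i)
  have "(f ^^ i) (f s) = 0" using Suc.prems(1) by (simp add: funpow_swap1)
  then show ?case using Suc assms(4) by (cases "f s = 0") auto
qed

lemma beta_iff:
  assumes f: "f \<in> set (D @ [0]) \<rightarrow>\<^sub>E set (D @ [0])" "f 0 = 0" "\<forall>s\<in>set D. \<exists>i. (f ^^ i) s = 0"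
    and D: "0 \<notin> set D" "D \<noteq> []"
  shows "beta_plus (set (D @ [0])) f > x \<longleftrightarrow> (\<exists>s\<in>set D. f s = 0 \<and> x < s)"
    and "beta_minus (set (D @ [0])) f < x \<longleftrightarrow> (\<exists>s\<in>set D. f s = 0 \<and> s < x)"
proof -
  have "f \<in> set D \<rightarrow> insert 0 (set D)" using f(1) by auto
  moreover obtain s i where "s \<in> set D" "(f ^^ i) s = 0" using f(3) D(2) by (metis last_in_set)
  ultimately have "{s \<in> set D. f s = 0} \<noteq> {}" using zero_has_child[of i f s "set D"] D(1) by blast
  moreover have "finite {s \<in> set D. f s = 0}" by simp
  ultimately show "beta_plus (set (D @ [0])) f > x \<longleftrightarrow> (\<exists>s\<in>set D. f s = 0 \<and> x < s)"
    and "beta_minus (set (D @ [0])) f < x \<longleftrightarrow> (\<exists>s\<in>set D. f s = 0 \<and> s < x)"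
    unfolding beta_plus_def beta_minus_def zero_neighbours_eq[of f D, OF f(2) D(1)]
    by (auto simp: Max_gr_iff Min_less_iff)
qed

section \<open>Decompositions with trees, and marked unicycles\<close>

lemma digraph_cong:
  assumes "\<And>s. s \<in> S \<Longrightarrow> a' s = a s"
  shows "is_unicycle S a' = is_unicycle S a" "upper_vertices S a' = upper_vertices S a"
    "lower_vertices S a' = lower_vertices S a" "upturns S a' = upturns S a"
proof -
  have e: "edges S a' = edges S a" using assms by (rule edges_cong)
  have r: "ring_vertices S a' = ring_vertices S a" unfolding ring_vertices_def e ..
  show "is_unicycle S a' = is_unicycle S a"
    unfolding is_unicycle_def connected_digraph_def r e ..
  show u: "upper_vertices S a' = upper_vertices S a" unfolding upper_vertices_def r e ..
  show l: "lower_vertices S a' = lower_vertices S a" unfolding lower_vertices_def r e ..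
  show "upturns S a' = upturns S a" unfolding upturns_def u l e ..
qed

lemma cycle_of_list_at_last:
  assumes "distinct (D @ [z])" "D \<noteq> []"
  shows "cycle_of_list (D @ [z]) (last D) = z" "cycle_of_list (D @ [z]) z = hd D"
  using cycle_of_list_steps[OF assms(1)] assms(2)
  by (simp_all add: successively_append_iff)

text \<open>The cycle through \<open>x\<close> is determined by the permutation.\<close>

lemma two_cycles_unique:
  assumes dist: "distinct A" "distinct B" "distinct A'" "distinct B'"
    and disj: "set A \<inter> set B = {}" "set A' \<inter> set B' = {}"
    and union: "set A' \<union> set B' = set A \<union> set B"
    and eq: "cycle_of_list A' \<circ> cycle_of_list B' = cycle_of_list A \<circ> cycle_of_list B"
    and x: "x \<in> set A" "x \<in> set A'"
  shows "same_cycle A' A" "same_cycle B' B"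
proof -
  let ?\<pi> = "cycle_of_list A \<circ> cycle_of_list B"
  have val: "(cycle_of_list C \<circ> cycle_of_list D) v =
      (if v \<in> set C then cycle_of_list C v else cycle_of_list D v)"
    if "distinct D" "set C \<inter> set D = {}" for C D :: "nat list" and v
  proof (cases "v \<in> set D")
    case True
    then have "cycle_of_list D v \<in> set D" using cycle_is_surj[OF that(1)] by blast
    then show ?thesis using True that(2) id_outside_supp[of "cycle_of_list D v" C] by auto
  qed (use id_outside_supp[of v D] id_outside_supp[of v C] in auto)
  have \<pi>: "?\<pi> v = (if v \<in> set A then cycle_of_list A v else cycle_of_list B v)" for v
    using val[OF dist(2) disj(1)] .
  have \<pi>': "?\<pi> v = (if v \<in> set A' then cycle_of_list A' v else cycle_of_list B' v)" for v
    using val[OF dist(4) disj(2)] unfolding eq .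
  let ?Y = "set A \<inter> set A'"
  have closed: "cycle_of_list A v \<in> ?Y" "cycle_of_list A' v \<in> ?Y" if "v \<in> ?Y" for v
  proof -
    have "cycle_of_list A v = cycle_of_list A' v" using \<pi>[of v] \<pi>'[of v] that by simp
    moreover have "cycle_of_list A v \<in> set A" "cycle_of_list A' v \<in> set A'"
      using that cycle_is_surj[OF dist(1)] cycle_is_surj[OF dist(3)] by blast+
    ultimately show "cycle_of_list A v \<in> ?Y" "cycle_of_list A' v \<in> ?Y" by auto
  qed
  have "?Y = set A" by (rule cycle_of_list_invariant_set[OF dist(1)]) (use x closed in auto)
  moreover have "?Y = set A'" by (rule cycle_of_list_invariant_set[OF dist(3)]) (use x closed in auto)
  ultimately have sA: "set A' = set A" by simp
  then have sB: "set B' = set B" using union disj by blast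
  have "cycle_of_list A' v = cycle_of_list A v" for v
    using \<pi>[of v] \<pi>'[of v] sA id_outside_supp[of v A] id_outside_supp[of v A'] by (cases "v \<in> set A") auto
  moreover have "cycle_of_list B' v = cycle_of_list B v" for v
  proof (cases "v \<in> set B")
    case True
    then have "v \<notin> set A" using disj by blast
    then show ?thesis using \<pi>[of v] \<pi>'[of v] sA by simp
  next
    case False
    then show ?thesis using sB id_outside_supp[of v] by simp
  qed
  ultimately show "same_cycle A' A" "same_cycle B' B"
    using dist sA sB by (auto simp: same_cycle_def)
qed

definition upper_trees :: "nat list list \<Rightarrow> nat list list \<Rightarrow> nat \<Rightarrow> (nat \<Rightarrow> nat) set" where
  "upper_trees As Bs i =
     {f \<in> representations (set (As ! i @ [0])) (cycle_of_list (As ! i @ [0])).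
        is_tree_with_root (set (As ! i @ [0])) f 0 \<and> beta_plus (set (As ! i @ [0])) f > hd (Bs ! i)}"

definition lower_trees :: "nat \<Rightarrow> nat list list \<Rightarrow> nat list list \<Rightarrow> nat \<Rightarrow> (nat \<Rightarrow> nat) set" where
  "lower_trees k As Bs j =
     {f \<in> representations (set (Bs ! j @ [0])) (cycle_of_list (Bs ! j @ [0])).
        is_tree_with_root (set (Bs ! j @ [0])) f 0 \<and>
        beta_minus (set (Bs ! j @ [0])) f < last (As ! (Suc j mod k))}"

text \<open>The sequences are interleaved as \<open>A\<^sub>1, B\<^sub>1, A\<^sub>2, B\<^sub>2, \<dots>\<close> and numbered from 0. This is the order in which the
ring passes through their trees.\<close>

definition block :: "nat list list \<Rightarrow> nat list list \<Rightarrow> nat \<Rightarrow> nat list" where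
  "block As Bs j = (if even j then As ! (j div 2) else Bs ! (j div 2))"

definition block_index :: "nat list list \<Rightarrow> nat list list \<Rightarrow> nat \<Rightarrow> nat" where
  "block_index As Bs s = (LEAST j. s \<in> set (block As Bs j))"

definition block_tree :: "(nat \<Rightarrow> nat \<Rightarrow> nat) \<Rightarrow> (nat \<Rightarrow> nat \<Rightarrow> nat) \<Rightarrow> nat \<Rightarrow> nat \<Rightarrow> nat" where
  "block_tree F H j = (if even j then F (j div 2) else H (j div 2))"

definition joint_tree :: "nat set \<Rightarrow> nat list list \<Rightarrow> nat list list \<Rightarrow>
    (nat \<Rightarrow> nat \<Rightarrow> nat) \<Rightarrow> (nat \<Rightarrow> nat \<Rightarrow> nat) \<Rightarrow> nat \<Rightarrow> nat" where
  "joint_tree S As Bs F H s = (if s \<in> S then block_tree F H (block_index As Bs s) s else s)"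

definition ring_entry :: "nat list list \<Rightarrow> nat list list \<Rightarrow> nat \<Rightarrow> nat" where
  "ring_entry As Bs j = (if even j then last (block As Bs j) else hd (block As Bs j))"

definition glued :: "nat set \<Rightarrow> nat \<Rightarrow> nat list list \<Rightarrow> nat list list \<Rightarrow>
    (nat \<Rightarrow> nat \<Rightarrow> nat) \<Rightarrow> (nat \<Rightarrow> nat \<Rightarrow> nat) \<Rightarrow> nat \<Rightarrow> nat" where
  "glued S k As Bs F H =
     restrict (tree_necklace.glue S (2 * k) (block_index As Bs) (joint_tree S As Bs F H) (ring_entry As Bs)) S"

locale disjoint_cycles =
  fixes A B :: "nat list"
  assumes A_ne: "A \<noteq> []" and B_ne: "B \<noteq> []"
    and dist_A: "distinct A" and dist_B: "distinct B"
    and zero_A: "0 \<notin> set A" and zero_B: "0 \<notin> set B"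
    and disj: "set A \<inter> set B = {}"
begin

definition "S = set A \<union> set B"
definition "n = Suc (Max S)"

lemma S_sub: "S \<subseteq> {0<..<n}"
proof
  fix s assume s: "s \<in> S"
  have "s \<le> Max S" using s by (intro Max_ge) (auto simp: S_def)
  moreover have "s \<noteq> 0" using s zero_A zero_B unfolding S_def by (metis Un_iff)
  ultimately show "s \<in> {0<..<n}" by (simp add: n_def)
qed

lemma zero_S: "0 \<notin> S" using S_sub by auto

lemma represented_perm_S: "represented_perm S a = token (\<lambda>s. if s \<in> S then a s else s) n"
  using S_sub by (intro represented_perm_eq_token) auto

definition unicycles :: "(nat \<Rightarrow> nat) set" where
  "unicycles = {a \<in> representations S (cycle_of_list A \<circ> cycle_of_list B).
     is_unicycle S a \<and> upper_vertices S a \<subseteq> set A \<and> lower_vertices S a \<subseteq> set B}"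

end

text \<open>One of the objects counted by the inner sum, with the trees for the \<open>A\<^sub>i\<close> in \<open>F\<close> and those for the \<open>B\<^sub>j\<close> in \<open>H\<close>.\<close>

locale decomposition_with_trees = disjoint_cycles +
  fixes k :: nat and As Bs :: "nat list list" and F H :: "nat \<Rightarrow> nat \<Rightarrow> nat"
  assumes k_pos: "0 < k" and decomp: "(As, Bs) \<in> decompositions A B k"
    and F: "F \<in> Pi\<^sub>E {..<k} (upper_trees As Bs)"
    and H: "H \<in> Pi\<^sub>E {..<k} (lower_trees k As Bs)"
begin

abbreviation "piece \<equiv> block As Bs"
abbreviation "tr \<equiv> block_tree F H"
abbreviation "\<kappa> \<equiv> block_index As Bs"
abbreviation "b \<equiv> joint_tree S As Bs F H"
abbreviation "c \<equiv> ring_entry As Bs"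

lemma len: "length As = k" "length Bs = k"
  and nonempty: "D \<in> set As \<union> set Bs \<Longrightarrow> D \<noteq> []"
  and same: "same_cycle (concat (rev As)) A" "same_cycle (concat Bs) B"
  using decomp by (auto simp: decompositions_def)

lemma dist_concat: "distinct (concat As)" "distinct (concat Bs)"
  and set_concat: "set (concat As) = set A" "set (concat Bs) = set B"
  using same by (auto simp: same_cycle_def)

lemma less_cases:
  assumes "j < 2 * k"
  obtains i where "i < k" "j = 2 * i" "piece j = As ! i" "tr j = F i"
  | i where "i < k" "j = Suc (2 * i)" "piece j = Bs ! i" "tr j = H i"
proof (cases "even j")
  case True
  then obtain i where "j = 2 * i" by (elim evenE)
  then show ?thesis using that(1)[of i] assms by (simp add: block_def block_tree_def)
next
  case False
  then obtain i where "j = Suc (2 * i)" by (auto elim!: oddE)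
  then show ?thesis using that(2)[of i] assms by (simp add: block_def block_tree_def)
qed

lemma piece_mem: "j < 2 * k \<Longrightarrow> piece j \<in> (if even j then set As else set Bs)"
  using len by (elim less_cases) auto

lemma piece_props:
  assumes "j < 2 * k"
  shows "piece j \<noteq> []" "distinct (piece j)" "set (piece j) \<subseteq> (if even j then set A else set B)"
    "set (piece j) \<subseteq> S" "0 \<notin> set (piece j)"
proof -
  note mem = piece_mem[OF assms]
  show "piece j \<noteq> []" using mem nonempty by (auto split: if_splits)
  show "distinct (piece j)"
    using mem dist_concat unfolding distinct_concat_iff by (auto split: if_splits)
  show sub: "set (piece j) \<subseteq> (if even j then set A else set B)"
    using mem set_concat by (auto split: if_splits)
  then show "set (piece j) \<subseteq> S" by (auto simp: S_def split: if_splits)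
  then show "0 \<notin> set (piece j)" using zero_S by blast
qed

lemma blocks_disjoint:
  assumes "length Ls = k" "distinct (concat Ls)" "\<And>L. L \<in> set Ls \<Longrightarrow> L \<noteq> []" "p < k" "q < k" "p \<noteq> q"
  shows "set (Ls ! p) \<inter> set (Ls ! q) = {}"
proof -
  have "removeAll [] Ls = Ls" using assms(3) by (metis removeAll_id)
  then have "distinct Ls" and d: "\<forall>ys zs. ys \<in> set Ls \<and> zs \<in> set Ls \<and> ys \<noteq> zs \<longrightarrow> set ys \<inter> set zs = {}"
    using assms(2) unfolding distinct_concat_iff by auto
  then have "Ls ! p \<noteq> Ls ! q" using assms by (simp add: nth_eq_iff_index_eq)
  then show ?thesis using d assms(1,4,5) by (metis nth_mem)
qed

lemma pieces_disjoint:
  assumes "i < 2 * k" "j < 2 * k" "s \<in> set (piece i)" "s \<in> set (piece j)"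
  shows "i = j"
proof (rule ccontr)
  assume "i \<noteq> j"
  have "even i \<longleftrightarrow> even j"
    using piece_props(3)[OF assms(1)] piece_props(3)[OF assms(2)] assms(3,4) disj by (auto split: if_splits)
  then consider p q where "p < k" "q < k" "p \<noteq> q" "piece i = As ! p" "piece j = As ! q"
    | p q where "p < k" "q < k" "p \<noteq> q" "piece i = Bs ! p" "piece j = Bs ! q"
    using \<open>i \<noteq> j\<close> by (rule_tac less_cases[OF assms(1)]; rule_tac less_cases[OF assms(2)]) auto
  then show False
    using blocks_disjoint[of As] blocks_disjoint[of Bs] len dist_concat nonempty assms(3,4)
    by cases (metis UnI1 UnI2 disjoint_iff)+
qed

lemma \<kappa>_eq: "j < 2 * k \<Longrightarrow> s \<in> set (piece j) \<Longrightarrow> \<kappa> s = j"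
  unfolding block_index_def
proof (rule Least_equality)
  fix i assume j: "j < 2 * k" "s \<in> set (piece j)" and i: "s \<in> set (piece i)"
  show "j \<le> i"
  proof (rule ccontr)
    assume "\<not> j \<le> i"
    then show False using pieces_disjoint[of i j s] i j by simp
  qed
qed

lemma piece_cover: "s \<in> S \<Longrightarrow> \<exists>j<2 * k. s \<in> set (piece j)"
proof -
  assume "s \<in> S"
  then consider "s \<in> set (concat As)" | "s \<in> set (concat Bs)" unfolding set_concat S_def by blast
  then show ?thesis
  proof cases
    case 1
    then obtain L where L: "L \<in> set As" "s \<in> set L" by auto
    then obtain i where "i < k" "s \<in> set (As ! i)" using len(1) by (metis in_set_conv_nth)
    then have "2 * i < 2 * k \<and> s \<in> set (piece (2 * i))" by (simp add: block_def)
    then show ?thesis by blast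
  next
    case 2
    then obtain L where L: "L \<in> set Bs" "s \<in> set L" by auto
    then obtain i where "i < k" "s \<in> set (Bs ! i)" using len(2) by (metis in_set_conv_nth)
    then have "Suc (2 * i) < 2 * k \<and> s \<in> set (piece (Suc (2 * i)))" by (simp add: block_def)
    then show ?thesis by blast
  qed
qed

lemma \<kappa>_props: "s \<in> S \<Longrightarrow> \<kappa> s < 2 * k \<and> s \<in> set (piece (\<kappa> s))"
  using piece_cover \<kappa>_eq by metis

lemma c_in_piece: "j < 2 * k \<Longrightarrow> c j \<in> set (piece j)"
  using piece_props(1) by (simp add: ring_entry_def)

lemma piece_zero_sub: "j < 2 * k \<Longrightarrow> set (piece j @ [0]) \<subseteq> {..<n}"
  using piece_props(4)[of j] S_sub by (auto simp: n_def)

lemma tr_props: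
  assumes "j < 2 * k"
  shows "tr j \<in> set (piece j @ [0]) \<rightarrow>\<^sub>E set (piece j @ [0])" "tr j 0 = 0"
    "\<forall>s\<in>set (piece j). \<exists>i. (tr j ^^ i) s = 0"
    "token (\<lambda>s. if s \<in> set (piece j @ [0]) then tr j s else s) n = cycle_of_list (piece j @ [0])"
    "even j \<Longrightarrow> \<exists>s\<in>set (piece j). tr j s = 0 \<and> c (Suc j mod (2 * k)) < s"
    "odd j \<Longrightarrow> \<exists>s\<in>set (piece j). tr j s = 0 \<and> s < c (Suc j mod (2 * k))"
proof -
  let ?X = "set (piece j @ [0])"
  have rep: "tr j \<in> representations ?X (cycle_of_list (piece j @ [0])) \<and> is_tree_with_root ?X (tr j) 0"
    using assms
  proof (cases rule: less_cases)
    case (1 i)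
    then show ?thesis using PiE_mem[OF F, of i] by (auto simp: upper_trees_def)
  next
    case (2 i)
    then show ?thesis using PiE_mem[OF H, of i] by (auto simp: lower_trees_def)
  qed
  note r = rep[unfolded rooted_tree_representation_iff[OF piece_zero_sub[OF assms]]]
  show 1: "tr j \<in> ?X \<rightarrow>\<^sub>E ?X" and 2: "tr j 0 = 0" and 3: "\<forall>s\<in>set (piece j). \<exists>i. (tr j ^^ i) s = 0"
    and "token (\<lambda>s. if s \<in> ?X then tr j s else s) n = cycle_of_list (piece j @ [0])"
    using r by blast+
  note beta = beta_iff[of "tr j", OF 1 2 3 piece_props(5,1)[OF assms]]
  show "\<exists>s\<in>set (piece j). tr j s = 0 \<and> c (Suc j mod (2 * k)) < s" if "even j"
    using assms
  proof (cases rule: less_cases)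
    case (1 i)
    then have "beta_plus ?X (tr j) > hd (Bs ! i)"
      using PiE_mem[OF F, of i] by (auto simp: upper_trees_def)
    moreover have "c (Suc j mod (2 * k)) = hd (Bs ! i)" using 1 by (simp add: ring_entry_def block_def)
    ultimately show ?thesis using beta(1) by simp
  qed (use that in simp)
  show "\<exists>s\<in>set (piece j). tr j s = 0 \<and> s < c (Suc j mod (2 * k))" if "odd j"
    using assms
  proof (cases rule: less_cases)
    case (2 i)
    then have "beta_minus ?X (tr j) < last (As ! (Suc i mod k))"
      using PiE_mem[OF H, of i] by (auto simp: lower_trees_def)
    moreover have "Suc j mod (2 * k) = 2 * (Suc i mod k)"
      using 2(2) by (simp add: mult_mod_right)
    then have "c (Suc j mod (2 * k)) = last (As ! (Suc i mod k))" by (simp add: ring_entry_def block_def)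
    ultimately show ?thesis using beta(2) by simp
  qed (use that in simp)
qed

lemma b_eq: "j < 2 * k \<Longrightarrow> s \<in> set (piece j) \<Longrightarrow> b s = tr j s"
  using \<kappa>_eq piece_props(4) by (auto simp: joint_tree_def)

lemma b_zero: "b 0 = 0"
  using zero_S by (simp add: joint_tree_def)

lemma tree_of_eq:
  assumes "j < 2 * k"
  shows "tree_of \<kappa> b j = (\<lambda>s. if s \<in> set (piece j @ [0]) then tr j s else s)"
proof
  fix s
  consider "s = 0" | "s \<in> set (piece j)" | "s \<notin> set (piece j @ [0])" by fastforce
  then show "tree_of \<kappa> b j s = (if s \<in> set (piece j @ [0]) then tr j s else s)"
  proof cases
    case 1
    then show ?thesis using tr_props(2)[OF assms] by (simp add: tree_of_def b_zero)
  next
    case 2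
    then show ?thesis using \<kappa>_eq[OF assms] b_eq[OF assms] by (simp add: tree_of_def)
  next
    case 3
    then have "s \<in> S \<Longrightarrow> \<kappa> s \<noteq> j" using \<kappa>_props by auto
    then show ?thesis using 3 by (auto simp: tree_of_def joint_tree_def)
  qed
qed

lemma token_tree_of: "j < 2 * k \<Longrightarrow> token (tree_of \<kappa> b j) n = cycle_of_list (piece j @ [0])"
  using tree_of_eq tr_props(4) by simp

sublocale necklace: tree_necklace S n "2 * k" \<kappa> b c
proof
  show "even (2 * k)" "0 < 2 * k" "S \<subseteq> {0<..<n}" using k_pos S_sub by auto
  fix s assume s: "s \<in> S"
  let ?j = "\<kappa> s"
  have j: "?j < 2 * k" "s \<in> set (piece ?j)" using \<kappa>_props[OF s] by auto
  have b: "b s = tr ?j s" using b_eq[OF j] .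
  have b': "b s \<in> set (piece ?j @ [0])" using tr_props(1)[OF j(1)] j(2) unfolding b by auto
  show "\<kappa> s < 2 * k" by (rule j)
  show "b s \<in> insert 0 S" using b' piece_props(4)[OF j(1)] by auto
  show "\<kappa> (b s) = \<kappa> s" if "b s \<noteq> 0" using b' that \<kappa>_eq[OF j(1)] by auto
  obtain i where "(tr ?j ^^ i) s = 0" using tr_props(3)[OF j(1)] j(2) by blast
  moreover have "(b ^^ i) s = (tr ?j ^^ i) s"
  proof (rule funpow_cong_on)
    show "tr ?j \<in> set (piece ?j @ [0]) \<rightarrow> set (piece ?j @ [0])" using tr_props(1)[OF j(1)] by blast
    show "b x = tr ?j x" if "x \<in> set (piece ?j @ [0])" for x
      using that b_eq[OF j(1)] b_zero tr_props(2)[OF j(1)] by auto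
  qed (use j in simp)
  ultimately show "\<exists>i. (b ^^ i) s = 0" by metis
next
  show "b s = s" if "s \<notin> S" for s using that by (simp add: joint_tree_def)
next
  fix j assume j: "j < 2 * k"
  show "c j \<in> S" "\<kappa> (c j) = j" using c_in_piece[OF j] piece_props(4)[OF j] \<kappa>_eq[OF j] by auto
  have d: "distinct (piece j @ [0])" "piece j \<noteq> []" using piece_props[OF j] by auto
  show "token (tree_of \<kappa> b j) n (c j) = 0" if "even j"
    using cycle_of_list_at_last(1)[OF d] that by (simp add: token_tree_of[OF j] ring_entry_def)
  show "token (tree_of \<kappa> b j) n 0 = c j" if "odd j"
    using cycle_of_list_at_last(2)[OF d] that by (simp add: token_tree_of[OF j] ring_entry_def)
  show "\<exists>s\<in>S. \<kappa> s = j \<and> b s = 0 \<and> c (Suc j mod (2 * k)) < s" if "even j"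
    using tr_props(5)[OF j that] b_eq[OF j] \<kappa>_eq[OF j] piece_props(4)[OF j] by (metis subsetD)
  show "\<exists>s\<in>S. \<kappa> s = j \<and> b s = 0 \<and> s < c (Suc j mod (2 * k))" if "odd j"
    using tr_props(6)[OF j that] b_eq[OF j] \<kappa>_eq[OF j] piece_props(4)[OF j] by (metis subsetD)
qed

lemma X_eq: "j < 2 * k \<Longrightarrow> necklace.X j = set (piece j)"
  using \<kappa>_props \<kappa>_eq piece_props(4)[of j] by (auto simp: necklace.X_def)

lemma glued_eq: "glued S k As Bs F H = restrict necklace.glue S"
  by (simp add: glued_def)

lemma glued_in: "glued S k As Bs F H \<in> unicycles"
  and card_upturns_glued: "card (upturns S (glued S k As Bs F H)) = k"
  and start_upturn: "last (As ! 0) \<in> upturns S (glued S k As Bs F H)"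
proof -
  let ?a = "glued S k As Bs F H"
  have a: "?a s = necklace.glue s" if "s \<in> S" for s using that by (simp add: glued_eq)
  have "?a \<in> S \<rightarrow>\<^sub>E S" using necklace.glue_in by (auto simp: glued_eq)
  moreover have "(\<lambda>s. if s \<in> S then ?a s else s) = necklace.glue"
    using a by (auto simp: necklace.glue_def)
  then have rep: "represented_perm S ?a = token necklace.glue n" by (simp add: represented_perm_S)
  have g: "token necklace.glue n = cycle_of_list (concat (rev As)) \<circ> cycle_of_list (concat Bs)"
    "set (concat (rev As)) = {s \<in> S. even (\<kappa> s)}" "set (concat Bs) = {s \<in> S. odd (\<kappa> s)}"
  proof -
    have piece: "piece (2 * i) = As ! i" "piece (Suc (2 * i)) = Bs ! i" for i by (simp_all add: block_def)
    have "distinct (As ! i) \<and> set (As ! i) = necklace.X (2 * i) \<and>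
        token (tree_of \<kappa> b (2 * i)) n = cycle_of_list (As ! i @ [0])" if "i < k" for i
      using piece_props(2)[of "2 * i"] X_eq[of "2 * i"] token_tree_of[of "2 * i"] that by (simp add: piece)
    moreover have "distinct (Bs ! i) \<and> set (Bs ! i) = necklace.X (Suc (2 * i)) \<and>
        token (tree_of \<kappa> b (Suc (2 * i))) n = cycle_of_list (Bs ! i @ [0])" if "i < k" for i
      using piece_props(2)[of "Suc (2 * i)"] X_eq[of "Suc (2 * i)"] token_tree_of[of "Suc (2 * i)"] that
      by (simp add: piece)
    ultimately show "token necklace.glue n = cycle_of_list (concat (rev As)) \<circ> cycle_of_list (concat Bs)"
      "set (concat (rev As)) = {s \<in> S. even (\<kappa> s)}" "set (concat Bs) = {s \<in> S. odd (\<kappa> s)}"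
      using necklace.glue_cycles(3-5)[OF refl len] by blast+
  qed
  have "cycle_of_list (concat (rev As)) = cycle_of_list A" "cycle_of_list (concat Bs) = cycle_of_list B"
    using same by (auto simp: same_cycle_def)
  ultimately have "?a \<in> representations S (cycle_of_list A \<circ> cycle_of_list B)"
    using rep g(1) by (simp add: representations_def)
  moreover have cong: "is_unicycle S ?a = is_unicycle S necklace.glue"
    "upper_vertices S ?a = upper_vertices S necklace.glue"
    "lower_vertices S ?a = lower_vertices S necklace.glue" "upturns S ?a = upturns S necklace.glue"
    using digraph_cong[of S ?a necklace.glue] a by blast+
  moreover have "upper_vertices S ?a \<subseteq> set A" "lower_vertices S ?a \<subseteq> set B"
    using g(2,3) set_concat necklace.R_subset
    unfolding cong necklace.upper_vertices_glue necklace.lower_vertices_glue by auto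
  moreover have "is_unicycle S ?a" unfolding cong by (rule necklace.is_unicycle_glue)
  ultimately show "?a \<in> unicycles" by (simp add: unicycles_def)
  show "card (upturns S ?a) = k" unfolding cong necklace.card_upturns_glue by simp
  have "c 0 \<in> upturns S ?a" unfolding cong necklace.upturns_glue using k_pos by auto
  then show "last (As ! 0) \<in> upturns S ?a" by (simp add: ring_entry_def block_def)
qed

lemma k_le: "k \<le> length A"
proof -
  have "length Ls \<le> length (concat Ls)" if "\<forall>L\<in>set Ls. L \<noteq> []" for Ls :: "nat list list"
    using that by (induction Ls) (auto simp: Suc_le_eq neq_Nil_conv)
  then have "k \<le> length (concat As)" using len(1) nonempty by (metis UnI1)
  also have "\<dots> = length A" using dist_concat(1) set_concat(1) dist_A by (metis distinct_card)
  finally show ?thesis .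
qed

end

context disjoint_cycles
begin

lemma glued_inj:
  assumes "decomposition_with_trees A B k As Bs F H" "decomposition_with_trees A B k' As' Bs' F' H'"
    and eq: "glued S k As Bs F H = glued S k' As' Bs' F' H'" and start: "last (As ! 0) = last (As' ! 0)"
  shows "k' = k" "As' = As" "Bs' = Bs" "F' = F" "H' = H"
proof -
  interpret P: decomposition_with_trees A B k As Bs F H by fact
  interpret Q: decomposition_with_trees A B k' As' Bs' F' H' by fact
  have gl: "P.necklace.glue s = Q.necklace.glue s" if "s \<in> S" for s
    using fun_cong[OF eq[unfolded P.glued_eq Q.glued_eq], of s] that by simp
  have start': "ring_entry As Bs 0 = ring_entry As' Bs' 0" using start by (simp add: ring_entry_def block_def)
  have "2 * k' = 2 * k"
    by (rule tree_necklace_unique(1)[OF P.necklace.tree_necklace_axioms Q.necklace.tree_necklace_axioms])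
      (use gl start' in auto)
  then show kk: "k' = k" by simp
  have "Q.\<kappa> s = P.\<kappa> s \<and> Q.b s = P.b s" if "s \<in> S" for s
    by (rule tree_necklace_unique(2)[OF P.necklace.tree_necklace_axioms Q.necklace.tree_necklace_axioms])
      (use gl start' that in auto)
  then have \<kappa>: "Q.\<kappa> s = P.\<kappa> s" and b: "Q.b s = P.b s" if "s \<in> S" for s using that by auto
  have sets: "set (block As' Bs' j) = set (block As Bs j)" if "j < 2 * k" for j
  proof -
    have "{s \<in> S. Q.\<kappa> s = j} = {s \<in> S. P.\<kappa> s = j}" using \<kappa> by auto
    then show ?thesis
      using P.X_eq[of j] Q.X_eq[of j] that kk by (simp add: P.necklace.X_def Q.necklace.X_def)
  qed
  have bo: "Q.b s = P.b s" for s
    using b[of s] by (cases "s \<in> S") (auto simp: joint_tree_def)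
  have "tree_of Q.\<kappa> Q.b j = tree_of P.\<kappa> P.b j" for j
  proof
    fix s show "tree_of Q.\<kappa> Q.b j s = tree_of P.\<kappa> P.b j s"
      using \<kappa>[of s] bo[of s] by (cases "s \<in> S") (auto simp: tree_of_def joint_tree_def)
  qed
  then have cyc: "cycle_of_list (block As' Bs' j @ [0]) = cycle_of_list (block As Bs j @ [0])"
    if "j < 2 * k" for j
    using P.token_tree_of[of j] Q.token_tree_of[of j] that kk by simp
  have blk: "block As' Bs' j = block As Bs j" if j: "j < 2 * k" for j
  proof -
    have "distinct (block As' Bs' j @ [0])" "distinct (block As Bs j @ [0])"
      using P.piece_props[OF j] Q.piece_props[of j] j kk by auto
    then have "block As' Bs' j @ [0] = block As Bs j @ [0]"
      using sets[OF j] cyc[OF j] by (intro cycle_of_list_unique) auto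
    then show ?thesis by simp
  qed
  have lens: "length As' = length As" "length Bs' = length Bs" using P.len Q.len kk by auto
  show "As' = As"
  proof (rule nth_equalityI[OF lens(1)])
    fix i assume "i < length As'"
    then show "As' ! i = As ! i" using blk[of "2 * i"] Q.len kk by (simp add: block_def)
  qed
  show "Bs' = Bs"
  proof (rule nth_equalityI[OF lens(2)])
    fix i assume "i < length Bs'"
    then show "Bs' ! i = Bs ! i" using blk[of "Suc (2 * i)"] Q.len kk by (simp add: block_def)
  qed
  have trees: "block_tree F' H' j = block_tree F H j" if j: "j < 2 * k" for j
  proof
    fix s
    have j': "j < 2 * k'" using j kk by simp
    consider "s = 0" | "s \<in> set (block As Bs j)" | "s \<notin> set (block As Bs j @ [0])" by fastforce
    then show "block_tree F' H' j s = block_tree F H j s"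
    proof cases
      case 1
      then show ?thesis using P.tr_props(2)[OF j] Q.tr_props(2)[OF j'] by simp
    next
      case 2
      then show ?thesis using P.b_eq[OF j, of s] Q.b_eq[OF j', of s] bo sets[OF j] by simp
    next
      case 3
      then have "s \<notin> set (block As' Bs' j @ [0])" using sets[OF j] by simp
      then show ?thesis
        using PiE_arb[OF P.tr_props(1)[OF j] 3] PiE_arb[OF Q.tr_props(1)[OF j']] by simp
    qed
  qed
  show "F' = F"
  proof
    fix i show "F' i = F i"
    proof (cases "i < k")
      case True
      then show ?thesis using trees[of "2 * i"] by (simp add: block_tree_def)
    next
      case False
      then show ?thesis using PiE_arb[OF P.F, of i] PiE_arb[OF Q.F, of i] kk by simp
    qed
  qed
  show "H' = H"
  proof
    fix i show "H' i = H i"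
    proof (cases "i < k")
      case True
      then show ?thesis using trees[of "Suc (2 * i)"] by (simp add: block_tree_def)
    next
      case False
      then show ?thesis using PiE_arb[OF P.H, of i] PiE_arb[OF Q.H, of i] kk by simp
    qed
  qed
qed

text \<open>The cycles of the trees cut from \<open>a\<close> are the sequences. By \<open>glue_cycles\<close> their concatenations are the two cycles
of the permutation of \<open>a\<close>, and \<open>y\<close> tells which of them is \<open>(A)\<close>.\<close>

lemma glued_surj:
  assumes a: "a \<in> unicycles" and y: "y \<in> upturns S a"
  obtains k As Bs F H where "decomposition_with_trees A B k As Bs F H"
    "glued S k As Bs F H = a" "last (As ! 0) = y"
proof -
  have aS: "a \<in> S \<rightarrow>\<^sub>E S" and perm: "represented_perm S a = cycle_of_list A \<circ> cycle_of_list B"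
    and uni: "is_unicycle S a" and up: "upper_vertices S a \<subseteq> set A"
    using a by (auto simp: unicycles_def representations_def)
  interpret U: marked_unicycle S n a y
    using S_sub aS uni y by unfold_locales auto
  define k where "k = U.m div 2"
  have m: "U.m = 2 * k" using U.even_m by (simp add: k_def)
  have k: "0 < k" using m U.run_last(2) by simp
  have "\<forall>j. \<exists>D. j < U.m \<longrightarrow> distinct D \<and> set D = U.necklace.X j \<and>
      token (tree_of U.\<kappa> U.b j) n = cycle_of_list (D @ [0])"
    by (metis U.necklace.token_T_cycle)
  then obtain D where D: "\<And>j. j < U.m \<Longrightarrow> distinct (D j) \<and> set (D j) = U.necklace.X j \<and>
      token (tree_of U.\<kappa> U.b j) n = cycle_of_list (D j @ [0])"
    by metis
  define As Bs where "As = map (\<lambda>i. D (2 * i)) [0..<k]" and "Bs = map (\<lambda>i. D (Suc (2 * i))) [0..<k]"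
  have len: "length As = k" "length Bs = k" by (simp_all add: As_def Bs_def)
  have blk: "block As Bs j = D j" if "j < 2 * k" for j
    using that by (cases "even j") (auto simp: block_def As_def Bs_def elim!: evenE oddE)
  have nth: "As ! i = D (2 * i)" "Bs ! i = D (Suc (2 * i))" if "i < k" for i
    using that by (simp_all add: As_def Bs_def)
  note tree = U.necklace.cycle_of_tree[OF D[THEN conjunct1] D[THEN conjunct2, THEN conjunct1]
      D[THEN conjunct2, THEN conjunct2]]
  have pieces: "distinct (As ! i) \<and> set (As ! i) = U.necklace.X (2 * i) \<and>
      token (tree_of U.\<kappa> U.b (2 * i)) n = cycle_of_list (As ! i @ [0])"
    "distinct (Bs ! i) \<and> set (Bs ! i) = U.necklace.X (Suc (2 * i)) \<and>
      token (tree_of U.\<kappa> U.b (Suc (2 * i))) n = cycle_of_list (Bs ! i @ [0])" if "i < k" for i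
    using D[of "2 * i"] D[of "Suc (2 * i)"] that m nth by simp_all
  have g: "distinct (concat (rev As))" "distinct (concat Bs)"
    "set (concat (rev As)) = {s \<in> S. even (U.\<kappa> s)}" "set (concat Bs) = {s \<in> S. odd (U.\<kappa> s)}"
    "token U.necklace.glue n = cycle_of_list (concat (rev As)) \<circ> cycle_of_list (concat Bs)"
    using U.necklace.glue_cycles[OF m len] pieces by blast+
  have "(\<lambda>s. if s \<in> S then a s else s) = U.necklace.glue"
    using U.glue_eq by (auto simp: U.necklace.glue_def)
  then have "token U.necklace.glue n = cycle_of_list A \<circ> cycle_of_list B"
    using perm by (simp add: represented_perm_S)
  then have eq: "cycle_of_list (concat (rev As)) \<circ> cycle_of_list (concat Bs) = cycle_of_list A \<circ> cycle_of_list B"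
    using g(5) by simp
  have "y \<in> set A" using y up by (auto simp: upturns_def)
  moreover have "y \<in> set (concat (rev As))"
    unfolding g(3) using U.c_0 U.necklace.c_in[of 0] U.necklace.\<kappa>_c[of 0] U.run_last(2) by auto
  ultimately have same: "same_cycle (concat (rev As)) A" "same_cycle (concat Bs) B"
    using two_cycles_unique[OF dist_A dist_B g(1,2) disj _ _ eq] g(3,4) by (auto simp: S_def)
  have ne: "L \<noteq> []" if L: "L \<in> set As \<union> set Bs" for L
  proof -
    have D_ne: "D j \<noteq> []" if "j < 2 * k" for j using tree(1)[of j] that m by simp
    obtain i where "i < k" "L = D (2 * i) \<or> L = D (Suc (2 * i))" using L by (auto simp: As_def Bs_def)
    then show ?thesis using D_ne[of "2 * i"] D_ne[of "Suc (2 * i)"] by auto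
  qed
  have decomp: "(As, Bs) \<in> decompositions A B k"
    using len ne same by (auto simp: decompositions_def)
  define F where "F = (\<lambda>i\<in>{..<k}. restrict (tree_of U.\<kappa> U.b (2 * i)) (set (As ! i @ [0])))"
  define H where "H = (\<lambda>i\<in>{..<k}. restrict (tree_of U.\<kappa> U.b (Suc (2 * i))) (set (Bs ! i @ [0])))"
  have tree_ok: "f \<in> set (D j @ [0]) \<rightarrow>\<^sub>E set (D j @ [0])" "f 0 = 0"
      "\<forall>s\<in>set (D j). \<exists>i. (f ^^ i) s = 0" "0 \<notin> set (D j)" "D j \<noteq> []"
      "f \<in> representations (set (D j @ [0])) (cycle_of_list (D j @ [0])) \<and>
        is_tree_with_root (set (D j @ [0])) f 0"
      "\<And>s. s \<in> set (D j) \<Longrightarrow> f s = U.b s"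
    if j: "j < 2 * k" and f: "f = restrict (tree_of U.\<kappa> U.b j) (set (D j @ [0]))" for f j
  proof -
    let ?X = "set (D j @ [0])"
    have jm: "j < U.m" using j m by simp
    have setD: "set (D j) = U.necklace.X j" using D[OF jm] by blast
    show zero: "0 \<notin> set (D j)" unfolding setD using U.necklace.X_pos by blast
    show "D j \<noteq> []" using tree(1)[OF jm jm jm jm] .
    show fb: "f s = U.b s" if "s \<in> set (D j)" for s
      using that setD unfolding f by (auto simp: tree_of_def U.necklace.X_def)
    show f0: "f 0 = 0" unfolding f by (simp add: U.necklace.T_zero)
    show fX: "f \<in> ?X \<rightarrow>\<^sub>E ?X"
    proof
      fix s assume s: "s \<in> ?X"
      show "f s \<in> ?X"
      proof (cases "s = 0")
        case False
        then have sD: "s \<in> set (D j)" using s by simp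
        then have "s \<in> S" "U.\<kappa> s = j" unfolding setD by (auto simp: U.necklace.X_def)
        then have "U.b s = 0 \<or> U.b s \<in> U.necklace.X j"
          using U.b_in[of s] U.\<kappa>_b[of s] by (auto simp: U.necklace.X_def)
        then show ?thesis using fb[OF sD] setD by auto
      qed (use f0 in simp)
    qed (simp add: f)
    have b_on: "U.b s = f s" if "s \<in> ?X" for s
      using that fb f0 U.necklace.b_zero by auto
    show roots: "\<forall>s\<in>set (D j). \<exists>i. (f ^^ i) s = 0"
    proof
      fix s assume s: "s \<in> set (D j)"
      then have "s \<in> S" unfolding setD by (auto simp: U.necklace.X_def)
      then obtain i where "(U.b ^^ i) s = 0" using U.to_root by blast
      moreover have "f \<in> ?X \<rightarrow> ?X" using fX by blast
      then have "(U.b ^^ i) s = (f ^^ i) s" by (rule funpow_cong_on) (use b_on s in auto)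
      ultimately have "(f ^^ i) s = 0" by simp
      then show "\<exists>i. (f ^^ i) s = 0" ..
    qed
    have "set (D j) \<subseteq> S" unfolding setD by (auto simp: U.necklace.X_def)
    then have sub: "?X \<subseteq> {..<n}" using S_sub by (auto simp: n_def)
    have "tree_of U.\<kappa> U.b j s = s" if "s \<notin> ?X" for s
      using that U.necklace.T_neq_iff[of j s] setD by (auto simp: U.necklace.X_def)
    then have "(\<lambda>s. if s \<in> ?X then f s else s) = tree_of U.\<kappa> U.b j" by (auto simp: f)
    then show "f \<in> representations ?X (cycle_of_list (D j @ [0])) \<and> is_tree_with_root ?X f 0"
      using D[OF jm] unfolding rooted_tree_representation_iff[OF sub] using fX f0 roots by simp
  qed
  have c_blk: "U.c j = ring_entry As Bs j" if "j < 2 * k" for j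
    using tree(5,6)[of j] that m blk[OF that] by (auto simp: ring_entry_def)
  have F: "F \<in> Pi\<^sub>E {..<k} (upper_trees As Bs)"
  proof
    fix i assume "i \<in> {..<k}"
    then have i: "i < k" "2 * i < 2 * k" "Suc (2 * i) < 2 * k" by auto
    have Fi: "F i = restrict (tree_of U.\<kappa> U.b (2 * i)) (set (D (2 * i) @ [0]))"
      using i nth by (simp add: F_def)
    note ok = tree_ok[OF i(2) Fi]
    obtain s where s: "s \<in> S" "U.\<kappa> s = 2 * i" "U.b s = 0" "U.c (Suc (2 * i) mod U.m) < s"
      using U.necklace.child_above[of "2 * i"] i m by auto
    have "s \<in> set (D (2 * i))" using D[of "2 * i"] s i m by (auto simp: U.necklace.X_def)
    moreover have "U.c (Suc (2 * i) mod U.m) = hd (Bs ! i)"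
      using c_blk[OF i(3)] i m by (simp add: ring_entry_def block_def)
    ultimately have "beta_plus (set (D (2 * i) @ [0])) (F i) > hd (Bs ! i)"
      unfolding beta_iff(1)[of "F i", OF ok(1-5)] using s ok(7) by auto
    then show "F i \<in> upper_trees As Bs i" using ok(6) nth(1)[OF i(1)] by (simp add: upper_trees_def)
  qed (simp add: F_def)
  have H: "H \<in> Pi\<^sub>E {..<k} (lower_trees k As Bs)"
  proof
    fix i assume "i \<in> {..<k}"
    then have i: "i < k" "Suc (2 * i) < 2 * k" by auto
    have Hi: "H i = restrict (tree_of U.\<kappa> U.b (Suc (2 * i))) (set (D (Suc (2 * i)) @ [0]))"
      using i nth by (simp add: H_def)
    note ok = tree_ok[OF i(2) Hi]
    obtain s where s: "s \<in> S" "U.\<kappa> s = Suc (2 * i)" "U.b s = 0" "s < U.c (Suc (Suc (2 * i)) mod U.m)"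
      using U.necklace.child_below[of "Suc (2 * i)"] i m by auto
    have "s \<in> set (D (Suc (2 * i)))" using D[of "Suc (2 * i)"] s i m by (auto simp: U.necklace.X_def)
    moreover have "Suc (Suc (2 * i)) mod U.m = 2 * (Suc i mod k)"
      using m by (simp add: mult_mod_right)
    then have "U.c (Suc (Suc (2 * i)) mod U.m) = last (As ! (Suc i mod k))"
      using c_blk[of "2 * (Suc i mod k)"] k by (simp add: ring_entry_def block_def)
    ultimately have "beta_minus (set (D (Suc (2 * i)) @ [0])) (H i) < last (As ! (Suc i mod k))"
      unfolding beta_iff(2)[of "H i", OF ok(1-5)] using s ok(7) by auto
    then show "H i \<in> lower_trees k As Bs i" using ok(6) nth(2)[OF i(1)] by (simp add: lower_trees_def)
  qed (simp add: H_def)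
  have conf: "decomposition_with_trees A B k As Bs F H"
    using k decomp F H by unfold_locales
  interpret P: decomposition_with_trees A B k As Bs F H by (rule conf)
  have \<kappa>: "P.\<kappa> s = U.\<kappa> s" if "s \<in> S" for s
  proof -
    have j: "U.\<kappa> s < 2 * k" using U.\<kappa>_less[OF that] m by simp
    have "s \<in> set (block As Bs (U.\<kappa> s))"
      unfolding blk[OF j] using D[of "U.\<kappa> s"] j m that by (auto simp: U.necklace.X_def)
    then show ?thesis using P.\<kappa>_eq[OF j] by blast
  qed
  have b: "P.b s = U.b s" if s: "s \<in> S" for s
  proof -
    let ?j = "U.\<kappa> s"
    have j: "?j < 2 * k" using U.\<kappa>_less[OF s] m by simp
    have sD: "s \<in> set (D ?j)" using D[of ?j] j m s by (auto simp: U.necklace.X_def)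
    have "block_tree F H ?j = restrict (tree_of U.\<kappa> U.b ?j) (set (D ?j @ [0]))"
    proof (rule P.less_cases[OF j])
      fix i assume "i < k" "?j = 2 * i" "block_tree F H ?j = F i"
      then show ?thesis using nth by (simp add: F_def)
    next
      fix i assume "i < k" "?j = Suc (2 * i)" "block_tree F H ?j = H i"
      then show ?thesis using nth by (simp add: H_def)
    qed
    then have "block_tree F H ?j s = U.b s" using tree_ok(7)[OF j _ sD] by blast
    then show ?thesis using P.b_eq[OF j, of s] blk[OF j] sD by simp
  qed
  have "P.necklace.glue s = U.necklace.glue s" if "s \<in> S" for s
    using glue_cong[OF U.necklace.tree_necklace_axioms[unfolded m] P.necklace.tree_necklace_axioms _ _ _ that]
      \<kappa> b c_blk m by simp
  then have "glued S k As Bs F H s = a s" if "s \<in> S" for s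
    using that U.glue_eq by (simp add: P.glued_eq)
  moreover have "glued S k As Bs F H \<in> extensional S" by (simp add: glued_def)
  ultimately have "glued S k As Bs F H = a"
    using aS by (intro extensionalityI[of _ S]) (auto simp: PiE_def)
  moreover have "last (As ! 0) = y"
    using c_blk[of 0] U.c_0 k by (simp add: ring_entry_def block_def)
  ultimately show ?thesis using that conf by blast
qed

end

section \<open>Counting\<close>

lemma finite_decompositions:
  assumes "distinct A" "distinct B"
  shows "finite (decompositions A B k)"
proof -
  let ?L = "\<lambda>C :: nat list. {Ls. set Ls \<subseteq> {L. set L \<subseteq> set C \<and> length L \<le> length C} \<and> length Ls = k}"
  have block: "Ls \<in> ?L C"
    if "length Ls = k" "same_cycle (concat Ls) C \<or> same_cycle (concat (rev Ls)) C" for Ls C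
  proof -
    have c: "distinct (concat Ls)" "set (concat Ls) = set C" "distinct C"
      using that(2) by (auto simp: same_cycle_def)
    have "set L \<subseteq> set C \<and> length L \<le> length C" if L: "L \<in> set Ls" for L
    proof
      show sub: "set L \<subseteq> set C" using L c(2) by auto
      have "distinct L" using L c(1) by (simp add: distinct_concat_iff)
      then show "length L \<le> length C" using sub c(3) by (metis card_mono distinct_card finite_set)
    qed
    then show ?thesis using that(1) by blast
  qed
  have "finite (?L C)" for C :: "nat list"
    by (intro finite_lists_length_eq finite_lists_length_le) simp
  then have "finite (?L A \<times> ?L B)" by blast
  moreover have "decompositions A B k \<subseteq> ?L A \<times> ?L B"
    using block by (auto simp: decompositions_def)
  ultimately show ?thesis by (rule finite_subset[rotated])
qed

lemma finite_representations: "finite X \<Longrightarrow> finite (representations X \<pi>)"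
  unfolding representations_def
  by (rule finite_subset[of _ "X \<rightarrow>\<^sub>E X"]) (auto intro: finite_PiE)

context disjoint_cycles
begin

definition tree_decompositions ::
    "nat \<Rightarrow> ((nat list list \<times> nat list list) \<times> ((nat \<Rightarrow> nat \<Rightarrow> nat) \<times> (nat \<Rightarrow> nat \<Rightarrow> nat))) set" where
  "tree_decompositions k =
     (SIGMA D : decompositions A B k.
        Pi\<^sub>E {..<k} (upper_trees (fst D) (snd D)) \<times> Pi\<^sub>E {..<k} (lower_trees k (fst D) (snd D)))"

lemma mem_tree_decompositions_iff:
  "0 < k \<Longrightarrow> ((As, Bs), (F, H)) \<in> tree_decompositions k \<longleftrightarrow> decomposition_with_trees A B k As Bs F H"
  by (auto simp: tree_decompositions_def decomposition_with_trees_def decomposition_with_trees_axioms_def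
      disjoint_cycles_axioms)

lemma finite_upper_trees: "finite (upper_trees As Bs i)"
  and finite_lower_trees: "finite (lower_trees k As Bs i)"
  unfolding upper_trees_def lower_trees_def by (simp_all add: finite_representations)

lemma finite_tree_decompositions: "finite (tree_decompositions k)"
  unfolding tree_decompositions_def
  by (intro finite_SigmaI finite_cartesian_product finite_PiE finite_decompositions dist_A dist_B
      finite_upper_trees finite_lower_trees) auto

lemma card_tree_decompositions:
  "real (card (tree_decompositions k)) =
    (\<Sum>(As, Bs)\<in>decompositions A B k.
        (\<Prod>i<k. real (N'_beta_plus_gt (hd (Bs ! i))
                     (set (As ! i @ [0])) (cycle_of_list (As ! i @ [0])))) *
        (\<Prod>j<k. real (N'_beta_minus_lt (last (As ! (Suc j mod k)))
                     (set (Bs ! j @ [0])) (cycle_of_list (Bs ! j @ [0])))))"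
proof -
  have "card (tree_decompositions k) = (\<Sum>D\<in>decompositions A B k.
      card (Pi\<^sub>E {..<k} (upper_trees (fst D) (snd D)) \<times> Pi\<^sub>E {..<k} (lower_trees k (fst D) (snd D))))"
    unfolding tree_decompositions_def
    by (intro card_SigmaI finite_decompositions dist_A dist_B ballI finite_cartesian_product finite_PiE
        finite_upper_trees finite_lower_trees) auto
  also have "\<dots> = (\<Sum>(As, Bs)\<in>decompositions A B k.
      (\<Prod>i<k. card (upper_trees As Bs i)) * (\<Prod>j<k. card (lower_trees k As Bs j)))"
    by (simp add: card_cartesian_product card_PiE case_prod_beta)
  finally show ?thesis
    by (simp add: upper_trees_def lower_trees_def N'_beta_plus_gt_def N'_beta_minus_lt_def
        case_prod_beta of_nat_sum of_nat_prod)
qed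

lemma decomposition_length: "((As, Bs), (F, H)) \<in> tree_decompositions k \<Longrightarrow> 0 < k \<Longrightarrow> k \<le> length A"
  using decomposition_with_trees.k_le by (simp add: mem_tree_decompositions_iff)

definition mark ::
    "nat \<times> ((nat list list \<times> nat list list) \<times> ((nat \<Rightarrow> nat \<Rightarrow> nat) \<times> (nat \<Rightarrow> nat \<Rightarrow> nat))) \<Rightarrow>
     (nat \<Rightarrow> nat) \<times> nat" where
  "mark = (\<lambda>(k, ((As, Bs), (F, H))). (glued S k As Bs F H, last (As ! 0)))"

text \<open>Simultaneous rotation of the sequences does not change the unicycle, so the last entry of \<open>A\<^sub>1\<close> is
recorded as a mark. It ranges over the \<open>k\<close> upturns of the unicycle.\<close>

lemma bij_mark:
  "bij_betw mark (SIGMA k : {1..length A}. tree_decompositions k) (SIGMA a : unicycles. upturns S a)"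
proof (rule bij_betwI')
  fix p q
  assume p: "p \<in> (SIGMA k : {1..length A}. tree_decompositions k)"
    and q: "q \<in> (SIGMA k : {1..length A}. tree_decompositions k)"
  obtain k As Bs F H where p': "p = (k, ((As, Bs), (F, H)))" by (metis surj_pair)
  obtain k' As' Bs' F' H' where q': "q = (k', ((As', Bs'), (F', H')))" by (metis surj_pair)
  have "decomposition_with_trees A B k As Bs F H" "decomposition_with_trees A B k' As' Bs' F' H'"
    using p q by (auto simp: p' q' mem_tree_decompositions_iff)
  note inj = glued_inj[OF this]
  show "mark p = mark q \<longleftrightarrow> p = q"
    using inj by (auto simp: p' q' mark_def)
next
  fix p assume p: "p \<in> (SIGMA k : {1..length A}. tree_decompositions k)"
  obtain k As Bs F H where p': "p = (k, ((As, Bs), (F, H)))" by (metis surj_pair)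
  have d: "decomposition_with_trees A B k As Bs F H"
    using p by (auto simp: p' mem_tree_decompositions_iff)
  show "mark p \<in> (SIGMA a : unicycles. upturns S a)"
    using decomposition_with_trees.glued_in[OF d] decomposition_with_trees.start_upturn[OF d]
    by (simp add: p' mark_def)
next
  fix q assume "q \<in> (SIGMA a : unicycles. upturns S a)"
  then obtain a y where q: "q = (a, y)" "a \<in> unicycles" "y \<in> upturns S a" by auto
  obtain k As Bs F H where d: "decomposition_with_trees A B k As Bs F H"
    and eq: "glued S k As Bs F H = a" "last (As ! 0) = y"
    using glued_surj[OF q(2,3)] by blast
  have k: "0 < k" "k \<le> length A"
    using decomposition_with_trees.k_pos[OF d] decomposition_with_trees.k_le[OF d] by auto
  have "(k, ((As, Bs), (F, H))) \<in> (SIGMA k : {1..length A}. tree_decompositions k)"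
    using d k by (simp add: mem_tree_decompositions_iff)
  moreover have "q = mark (k, ((As, Bs), (F, H)))" using q(1) eq by (simp add: mark_def)
  ultimately show "\<exists>p\<in>(SIGMA k : {1..length A}. tree_decompositions k). q = mark p" by blast
qed

lemma card_upturns_mark:
  assumes "p \<in> (SIGMA k : {1..length A}. tree_decompositions k)"
  shows "card (upturns S (fst (mark p))) = fst p"
proof -
  obtain k As Bs F H where p': "p = (k, ((As, Bs), (F, H)))" by (metis surj_pair)
  have d: "decomposition_with_trees A B k As Bs F H"
    using assms by (auto simp: p' mem_tree_decompositions_iff)
  show ?thesis using decomposition_with_trees.card_upturns_glued[OF d] by (simp add: p' mark_def)
qed

lemma finite_unicycles: "finite unicycles"
  unfolding unicycles_def by (simp add: finite_representations S_def)

lemma upturns_unicycle: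
  assumes "a \<in> unicycles" shows "finite (upturns S a)" "upturns S a \<noteq> {}"
proof -
  have "upturns S a \<subseteq> S"
    by (auto simp: upturns_def upper_vertices_def ring_vertices_def)
  then show "finite (upturns S a)" by (rule finite_subset) (simp add: S_def)
  interpret unicycle_digraph S n a
    using assms S_sub by unfold_locales (auto simp: unicycles_def representations_def)
  show "upturns S a \<noteq> {}" by (rule upturns_nonempty)
qed

text \<open>Each unicycle carries as many marks as it has upturns, and the weight of each marked unicycle is the
reciprocal of this number.\<close>

lemma card_unicycles:
  "real (card unicycles) = (\<Sum>k\<in>{1..length A}. 1 / real k * real (card (tree_decompositions k)))"
proof -
  have "(\<Sum>k\<in>{1..length A}. 1 / real k * real (card (tree_decompositions k))) =
      (\<Sum>k\<in>{1..length A}. \<Sum>D\<in>tree_decompositions k. 1 / real k)"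
    by simp
  also have "\<dots> = (\<Sum>p\<in>(SIGMA k : {1..length A}. tree_decompositions k). 1 / real (fst p))"
    by (subst sum.Sigma) (auto simp: finite_tree_decompositions case_prod_beta)
  also have "\<dots> = (\<Sum>p\<in>(SIGMA k : {1..length A}. tree_decompositions k).
      1 / real (card (upturns S (fst (mark p)))))"
    using card_upturns_mark by simp
  also have "\<dots> = (\<Sum>q\<in>(SIGMA a : unicycles. upturns S a). 1 / real (card (upturns S (fst q))))"
    by (rule sum.reindex_bij_betw[OF bij_mark])
  also have "\<dots> = (\<Sum>a\<in>unicycles. \<Sum>y\<in>upturns S a. 1 / real (card (upturns S a)))"
    by (subst sum.Sigma) (auto simp: finite_unicycles upturns_unicycle case_prod_beta)
  also have "\<dots> = (\<Sum>a\<in>unicycles. 1)"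
    using upturns_unicycle by (intro sum.cong) auto
  finally show ?thesis by simp
qed

end

theorem proposition8:
  fixes A B :: "nat list"
  assumes "A \<noteq> []" and "B \<noteq> []"
    and "distinct A" and "distinct B"
    and "0 \<notin> set A" and "0 \<notin> set B"
    and "set A \<inter> set B = {}"
  shows "real (N_uni_u A B) =
    (\<Sum>\<^sub>\<infinity>k\<in>{1..}. 1 / real k *
      (\<Sum>(As, Bs)\<in>decompositions A B k.
        (\<Prod>i<k. real (N'_beta_plus_gt (hd (Bs ! i))
                     (set (As ! i @ [0])) (cycle_of_list (As ! i @ [0])))) *
        (\<Prod>j<k. real (N'_beta_minus_lt (last (As ! (Suc j mod k)))
                     (set (Bs ! j @ [0])) (cycle_of_list (Bs ! j @ [0]))))))"
proof -
  interpret disjoint_cycles A B using assms by unfold_locales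
  have empty: "tree_decompositions k = {}" if "k \<in> {1..} - {1..length A}" for k
    using decomposition_length[of _ _ _ _ k] that by fastforce
  have "real (N_uni_u A B) = (\<Sum>k\<in>{1..length A}. 1 / real k * real (card (tree_decompositions k)))"
    unfolding card_unicycles[symmetric] by (simp add: N_uni_u_def unicycles_def S_def)
  also have "\<dots> = (\<Sum>\<^sub>\<infinity>k\<in>{1..length A}. 1 / real k * real (card (tree_decompositions k)))"
    by simp
  also have "\<dots> = (\<Sum>\<^sub>\<infinity>k\<in>{1..}. 1 / real k * real (card (tree_decompositions k)))"
    by (rule infsum_cong_neutral) (auto simp: empty)
  finally show ?thesis unfolding card_tree_decompositions .
qed

end
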